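(* Let $V$ be a grading-restricted vertex algebra. The subspace $A_{00}(V)=\{[v]_{00}+Q^{\infty}(V)\mid v\in V\}$ of $A^{\infty}(V)$ is closed under $\diamond$ and is thus a subalgebra of $A^{\infty}(V)$, with $[\mathbf{1}]_{00}+Q^{\infty}(V)$ as its identity. The associative algebra $A_{00}(V)$ is isomorphic to the Zhu algebra $A(V)$ and, in particular, $[\omega]_{00}+Q^{\infty}(V)$ is in the center of $A_{00}(V)$ if $V$ is a vertex operator algebra with conformal vector $\omega$.
   Context: Conventions: $\mathbb{N}=\{0,1,2,\dots\}$; vector spaces are over $\mathbb{C}$; $\mathrm{Res}_{x}$ is the coefficient of $x^{-1}$. $V$ is a grading-restricted vertex algebra: $V=\coprod_{n\in\mathbb{Z}}V_{(n)}$ with $\dim V_{(n)}<\infty$ and $V_{(n)}=0$ for $n$ sufficiently negative, vacuum $\mathbf{1}\in V_{(0)}$, vertex operator map $Y_{V}(v,x)=\sum_{k\in\mathbb{Z}}(Y_{V})_{k}(v)x^{-k-1}$, operator $L_{V}(0)$ acting as $n$ on $V_{(n)}$ ($\mathrm{wt}\,v=n$ for $v\in V_{(n)}$) and operator $L_{V}(-1)$, satisfying the usual axioms (vacuum, creation, lower truncation, Jacobi identity, $[L_{V}(0),Y_{V}(v,x)]=x\frac{d}{dx}Y_{V}(v,x)+Y_{V}(L_{V}(0)v,x)$, $[L_{V}(-1),Y_{V}(v,x)]=Y_{V}(L_{V}(-1)v,x)=\frac{d}{dx}Y_{V}(v,x)$). The Zhu algebra is $A(V)=V/O(V)$, where $O(V)$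 is spanned by $\mathrm{Res}_{x}x^{-2}Y_{V}((1+x)^{L_{V}(0)}u,x)v$ for $u,v\in V$, with product induced by $u*v=\mathrm{Res}_{x}x^{-1}Y_{V}((1+x)^{L_{V}(0)}u,x)v$. A lower-bounded generalized $V$-module is a space $W=\coprod_{n\in\mathbb{C}}W_{[n]}$ with $W_{[n]}=0$ when $\Re(n)$ is sufficiently negative, a vertex operator map $Y_{W}(v,x)=\sum_{k\in\mathbb{Z}}(Y_{W})_{k}(v)x^{-k-1}$ and operators $L_{W}(0),L_{W}(-1)$, satisfying the usual module axioms (lower truncation, $Y_W(\mathbf 1,x)=1$, Jacobi identity, the $L(0)$- and $L(-1)$-commutator formulas, the $L(-1)$-derivative property, $[L_W(0),L_W(-1)]=L_W(-1)$), where $W_{[n]}$ is the generalized eigenspace of $L_{W}(0)$ with eigenvalue $n$ (possibly infinite dimensional). $U^{\infty}(V)$ is the space of column-finite matrices $[v_{kl}]_{k,l\in\mathbb{N}}$ with entries in $V$ (for each $l$, only finitely many $v_{kl}\neq 0$). For $v\in V$, $[v]_{kl}$ is the matrix with $(k,l)$ entry $v$ and other entries $0$. For $k,n,l\in\mathbb{N}$ put $T_{k+l+1}((x+1)^{-k+n-l-1})=\sum_{m=0}^{n}\binom{-k+n-l-1}{m}x^{-k+n-l-m-1}$. The product $\diamond$ on $U^{\infty}(V)$ is $$([u_{kl}]\diamond[v_{kl}])_{kl}=\sum_{n\in\mathbb{N}}\mathrm{Res}_{x}T_{k+l+1}((x+1)^{-k+n-l-1})(1+x)^{l}Y_{V}((1+x)^{L_{V}(0)}u_{kn},x)v_{nl}.$$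 For a lower-bounded generalized $V$-module $W$ and $n\in\mathbb{N}$ let $\Omega_{n}(W)=\{w\in W: (Y_{W})_{k}(v)w=0$ for all homogeneous $v\in V$ and $k\in\mathbb{Z}$ with $\mathrm{wt}\,v-k-1<-n\}$, $\Omega_{-1}(W)=0$, $Gr_{n}(W)=\Omega_{n}(W)/\Omega_{n-1}(W)$, $Gr(W)=\coprod_{n\in\mathbb{N}}Gr_{n}(W)$, and $[w]_{n}=w+\Omega_{n-1}(W)$ for $w\in\Omega_n(W)$. Define $\vartheta_{Gr(W)}:U^{\infty}(V)\to\mathrm{End}\,Gr(W)$ by $\vartheta_{Gr(W)}([v_{kl}])[w]_{l}=\sum_{k\in\mathbb{N}}[\mathrm{Res}_{x}x^{l-k-1}Y_{W}(x^{L_{V}(0)}v_{kl},x)w]_{k}$ for $w\in\Omega_{l}(W)$, $l\in\mathbb{N}$. Let $Q^{\infty}(V)=\bigcap_{W}\ker\vartheta_{Gr(W)}$ over all lower-bounded generalized $V$-modules $W$, and $A^{\infty}(V)=U^{\infty}(V)/Q^{\infty}(V)$, which with the product induced by $\diamond$ is an associative algebra. Subalgebras are not required to contain the identity of $A^{\infty}(V)$. *)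

theory Defs
  imports
    "HOL-Algebra.QuotRing"
    "HOL-Algebra.Module"
    "HOL-Library.Countable_Set"
    "HOL-Library.Groups_Big_Fun"
    "HOL-Computational_Algebra.Formal_Laurent_Series"
begin

section \<open>Gradings and formal series\<close>

definition decomposes :: "('i \<Rightarrow> 'a::ab_group_add set) \<Rightarrow> 'a \<Rightarrow> ('i \<Rightarrow> 'a) \<Rightarrow> bool"
  where "decomposes G v f \<longleftrightarrow>
    finite {i. f i \<noteq> 0} \<and> (\<forall>i. f i \<in> G i) \<and> v = Sum_any f"

definition direct_sum_decomposition :: "('i \<Rightarrow> 'a::ab_group_add set) \<Rightarrow> 'a set \<Rightarrow> bool"
  where "direct_sum_decomposition G C \<longleftrightarrow>
    (\<forall>i. G i \<subseteq> C) \<and> (\<forall>v\<in>C. \<exists>!f. decomposes G v f)"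

definition component :: "('i \<Rightarrow> 'a::ab_group_add set) \<Rightarrow> 'i \<Rightarrow> 'a \<Rightarrow> 'a"
  where "component G i v = (THE f. decomposes G v f) i"

definition linear_on ::
    "'a::ab_group_add set \<Rightarrow> (complex \<Rightarrow> 'a \<Rightarrow> 'a) \<Rightarrow> (complex \<Rightarrow> 'b \<Rightarrow> 'b) \<Rightarrow>
     ('a \<Rightarrow> 'b::ab_group_add) \<Rightarrow> bool"
  where "linear_on C s t f \<longleftrightarrow>
    (\<forall>x\<in>C. \<forall>y\<in>C. f (x + y) = f x + f y) \<and> (\<forall>c. \<forall>x\<in>C. f (s c x) = t c (f x))"

text \<open>
  A formal series with coefficients in a space \<open>'a\<close> is a function \<open>a :: int \<Rightarrow> 'a\<close>, where
  \<open>a n\<close> is the coefficient of \<open>x\<close> to the power \<open>n\<close>. Scalar Laurent series are elements of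
  \<open>complex fls\<close>; a negative power of \<open>1 + fls_X\<close> is expanded in nonnegative powers of \<open>x\<close>.
\<close>

definition laurent_times ::
    "(complex \<Rightarrow> 'a \<Rightarrow> 'a) \<Rightarrow> complex fls \<Rightarrow> (int \<Rightarrow> 'a) \<Rightarrow> int \<Rightarrow> 'a::ab_group_add"
  where "laurent_times s f a = (\<lambda>n. Sum_any (\<lambda>j. s (fls_nth f j) (a (n - j))))"

definition Res :: "(int \<Rightarrow> 'a) \<Rightarrow> 'a"
  where "Res a = a (- 1)"

text \<open>
  Throughout, \<open>Y v k w\<close> is \<open>v\<^sub>k w\<close>, the coefficient of \<open>x\<close> to the power \<open>- k - 1\<close> in \<open>Y(v, x) w\<close>.
\<close>

definition vop_series :: "('v \<Rightarrow> int \<Rightarrow> 'w \<Rightarrow> 'w) \<Rightarrow> 'v \<Rightarrow> 'w \<Rightarrow> int \<Rightarrow> 'w"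
  where "vop_series Y v w = (\<lambda>n. Y v (- n - 1) w)"

text \<open>
  The series \<open>Y(f(x)\<^bsup>L(0)\<^esup> v, x) w\<close>, where \<open>f(x)\<^bsup>L(0)\<^esup>\<close> acts on the homogeneous component of
  weight \<open>r\<close> as the \<open>r\<close>-th power of the Laurent series \<open>f\<close>.
\<close>

definition vop_twisted ::
    "(complex \<Rightarrow> 'w \<Rightarrow> 'w) \<Rightarrow> (int \<Rightarrow> 'v::ab_group_add set) \<Rightarrow> ('v \<Rightarrow> int \<Rightarrow> 'w \<Rightarrow> 'w) \<Rightarrow>
     complex fls \<Rightarrow> 'v \<Rightarrow> 'w \<Rightarrow> int \<Rightarrow> 'w::ab_group_add"
  where "vop_twisted s G Y f v w = (\<lambda>n.
    \<Sum>r | component G r v \<noteq> 0.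
      laurent_times s (f powi r) (vop_series Y (component G r v) w) n)"

text \<open>
  The Jacobi identity, in terms of the coefficients of
  \<open>x\<^sub>0\<close>, \<open>x\<^sub>1\<close>, \<open>x\<^sub>2\<close> to the powers \<open>- r - 1\<close>, \<open>- p - 1\<close>, \<open>- q - 1\<close>.
\<close>

definition jacobi_identity ::
    "(complex \<Rightarrow> 'w \<Rightarrow> 'w) \<Rightarrow> ('v \<Rightarrow> int \<Rightarrow> 'v \<Rightarrow> 'v) \<Rightarrow> ('v \<Rightarrow> int \<Rightarrow> 'w \<Rightarrow> 'w) \<Rightarrow>
     'v \<Rightarrow> 'v \<Rightarrow> 'w::ab_group_add \<Rightarrow> bool"
  where "jacobi_identity s YV YW u v w \<longleftrightarrow> (\<forall>p q r :: int.
    Sum_any (\<lambda>i::nat. s ((-1) ^ i * (of_int r gchoose i))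
        (YW u (p + r - int i) (YW v (q + int i) w)))
    - Sum_any (\<lambda>i::nat. s ((-1) powi r * (-1) ^ i * (of_int r gchoose i))
        (YW v (q + r - int i) (YW u (p + int i) w)))
    = Sum_any (\<lambda>i::nat. s (of_int p gchoose i)
        (YW (YV u (r + int i) v) (p + q - int i) w)))"

section \<open>Grading-restricted vertex algebras and their modules\<close>

record 'v vertex_algebra =
  vscale :: "complex \<Rightarrow> 'v \<Rightarrow> 'v"
  vgrade :: "int \<Rightarrow> 'v set"
  vac :: 'v
  vY :: "'v \<Rightarrow> int \<Rightarrow> 'v \<Rightarrow> 'v"
  vL0 :: "'v \<Rightarrow> 'v"
  vLm1 :: "'v \<Rightarrow> 'v"

locale grading_restricted_vertex_algebra =
  fixes V :: "'v::ab_group_add vertex_algebra"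
  assumes v_vector_space: "vector_space (vscale V)"
    and v_grade_subspace: "Modules.module.subspace (vscale V) (vgrade V n)"
    and v_direct_sum: "direct_sum_decomposition (vgrade V) UNIV"
    and v_grade_finite_dim: "\<exists>B. finite B \<and> vgrade V n = Modules.module.span (vscale V) B"
    and v_lower_bounded: "\<exists>N. \<forall>n<N. vgrade V n = {0}"
    and v_vac_grade: "vac V \<in> vgrade V 0"
    and v_Y_linear1: "Vector_Spaces.linear (vscale V) (vscale V) (\<lambda>v. vY V v k w)"
    and v_Y_linear2: "Vector_Spaces.linear (vscale V) (vscale V) (vY V v k)"
    and v_L0_linear: "Vector_Spaces.linear (vscale V) (vscale V) (vL0 V)"
    and v_L0_grade: "v \<in> vgrade V n \<Longrightarrow> vL0 V v = vscale V (of_int n) v"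
    and v_Lm1_linear: "Vector_Spaces.linear (vscale V) (vscale V) (vLm1 V)"
    and v_truncation: "\<exists>K. \<forall>k\<ge>K. vY V u k v = 0"
    and v_vacuum: "vY V (vac V) k v = (if k = - 1 then v else 0)"
    and v_creation: "k \<ge> 0 \<Longrightarrow> vY V v k (vac V) = 0" "vY V v (- 1) (vac V) = v"
    and v_jacobi: "jacobi_identity (vscale V) (vY V) (vY V) u v w"
    and v_L0_commutator: "vL0 V (vY V u k v) - vY V u k (vL0 V v) =
          vscale V (- of_int k - 1) (vY V u k v) + vY V (vL0 V u) k v"
    and v_Lm1_commutator: "vLm1 V (vY V u k v) - vY V u k (vLm1 V v) = vY V (vLm1 V u) k v"
    and v_Lm1_derivative: "vY V (vLm1 V u) k v = vscale V (- of_int k) (vY V u (k - 1) v)"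

locale vertex_operator_algebra = grading_restricted_vertex_algebra V
  for V :: "'v::ab_group_add vertex_algebra" +
  fixes \<omega> :: 'v
  assumes omega_grade: "\<omega> \<in> vgrade V 2"
    and omega_L0: "vY V \<omega> 1 = vL0 V"
    and omega_Lm1: "vY V \<omega> 0 = vLm1 V"
    and omega_virasoro: "\<exists>c::complex. \<forall>m n v.
          vY V \<omega> (m + 1) (vY V \<omega> (n + 1) v) - vY V \<omega> (n + 1) (vY V \<omega> (m + 1) v) =
          vscale V (of_int (m - n)) (vY V \<omega> (m + n + 1) v) +
          (if m + n = 0 then vscale V (c / 12 * of_int (m ^ 3 - m)) v else 0)"

text \<open>
  The underlying space of a module is a subspace \<open>mcarrier W\<close> of an ambient vector space \<open>'w\<close>;
  the values of \<open>mY W\<close>, \<open>mL0 W\<close>, \<open>mLm1 W\<close> outside of it are irrelevant.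
\<close>

record ('v, 'w) vmodule =
  mcarrier :: "'w set"
  mscale :: "complex \<Rightarrow> 'w \<Rightarrow> 'w"
  mY :: "'v \<Rightarrow> int \<Rightarrow> 'w \<Rightarrow> 'w"
  mL0 :: "'w \<Rightarrow> 'w"
  mLm1 :: "'w \<Rightarrow> 'w"

definition mgrade :: "('v, 'w::ab_group_add) vmodule \<Rightarrow> complex \<Rightarrow> 'w set"
  where "mgrade W n =
    {w \<in> mcarrier W. \<exists>m. ((\<lambda>w. mL0 W w - mscale W n w) ^^ m) w = 0}"

locale lower_bounded_generalized_module = grading_restricted_vertex_algebra V
  for V :: "'v::ab_group_add vertex_algebra" +
  fixes W :: "('v, 'w::ab_group_add) vmodule"
  assumes m_vector_space: "vector_space (mscale W)"
    and m_subspace: "Modules.module.subspace (mscale W) (mcarrier W)"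
    and m_Y_closed: "w \<in> mcarrier W \<Longrightarrow> mY W v k w \<in> mcarrier W"
    and m_L0_closed: "w \<in> mcarrier W \<Longrightarrow> mL0 W w \<in> mcarrier W"
    and m_Lm1_closed: "w \<in> mcarrier W \<Longrightarrow> mLm1 W w \<in> mcarrier W"
    and m_Y_linear1: "w \<in> mcarrier W \<Longrightarrow>
          Vector_Spaces.linear (vscale V) (mscale W) (\<lambda>v. mY W v k w)"
    and m_Y_linear2: "linear_on (mcarrier W) (mscale W) (mscale W) (mY W v k)"
    and m_L0_linear: "linear_on (mcarrier W) (mscale W) (mscale W) (mL0 W)"
    and m_Lm1_linear: "linear_on (mcarrier W) (mscale W) (mscale W) (mLm1 W)"
    and m_direct_sum: "direct_sum_decomposition (mgrade W) (mcarrier W)"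
    and m_lower_bounded: "\<exists>R. \<forall>n. Re n < R \<longrightarrow> mgrade W n = {0}"
    and m_truncation: "w \<in> mcarrier W \<Longrightarrow> \<exists>K. \<forall>k\<ge>K. mY W v k w = 0"
    and m_vacuum: "w \<in> mcarrier W \<Longrightarrow> mY W (vac V) k w = (if k = - 1 then w else 0)"
    and m_jacobi: "w \<in> mcarrier W \<Longrightarrow> jacobi_identity (mscale W) (vY V) (mY W) u v w"
    and m_L0_commutator: "w \<in> mcarrier W \<Longrightarrow>
          mL0 W (mY W v k w) - mY W v k (mL0 W w) =
          mscale W (- of_int k - 1) (mY W v k w) + mY W (vL0 V v) k w"
    and m_Lm1_commutator: "w \<in> mcarrier W \<Longrightarrow>
          mLm1 W (mY W v k w) - mY W v k (mLm1 W w) = mY W (vLm1 V v) k w"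
    and m_Lm1_derivative: "w \<in> mcarrier W \<Longrightarrow>
          mY W (vLm1 V v) k w = mscale W (- of_int k) (mY W v (k - 1) w)"
    and m_L0_Lm1: "w \<in> mcarrier W \<Longrightarrow> mL0 W (mLm1 W w) - mLm1 W (mL0 W w) = mLm1 W w"

section \<open>Algebras over the complex numbers\<close>

definition complex_ring :: "complex ring"
  where "complex_ring = \<lparr>carrier = UNIV, monoid.mult = (*), one = 1, zero = 0, add = (+)\<rparr>"

text \<open>
  The locale \<^locale>\<open>algebra\<close> only covers commutative algebras.
\<close>

locale unital_associative_algebra =
  ring A + Module.module complex_ring A for A :: "(complex, 'a) module" (structure) +
  assumes smult_mult_left: "x \<in> carrier A \<Longrightarrow> y \<in> carrier A \<Longrightarrow>
        c \<odot>\<^bsub>A\<^esub> (x \<otimes>\<^bsub>A\<^esub> y) = (c \<odot>\<^bsub>A\<^esub> x) \<otimes>\<^bsub>A\<^esub> y"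
    and smult_mult_right: "x \<in> carrier A \<Longrightarrow> y \<in> carrier A \<Longrightarrow>
        c \<odot>\<^bsub>A\<^esub> (x \<otimes>\<^bsub>A\<^esub> y) = x \<otimes>\<^bsub>A\<^esub> (c \<odot>\<^bsub>A\<^esub> y)"

text \<open>A subalgebra need not contain the identity of the ambient algebra.\<close>

definition nonunital_subalgebra :: "'a set \<Rightarrow> (complex, 'a) module \<Rightarrow> bool"
  where "nonunital_subalgebra S A \<longleftrightarrow>
    submodule S complex_ring A \<and> (\<forall>x\<in>S. \<forall>y\<in>S. x \<otimes>\<^bsub>A\<^esub> y \<in> S)"

definition algebra_iso :: "(complex, 'a) module \<Rightarrow> (complex, 'b) module \<Rightarrow> ('a \<Rightarrow> 'b) set"
  where "algebra_iso A B =
    {h \<in> ring_iso A B. \<forall>c. \<forall>x\<in>carrier A. h (c \<odot>\<^bsub>A\<^esub> x) = c \<odot>\<^bsub>B\<^esub> h x}"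

definition algebra_center :: "(complex, 'a) module \<Rightarrow> 'a set"
  where "algebra_center A =
    {z \<in> carrier A. \<forall>x\<in>carrier A. z \<otimes>\<^bsub>A\<^esub> x = x \<otimes>\<^bsub>A\<^esub> z}"

text \<open>
  As in \<^const>\<open>FactRing\<close>, an operation on cosets is the union of its results on all
  representatives, so that it yields a coset only if it is well defined.
\<close>

definition quotient_algebra ::
    "(complex, 'a) module \<Rightarrow> 'a set \<Rightarrow> (complex, 'a set) module"
  where "quotient_algebra A I =
    \<lparr>carrier = carrier (A Quot I), monoid.mult = monoid.mult (A Quot I), one = one (A Quot I),
     zero = zero (A Quot I), add = add (A Quot I),
     module.smult = (\<lambda>c X. \<Union>x\<in>X. I +>\<^bsub>A\<^esub> (c \<odot>\<^bsub>A\<^esub> x))\<rparr>"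

section \<open>The Zhu algebra\<close>

definition zhu_mult :: "'v::ab_group_add vertex_algebra \<Rightarrow> 'v \<Rightarrow> 'v \<Rightarrow> 'v"
  where "zhu_mult V u v =
    Res (laurent_times (vscale V) (fls_X powi (- 1))
      (vop_twisted (vscale V) (vgrade V) (vY V) (1 + fls_X) u v))"

definition zhu_O :: "'v::ab_group_add vertex_algebra \<Rightarrow> 'v set"
  where "zhu_O V = Modules.module.span (vscale V)
    {Res (laurent_times (vscale V) (fls_X powi (- 2))
      (vop_twisted (vscale V) (vgrade V) (vY V) (1 + fls_X) u v)) | u v. True}"

definition zhu_algebra :: "'v::ab_group_add vertex_algebra \<Rightarrow> (complex, 'v set) module"
  where "zhu_algebra V = quotient_algebra
    \<lparr>carrier = UNIV, monoid.mult = zhu_mult V, one = vac V, zero = 0, add = (+),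
     module.smult = vscale V\<rparr> (zhu_O V)"

section \<open>The algebra of column-finite matrices\<close>

definition elementary_matrix :: "'v::zero \<Rightarrow> nat \<Rightarrow> nat \<Rightarrow> nat \<Rightarrow> nat \<Rightarrow> 'v"
  where "elementary_matrix v k l = (\<lambda>i j. if i = k \<and> j = l then v else 0)"

definition T_truncation :: "nat \<Rightarrow> nat \<Rightarrow> nat \<Rightarrow> complex fls"
  where "T_truncation k n l = (\<Sum>m = 0..n.
    fls_const (of_int (- int k + int n - int l - 1) gchoose m) *
    fls_X powi (- int k + int n - int l - int m - 1))"

definition diamond ::
    "'v::ab_group_add vertex_algebra \<Rightarrow> (nat \<Rightarrow> nat \<Rightarrow> 'v) \<Rightarrow> (nat \<Rightarrow> nat \<Rightarrow> 'v) \<Rightarrow> nat \<Rightarrow> nat \<Rightarrow> 'v"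
  where "diamond V u v = (\<lambda>k l. \<Sum>n | v n l \<noteq> 0.
    Res (laurent_times (vscale V) (T_truncation k n l * (1 + fls_X) ^ l)
      (vop_twisted (vscale V) (vgrade V) (vY V) (1 + fls_X) (u k n) (v n l))))"

definition U_inf :: "'v::ab_group_add vertex_algebra \<Rightarrow> (complex, nat \<Rightarrow> nat \<Rightarrow> 'v) module"
  where "U_inf V =
    \<lparr>carrier = {u. \<forall>l. finite {k. u k l \<noteq> 0}},
     monoid.mult = diamond V,
     one = (\<lambda>k l. if k = l then vac V else 0),
     zero = (\<lambda>k l. 0),
     add = (\<lambda>u v k l. u k l + v k l),
     module.smult = (\<lambda>c u k l. vscale V c (u k l))\<rparr>"

section \<open>The associated graded space of a module\<close>

text \<open>The index is an integer in order to include \<open>\<Omega>\<^sub>-\<^sub>1(W) = 0\<close>.\<close>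

definition Omega ::
    "'v::ab_group_add vertex_algebra \<Rightarrow> ('v, 'w::ab_group_add) vmodule \<Rightarrow> int \<Rightarrow> 'w set"
  where "Omega V W n =
    (if n < 0 then {0}
     else {w \<in> mcarrier W. \<forall>r. \<forall>v\<in>vgrade V r. \<forall>k. r - k - 1 < - n \<longrightarrow> mY W v k w = 0})"

definition Gr_class ::
    "'v::ab_group_add vertex_algebra \<Rightarrow> ('v, 'w::ab_group_add) vmodule \<Rightarrow> nat \<Rightarrow> 'w \<Rightarrow> 'w set"
  where "Gr_class V W n w = (+) w ` Omega V W (int n - 1)"

definition Gr_component ::
    "'v::ab_group_add vertex_algebra \<Rightarrow> ('v, 'w::ab_group_add) vmodule \<Rightarrow> nat \<Rightarrow> 'w set set"
  where "Gr_component V W n = Gr_class V W n ` Omega V W (int n)"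

definition Gr_support ::
    "'v::ab_group_add vertex_algebra \<Rightarrow> ('v, 'w::ab_group_add) vmodule \<Rightarrow> (nat \<Rightarrow> 'w set) \<Rightarrow> nat set"
  where "Gr_support V W g = {n. g n \<noteq> Gr_class V W n 0}"

definition Gr ::
    "'v::ab_group_add vertex_algebra \<Rightarrow> ('v, 'w::ab_group_add) vmodule \<Rightarrow> (nat \<Rightarrow> 'w set) set"
  where "Gr V W = {g. (\<forall>n. g n \<in> Gr_component V W n) \<and> finite (Gr_support V W g)}"

definition theta_entry ::
    "'v::ab_group_add vertex_algebra \<Rightarrow> ('v, 'w::ab_group_add) vmodule \<Rightarrow>
     nat \<Rightarrow> nat \<Rightarrow> 'v \<Rightarrow> 'w \<Rightarrow> 'w"
  where "theta_entry V W k l v w =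
    Res (laurent_times (mscale W) (fls_X powi (int l - int k - 1))
      (vop_twisted (mscale W) (vgrade V) (mY W) fls_X v w))"

text \<open>
  The \<open>k\<close>-th component of the image of \<open>g = (g l)\<^sub>l\<close> is the class of the sum over \<open>l\<close> of the
  entries applied to representatives \<open>w l\<close> of \<open>g l\<close>; again the union over all representatives
  is taken.
\<close>

definition theta_Gr ::
    "'v::ab_group_add vertex_algebra \<Rightarrow> ('v, 'w::ab_group_add) vmodule \<Rightarrow>
     (nat \<Rightarrow> nat \<Rightarrow> 'v) \<Rightarrow> (nat \<Rightarrow> 'w set) \<Rightarrow> nat \<Rightarrow> 'w set"
  where "theta_Gr V W u g = (\<lambda>k. \<Union>w \<in> {w. \<forall>l. w l \<in> g l}.
    Gr_class V W k (\<Sum>l\<in>Gr_support V W g. theta_entry V W k l (u k l) (w l)))"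

definition theta_kernel ::
    "'v::ab_group_add vertex_algebra \<Rightarrow> ('v, 'w::ab_group_add) vmodule \<Rightarrow> (nat \<Rightarrow> nat \<Rightarrow> 'v) set"
  where "theta_kernel V W =
    {u \<in> carrier (U_inf V). \<forall>g\<in>Gr V W. theta_Gr V W u g = (\<lambda>k. Gr_class V W k 0)}"

text \<open>
  A bound variable cannot range over modules on all types. It is enough to let the modules be
  carried by the subspaces of a space of countably infinite dimension (with any scalar
  multiplication on its additive group), because a matrix acting nontrivially on \<open>Gr(W)\<close> already
  acts nontrivially on \<open>Gr\<close> of a submodule of \<open>W\<close> of countable dimension. The theorem
  \<open>Q_inf_subset_theta_kernel\<close> below proves that the intersection is indeed contained
  in the kernel for every module on every type.
\<close>

definition Q_inf :: "'v::ab_group_add vertex_algebra \<Rightarrow> (nat \<Rightarrow> nat \<Rightarrow> 'v) set"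
  where "Q_inf V =
    {u \<in> carrier (U_inf V). \<forall>W :: ('v, complex poly) vmodule.
      lower_bounded_generalized_module V W \<longrightarrow> u \<in> theta_kernel V W}"

definition A_inf :: "'v::ab_group_add vertex_algebra \<Rightarrow> (complex, (nat \<Rightarrow> nat \<Rightarrow> 'v) set) module"
  where "A_inf V = quotient_algebra (U_inf V) (Q_inf V)"

definition class00 :: "'v::ab_group_add vertex_algebra \<Rightarrow> 'v \<Rightarrow> (nat \<Rightarrow> nat \<Rightarrow> 'v) set"
  where "class00 V v = Q_inf V +>\<^bsub>U_inf V\<^esub> elementary_matrix v 0 0"

definition A00 :: "'v::ab_group_add vertex_algebra \<Rightarrow> (nat \<Rightarrow> nat \<Rightarrow> 'v) set set"
  where "A00 V = range (class00 V)"

text \<open>The identity of \<open>A00_algebra V\<close> is not the one of \<open>A_inf V\<close>.\<close>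

definition A00_algebra ::
    "'v::ab_group_add vertex_algebra \<Rightarrow> (complex, (nat \<Rightarrow> nat \<Rightarrow> 'v) set) module"
  where "A00_algebra V = (A_inf V)\<lparr>carrier := A00 V, one := class00 V (vac V)\<rparr>"

section \<open>Independence of the ambient type of the modules\<close>

lemma linear_on_zero:
  assumes "linear_on C s t f" and "0 \<in> C"
  shows "f 0 = 0"
proof -
  have "f (0 + 0) = f 0 + f 0" using assms unfolding linear_on_def by blast
  then show ?thesis by simp
qed

locale vs_embedding = dom: vector_space s + cod: vector_space t
  for s :: "complex \<Rightarrow> 'a::ab_group_add \<Rightarrow> 'a" and t :: "complex \<Rightarrow> 'b::ab_group_add \<Rightarrow> 'b" +
  fixes C and \<phi>
  assumes sub: "dom.subspace C" and lin: "linear_on C s t \<phi>" and inj: "inj_on \<phi> C"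
begin

lemma C0 [simp]: "0 \<in> C" using sub by (rule dom.subspace_0)
lemma C_add: "x \<in> C \<Longrightarrow> y \<in> C \<Longrightarrow> x + y \<in> C" using sub by (rule dom.subspace_add)
lemma C_diff: "x \<in> C \<Longrightarrow> y \<in> C \<Longrightarrow> x - y \<in> C" using sub by (rule dom.subspace_diff)
lemma C_scale: "x \<in> C \<Longrightarrow> s c x \<in> C" using sub by (rule dom.subspace_scale)

lemma phi_add: "x \<in> C \<Longrightarrow> y \<in> C \<Longrightarrow> \<phi> (x + y) = \<phi> x + \<phi> y"
  using lin unfolding linear_on_def by blast
lemma phi_scale: "x \<in> C \<Longrightarrow> \<phi> (s c x) = t c (\<phi> x)"
  using lin unfolding linear_on_def by blast
lemma phi_0 [simp]: "\<phi> 0 = 0" using lin C0 by (rule linear_on_zero)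
lemma phi_diff: "x \<in> C \<Longrightarrow> y \<in> C \<Longrightarrow> \<phi> (x - y) = \<phi> x - \<phi> y"
  using phi_add[of "x - y" y] by (simp add: C_diff)
lemma phi_eq_iff: "x \<in> C \<Longrightarrow> y \<in> C \<Longrightarrow> \<phi> x = \<phi> y \<longleftrightarrow> x = y"
  using inj by (auto dest: inj_onD)
lemma phi_eq_0_iff: "x \<in> C \<Longrightarrow> \<phi> x = 0 \<longleftrightarrow> x = 0"
  using phi_eq_iff[of x 0] by simp

lemma C_sum: "(\<And>i. i \<in> A \<Longrightarrow> f i \<in> C) \<Longrightarrow> sum f A \<in> C"
  by (rule dom.subspace_sum[OF sub])

lemma phi_sum: "(\<And>i. i \<in> A \<Longrightarrow> f i \<in> C) \<Longrightarrow> \<phi> (sum f A) = (\<Sum>i\<in>A. \<phi> (f i))"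
proof (induction A rule: infinite_finite_induct)
  case (insert x F)
  then show ?case by (simp add: phi_add C_sum)
qed auto

lemma C_Sum_any: "(\<And>i. f i \<in> C) \<Longrightarrow> Sum_any f \<in> C"
  unfolding Sum_any.expand_set by (rule C_sum)

lemma phi_Sum_any: "(\<And>i. f i \<in> C) \<Longrightarrow> \<phi> (Sum_any f) = Sum_any (\<lambda>i. \<phi> (f i))"
  unfolding Sum_any.expand_set by (simp add: phi_sum phi_eq_0_iff)

definition "\<psi> = inv_into C \<phi>"

lemma psi_phi [simp]: "x \<in> C \<Longrightarrow> \<psi> (\<phi> x) = x"
  using inj by (simp add: \<psi>_def)

lemma image_subspace: "cod.subspace (\<phi> ` C)"
proof (rule cod.subspaceI)
  show "0 \<in> \<phi> ` C" by (metis C0 phi_0 imageI)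
  show "x + y \<in> \<phi> ` C" if "x \<in> \<phi> ` C" "y \<in> \<phi> ` C" for x y
    using that by (auto simp: phi_add[symmetric] intro: C_add)
  show "t c x \<in> \<phi> ` C" if "x \<in> \<phi> ` C" for c x
    using that by (auto simp: phi_scale[symmetric] intro: C_scale)
qed

lemma laurent_times_phi:
  assumes "\<And>n. a n \<in> C"
  shows "laurent_times s f a n \<in> C"
    "laurent_times t f (\<lambda>n. \<phi> (a n)) n = \<phi> (laurent_times s f a n)"
  using assms unfolding laurent_times_def
  by (auto simp: C_scale phi_Sum_any phi_scale intro!: C_Sum_any)

lemma vop_twisted_phi:
  assumes C: "\<And>v k. Y v k w \<in> C" and Y': "\<And>v k. Y' v k (\<phi> w) = \<phi> (Y v k w)"
  shows "vop_twisted s G Y f v w n \<in> C"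
    "vop_twisted t G Y' f v (\<phi> w) n = \<phi> (vop_twisted s G Y f v w n)"
proof -
  have a: "vop_series Y u w n \<in> C" for u n
    by (simp add: vop_series_def C)
  have b: "vop_series Y' u (\<phi> w) = (\<lambda>n. \<phi> (vop_series Y u w n))" for u
    by (simp add: vop_series_def Y')
  show "vop_twisted s G Y f v w n \<in> C"
    unfolding vop_twisted_def by (intro C_sum laurent_times_phi a)
  show "vop_twisted t G Y' f v (\<phi> w) n = \<phi> (vop_twisted s G Y f v w n)"
    unfolding vop_twisted_def by (simp add: b laurent_times_phi a phi_sum)
qed

end

context lower_bounded_generalized_module
begin

lemma component_decomposes:
  assumes "x \<in> mcarrier W"
  shows "decomposes (mgrade W) x (\<lambda>n. component (mgrade W) n x)"
proof -
  from m_direct_sum assms have "\<exists>!f. decomposes (mgrade W) x f"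
    unfolding direct_sum_decomposition_def by blast
  from theI'[OF this] show ?thesis by (simp add: component_def)
qed

end

locale module_embedding =
  lower_bounded_generalized_module V W + vs_embedding "mscale W" t C \<phi>
  for V :: "'v::ab_group_add vertex_algebra"
    and W :: "('v, 'w::ab_group_add) vmodule"
    and t :: "complex \<Rightarrow> 'b::ab_group_add \<Rightarrow> 'b" and C \<phi> +
  assumes C_subset: "C \<subseteq> mcarrier W"
    and C_Y: "w \<in> C \<Longrightarrow> mY W v k w \<in> C"
    and C_L0: "w \<in> C \<Longrightarrow> mL0 W w \<in> C"
    and C_Lm1: "w \<in> C \<Longrightarrow> mLm1 W w \<in> C"
    and C_component: "w \<in> C \<Longrightarrow> component (mgrade W) n w \<in> C"
begin

definition W' :: "('v, 'b) vmodule"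
  where "W' = \<lparr>mcarrier = \<phi> ` C, mscale = t, mY = (\<lambda>v k x. \<phi> (mY W v k (\<psi> x))),
    mL0 = (\<lambda>x. \<phi> (mL0 W (\<psi> x))), mLm1 = (\<lambda>x. \<phi> (mLm1 W (\<psi> x)))\<rparr>"

lemma W'_simps [simp]:
  "mcarrier W' = \<phi> ` C" "mscale W' = t"
  "x \<in> C \<Longrightarrow> mY W' v k (\<phi> x) = \<phi> (mY W v k x)"
  "x \<in> C \<Longrightarrow> mL0 W' (\<phi> x) = \<phi> (mL0 W x)"
  "x \<in> C \<Longrightarrow> mLm1 W' (\<phi> x) = \<phi> (mLm1 W x)"
  by (simp_all add: W'_def)

lemma in_W: "x \<in> C \<Longrightarrow> x \<in> mcarrier W"
  using C_subset by blast

lemma mgrade_W': "mgrade W' n = \<phi> ` (mgrade W n \<inter> C)"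
proof -
  define N where "N = (\<lambda>w. mL0 W w - mscale W n w)"
  define N' where "N' = (\<lambda>w. mL0 W' w - mscale W' n w)"
  have N: "N x \<in> C" "N' (\<phi> x) = \<phi> (N x)" if "x \<in> C" for x
    using that by (simp_all add: N_def N'_def C_L0 C_scale C_diff phi_diff phi_scale)
  have *: "(N ^^ m) x \<in> C \<and> (N' ^^ m) (\<phi> x) = \<phi> ((N ^^ m) x)" if "x \<in> C" for m x
    using that by (induction m) (simp_all add: N)
  have iff: "(N' ^^ m) (\<phi> x) = 0 \<longleftrightarrow> (N ^^ m) x = 0" if "x \<in> C" for m x
    using *[OF that, of m] by (simp add: phi_eq_0_iff)
  have "mgrade W n \<inter> C = {x \<in> C. \<exists>m. (N ^^ m) x = 0}"
    unfolding mgrade_def N_def[symmetric] using in_W by auto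
  moreover have "mgrade W' n = {y \<in> \<phi> ` C. \<exists>m. (N' ^^ m) y = 0}"
    unfolding mgrade_def N'_def[symmetric] by simp
  moreover have "{y \<in> \<phi> ` C. \<exists>m. (N' ^^ m) y = 0} = \<phi> ` {x \<in> C. \<exists>m. (N ^^ m) x = 0}"
    using iff by auto
  ultimately show ?thesis by simp
qed

lemma direct_sum_W': "direct_sum_decomposition (mgrade W') (mcarrier W')"
  unfolding direct_sum_decomposition_def
proof (intro conjI allI ballI)
  show "mgrade W' i \<subseteq> mcarrier W'" for i by (auto simp: mgrade_W')
  fix y assume "y \<in> mcarrier W'"
  then obtain x where x: "x \<in> C" "y = \<phi> x" by auto
  let ?f = "\<lambda>n. component (mgrade W) n x"
  have f: "decomposes (mgrade W) x ?f" by (rule component_decomposes[OF in_W[OF x(1)]])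
  have fC: "?f n \<in> C" for n by (rule C_component[OF x(1)])
  show "\<exists>!h. decomposes (mgrade W') y h"
  proof (rule ex1I)
    show "decomposes (mgrade W') y (\<lambda>n. \<phi> (?f n))"
      using f fC unfolding decomposes_def mgrade_W'
      by (auto simp: phi_eq_0_iff x(2) phi_Sum_any[symmetric])
    fix h assume h: "decomposes (mgrade W') y h"
    then have "\<forall>n. \<exists>z. z \<in> mgrade W n \<and> z \<in> C \<and> h n = \<phi> z"
      unfolding decomposes_def mgrade_W' by blast
    then obtain g where g: "\<And>n. g n \<in> mgrade W n" "\<And>n. g n \<in> C" "\<And>n. h n = \<phi> (g n)"
      by metis
    have "\<phi> x = \<phi> (Sum_any g)"
      using h g unfolding decomposes_def by (simp add: phi_Sum_any x(2))
    then have "x = Sum_any g"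
      using phi_eq_iff[OF x(1) C_Sum_any] g(2) by blast
    then have "decomposes (mgrade W) x g"
      using h g unfolding decomposes_def by (simp add: phi_eq_0_iff)
    then have "g = ?f"
      using f m_direct_sum in_W[OF x(1)] unfolding direct_sum_decomposition_def by blast
    then show "h = (\<lambda>n. \<phi> (?f n))" using g(3) by auto
  qed
qed

lemma jacobi_W':
  assumes x: "x \<in> C"
  shows "jacobi_identity t (vY V) (mY W') u v (\<phi> x)"
proof -
  show ?thesis
    unfolding jacobi_identity_def
  proof (intro allI)
    fix p q r
    define A where "A = (\<lambda>i::nat. mscale W ((-1) ^ i * (of_int r gchoose i))
        (mY W u (p + r - int i) (mY W v (q + int i) x)))"
    define B where "B = (\<lambda>i::nat. mscale W ((-1) powi r * (-1) ^ i * (of_int r gchoose i))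
        (mY W v (q + r - int i) (mY W u (p + int i) x)))"
    define D where "D = (\<lambda>i::nat. mscale W (of_int p gchoose i)
        (mY W (vY V u (r + int i) v) (p + q - int i) x))"
    have C: "A i \<in> C" "B i \<in> C" "D i \<in> C" for i
      by (simp_all add: A_def B_def D_def C_scale C_Y x)
    have eq: "Sum_any A - Sum_any B = Sum_any D"
      using m_jacobi[OF in_W[OF x], of u v] unfolding jacobi_identity_def A_def B_def D_def
      by blast
    have 1: "t ((-1) ^ i * (of_int r gchoose i))
        (mY W' u (p + r - int i) (mY W' v (q + int i) (\<phi> x))) = \<phi> (A i)" for i
      by (simp add: A_def phi_scale C_Y x)
    have 2: "t ((-1) powi r * (-1) ^ i * (of_int r gchoose i))
        (mY W' v (q + r - int i) (mY W' u (p + int i) (\<phi> x))) = \<phi> (B i)" for i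
      by (simp add: B_def phi_scale C_Y x)
    have 3: "t (of_int p gchoose i)
        (mY W' (vY V u (r + int i) v) (p + q - int i) (\<phi> x)) = \<phi> (D i)" for i
      by (simp add: D_def phi_scale C_Y x)
    have "Sum_any (\<lambda>i. \<phi> (A i)) - Sum_any (\<lambda>i. \<phi> (B i)) = \<phi> (Sum_any A - Sum_any B)"
      using C by (simp add: phi_Sum_any phi_diff C_Sum_any)
    also have "\<dots> = Sum_any (\<lambda>i. \<phi> (D i))"
      using C by (simp add: eq phi_Sum_any)
    finally show "Sum_any (\<lambda>i::nat. t ((-1) ^ i * (of_int r gchoose i))
          (mY W' u (p + r - int i) (mY W' v (q + int i) (\<phi> x)))) -
        Sum_any (\<lambda>i::nat. t ((-1) powi r * (-1) ^ i * (of_int r gchoose i))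
          (mY W' v (q + r - int i) (mY W' u (p + int i) (\<phi> x)))) =
        Sum_any (\<lambda>i::nat. t (of_int p gchoose i)
          (mY W' (vY V u (r + int i) v) (p + q - int i) (\<phi> x)))"
      unfolding 1 2 3 .
  qed
qed

sublocale transported: lower_bounded_generalized_module V W'
proof (intro lower_bounded_generalized_module.intro lower_bounded_generalized_module_axioms.intro)
  show "Modules.module.subspace (mscale W') (mcarrier W')"
    using image_subspace by simp
  show "direct_sum_decomposition (mgrade W') (mcarrier W')" by (rule direct_sum_W')
  obtain R where R: "\<forall>n. Re n < R \<longrightarrow> mgrade W n = {0}" using m_lower_bounded by blast
  then show "\<exists>R. \<forall>n. Re n < R \<longrightarrow> mgrade W' n = {0}"
    by (intro exI[of _ R]) (auto simp: mgrade_W' R)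
  fix w v u k
  show "linear_on (mcarrier W') (mscale W') (mscale W') (mY W' v k)"
    using m_Y_linear2[of v k] unfolding linear_on_def
    by (auto simp: phi_add[symmetric] phi_scale[symmetric] C_add C_scale C_Y in_W)
  show "linear_on (mcarrier W') (mscale W') (mscale W') (mL0 W')"
    using m_L0_linear unfolding linear_on_def
    by (auto simp: phi_add[symmetric] phi_scale[symmetric] C_add C_scale C_L0 in_W)
  show "linear_on (mcarrier W') (mscale W') (mscale W') (mLm1 W')"
    using m_Lm1_linear unfolding linear_on_def
    by (auto simp: phi_add[symmetric] phi_scale[symmetric] C_add C_scale C_Lm1 in_W)
  assume "w \<in> mcarrier W'"
  then obtain x where x: "x \<in> C" "w = \<phi> x" by auto
  note xW = in_W[OF x(1)]
  show "mY W' v k w \<in> mcarrier W'" using x C_Y by auto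
  show "mL0 W' w \<in> mcarrier W'" using x C_L0 by auto
  show "mLm1 W' w \<in> mcarrier W'" using x C_Lm1 by auto
  show "Vector_Spaces.linear (vscale V) (mscale W') (\<lambda>v. mY W' v k w)"
    using m_Y_linear1[OF xW, of k] x
    unfolding Vector_Spaces.linear_iff
    by (auto simp: phi_add phi_scale C_Y cod.vector_space_axioms)
  obtain K where "\<forall>k\<ge>K. mY W v k x = 0" using m_truncation[OF xW] by blast
  then show "\<exists>K. \<forall>k\<ge>K. mY W' v k w = 0"
    using x by (intro exI[of _ K]) auto
  show "mY W' (vac V) k w = (if k = - 1 then w else 0)"
    using x m_vacuum[OF xW] by simp
  show "jacobi_identity (mscale W') (vY V) (mY W') u v w"
    using jacobi_W'[OF x(1)] x by simp
  show "mL0 W' (mY W' v k w) - mY W' v k (mL0 W' w) =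
      mscale W' (- of_int k - 1) (mY W' v k w) + mY W' (vL0 V v) k w"
    using x m_L0_commutator[OF xW, of v k]
    by (simp add: phi_scale[symmetric] phi_diff[symmetric] phi_add[symmetric] C_Y C_L0 C_scale)
  show "mLm1 W' (mY W' v k w) - mY W' v k (mLm1 W' w) = mY W' (vLm1 V v) k w"
    using x m_Lm1_commutator[OF xW, of v k]
    by (simp add: phi_diff[symmetric] C_Y C_Lm1)
  show "mY W' (vLm1 V v) k w = mscale W' (- of_int k) (mY W' v (k - 1) w)"
    unfolding x(2) W'_simps(2) W'_simps(3)[OF x(1)] m_Lm1_derivative[OF xW]
    by (rule phi_scale) (rule C_Y[OF x(1)])
  show "mL0 W' (mLm1 W' w) - mLm1 W' (mL0 W' w) = mLm1 W' w"
    using x m_L0_Lm1[OF xW]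
    by (simp add: phi_diff[symmetric] C_L0 C_Lm1)
qed (use cod.vector_space_axioms grading_restricted_vertex_algebra_axioms in simp_all)

lemma Omega_W': "Omega V W' n = \<phi> ` (Omega V W n \<inter> C)"
  using C_subset by (auto simp: Omega_def phi_eq_0_iff C_Y image_iff)

lemma theta_entry_W':
  assumes x: "x \<in> C"
  shows "theta_entry V W k l v x \<in> C"
    "theta_entry V W' k l v (\<phi> x) = \<phi> (theta_entry V W k l v x)"
proof -
  have a: "vop_twisted (mscale W) (vgrade V) (mY W) fls_X v x n \<in> C" for n
    by (rule vop_twisted_phi) (use x C_Y in auto)
  have b: "vop_twisted t (vgrade V) (mY W') fls_X v (\<phi> x) =
      (\<lambda>n. \<phi> (vop_twisted (mscale W) (vgrade V) (mY W) fls_X v x n))"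
    by (rule ext, rule vop_twisted_phi) (use x C_Y in auto)
  show "theta_entry V W k l v x \<in> C"
    unfolding theta_entry_def Res_def by (rule laurent_times_phi) (rule a)
  show "theta_entry V W' k l v (\<phi> x) = \<phi> (theta_entry V W k l v x)"
    unfolding theta_entry_def Res_def by (simp add: b laurent_times_phi a)
qed

end

context lower_bounded_generalized_module
begin

lemma Omega_0: "0 \<in> Omega V W n"
proof -
  interpret vector_space "mscale W" by (rule m_vector_space)
  have 0: "0 \<in> mcarrier W" using m_subspace by (rule subspace_0)
  show ?thesis
    using 0 linear_on_zero[OF m_Y_linear2 0] by (auto simp: Omega_def)
qed

lemma Omega_add:
  assumes "x \<in> Omega V W n" "y \<in> Omega V W n"
  shows "x + y \<in> Omega V W n"
proof -
  interpret vector_space "mscale W" by (rule m_vector_space)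
  show ?thesis
    using assms m_Y_linear2 subspace_add[OF m_subspace]
    unfolding Omega_def linear_on_def by (auto split: if_splits)
qed

lemma Omega_minus:
  assumes "x \<in> Omega V W n"
  shows "- x \<in> Omega V W n"
proof -
  interpret vector_space "mscale W" by (rule m_vector_space)
  have *: "mY W v k (mscale W (-1) z) = mscale W (-1) (mY W v k z)" if "z \<in> mcarrier W" for v k z
    using that m_Y_linear2[of v k] unfolding linear_on_def by blast
  have "mscale W (-1) x \<in> Omega V W n"
    using assms * subspace_scale[OF m_subspace, of x "-1"]
    unfolding Omega_def by (auto split: if_splits)
  then show ?thesis by simp
qed

lemma Gr_class_eq:
  "Gr_class V W n x = Gr_class V W n y \<longleftrightarrow> x - y \<in> Omega V W (int n - 1)"
proof
  assume "Gr_class V W n x = Gr_class V W n y"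
  moreover have "x + 0 \<in> Gr_class V W n x" unfolding Gr_class_def using Omega_0 by blast
  ultimately obtain z where "x = y + z" "z \<in> Omega V W (int n - 1)"
    unfolding Gr_class_def by auto
  then show "x - y \<in> Omega V W (int n - 1)" by simp
next
  assume a: "x - y \<in> Omega V W (int n - 1)"
  have "Gr_class V W n a \<subseteq> Gr_class V W n b" if "a - b \<in> Omega V W (int n - 1)" for a b
    using Omega_add[OF that] unfolding Gr_class_def
    by (auto simp: image_iff) (metis add_diff_cancel_left' diff_add_cancel add.assoc add.commute)
  from this[OF a] this[of y x] Omega_minus[OF a]
  show "Gr_class V W n x = Gr_class V W n y" by auto
qed

lemma
  shows mgrade_add: "x \<in> mgrade W n \<Longrightarrow> y \<in> mgrade W n \<Longrightarrow> x + y \<in> mgrade W n"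
    and mgrade_scale: "x \<in> mgrade W n \<Longrightarrow> mscale W c x \<in> mgrade W n"
proof -
  interpret vector_space "mscale W" by (rule m_vector_space)
  define N where "N = (\<lambda>w. mL0 W w - mscale W n w)"
  have N_C: "N x \<in> mcarrier W" if "x \<in> mcarrier W" for x
    using that by (simp add: N_def m_L0_closed subspace_diff[OF m_subspace] subspace_scale[OF m_subspace])
  have N_add: "N (x + y) = N x + N y" if "x \<in> mcarrier W" "y \<in> mcarrier W" for x y
    using that m_L0_linear unfolding linear_on_def by (simp add: N_def scale_right_distrib)
  have N_scale: "N (mscale W c x) = mscale W c (N x)" if "x \<in> mcarrier W" for x
    using that m_L0_linear unfolding linear_on_def
    by (simp add: N_def scale_right_diff_distrib mult.commute)
  have Nm_C: "(N ^^ m) x \<in> mcarrier W" if "x \<in> mcarrier W" for m x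
    using that by (induction m) (simp_all add: N_C)
  have Nm_add: "(N ^^ m) (x + y) = (N ^^ m) x + (N ^^ m) y"
    if "x \<in> mcarrier W" "y \<in> mcarrier W" for m x y
    using that by (induction m) (simp_all add: N_add Nm_C)
  have Nm_scale: "(N ^^ m) (mscale W c x) = mscale W c ((N ^^ m) x)" if "x \<in> mcarrier W" for m x
    using that by (induction m) (simp_all add: N_scale Nm_C)
  have N0: "N 0 = 0" using N_add[of 0 0] subspace_0[OF m_subspace] by simp
  have Nm_0: "(N ^^ m) 0 = 0" for m by (induction m) (simp_all add: N0)
  have mg: "mgrade W n = {w \<in> mcarrier W. \<exists>m. (N ^^ m) w = 0}"
    by (simp add: mgrade_def N_def)
  show "x + y \<in> mgrade W n" if x: "x \<in> mgrade W n" and y: "y \<in> mgrade W n"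
  proof -
    from x obtain i where i: "(N ^^ i) x = 0" "x \<in> mcarrier W" by (auto simp: mg)
    from y obtain j where j: "(N ^^ j) y = 0" "y \<in> mcarrier W" by (auto simp: mg)
    have "(N ^^ (j + i)) x = 0" unfolding funpow_add using i Nm_0 by simp
    moreover have "(N ^^ (i + j)) y = 0" unfolding funpow_add using j Nm_0 by simp
    ultimately have "(N ^^ (i + j)) (x + y) = 0"
      using Nm_add[OF i(2) j(2)] by (simp add: add.commute)
    then show ?thesis
      using subspace_add[OF m_subspace i(2) j(2)] unfolding mg by blast
  qed
  show "mscale W c x \<in> mgrade W n" if x: "x \<in> mgrade W n"
  proof -
    from x obtain i where i: "(N ^^ i) x = 0" "x \<in> mcarrier W" by (auto simp: mg)
    have "(N ^^ i) (mscale W c x) = 0" by (simp add: Nm_scale[OF i(2)] i(1))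
    then show ?thesis
      using subspace_scale[OF m_subspace i(2)] unfolding mg by blast
  qed
qed

lemma component_eqI:
  assumes "x \<in> mcarrier W" "decomposes (mgrade W) x f"
  shows "component (mgrade W) n x = f n"
proof -
  have "(\<lambda>n. component (mgrade W) n x) = f"
    using m_direct_sum component_decomposes[OF assms(1)] assms
    unfolding direct_sum_decomposition_def by blast
  then show ?thesis by (rule fun_cong)
qed

lemma component_linear: "linear_on (mcarrier W) (mscale W) (mscale W) (component (mgrade W) n)"
proof -
  interpret vector_space "mscale W" by (rule m_vector_space)
  show ?thesis
    unfolding linear_on_def
  proof (intro conjI ballI allI)
    fix x y assume x: "x \<in> mcarrier W" and y: "y \<in> mcarrier W"
    let ?f = "\<lambda>n. component (mgrade W) n x" and ?g = "\<lambda>n. component (mgrade W) n y"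
    have f: "decomposes (mgrade W) x ?f" and g: "decomposes (mgrade W) y ?g"
      by (simp_all add: component_decomposes x y)
    have "finite ({n. ?f n \<noteq> 0} \<union> {n. ?g n \<noteq> 0})"
      using f g by (simp add: decomposes_def)
    then have fin: "finite {n. ?f n + ?g n \<noteq> 0}"
      by (rule rev_finite_subset) auto
    have "decomposes (mgrade W) (x + y) (\<lambda>n. ?f n + ?g n)"
      using f g fin unfolding decomposes_def by (simp add: mgrade_add Sum_any.distrib)
    from component_eqI[OF subspace_add[OF m_subspace x y] this]
    show "component (mgrade W) n (x + y) = ?f n + ?g n" .
  next
    fix c x assume x: "x \<in> mcarrier W"
    let ?f = "\<lambda>n. component (mgrade W) n x"
    have f: "decomposes (mgrade W) x ?f"
      using x by (rule component_decomposes)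
    have "mscale W c (Sum_any ?f) = Sum_any (\<lambda>n. mscale W c (?f n))"
      by (cases "c = 0") (simp_all add: Sum_any.expand_set scale_sum_right)
    moreover have "0 \<in> mgrade W n" for n
      using mgrade_scale[of "?f n" n 0] f by (simp add: decomposes_def)
    ultimately have "decomposes (mgrade W) (mscale W c x) (\<lambda>n. mscale W c (?f n))"
      using f unfolding decomposes_def by (cases "c = 0") (simp_all add: mgrade_scale)
    from component_eqI[OF subspace_scale[OF m_subspace x] this]
    show "component (mgrade W) n (mscale W c x) = mscale W c (?f n)" .
  qed
qed

lemma linear_on_span_closed:
  assumes lin: "linear_on (mcarrier W) (mscale W) (mscale W) f"
    and M: "M \<subseteq> mcarrier W" and f: "\<And>x. x \<in> M \<Longrightarrow> f x \<in> Modules.module.span (mscale W) M"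
    and x: "x \<in> Modules.module.span (mscale W) M"
  shows "f x \<in> Modules.module.span (mscale W) M"
proof -
  interpret vector_space "mscale W" by (rule m_vector_space)
  have sub: "span M \<subseteq> mcarrier W" by (rule span_minimal[OF M m_subspace])
  have "f x \<in> span M \<and> x \<in> span M" using x
  proof (induction rule: span_induct_alt)
    case base
    show ?case using linear_on_zero[OF lin subspace_0[OF m_subspace]] by (simp add: span_zero)
  next
    case (step c x y)
    have "x \<in> mcarrier W" "y \<in> mcarrier W" using step M sub by auto
    then have "f (mscale W c x + y) = mscale W c (f x) + f y"
      using lin subspace_scale[OF m_subspace] unfolding linear_on_def by simp
    then show ?case
      using step f by (simp add: span_add span_scale span_base)
  qed
  then show ?thesis ..
qed

lemma countable_span_V:
  obtains B where "countable B" "Modules.module.span (vscale V) B = UNIV"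
proof -
  interpret vector_space "vscale V" by (rule v_vector_space)
  have "\<forall>n. \<exists>B. finite B \<and> vgrade V n = span B" using v_grade_finite_dim by blast
  then obtain B where B: "\<And>n. finite (B n)" "\<And>n. vgrade V n = span (B n)" by metis
  have "v \<in> span (\<Union>n. B n)" for v
  proof -
    from v_direct_sum obtain f where "decomposes (vgrade V) v f"
      unfolding direct_sum_decomposition_def by blast
    then have f: "\<And>n. f n \<in> span (B n)" and v: "v = Sum_any f"
      by (auto simp: decomposes_def B)
    have "f n \<in> span (\<Union>n. B n)" for n
      using f[of n] span_mono[of "B n" "\<Union>n. B n"] by auto
    then show ?thesis unfolding v Sum_any.expand_set by (rule span_sum)
  qed
  then show ?thesis
    using that[of "\<Union>n. B n"] B(1) by (auto intro: countable_finite)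
qed

lemma countably_spanned_submodule:
  assumes S: "countable S" "S \<subseteq> mcarrier W"
  obtains M where "countable M" "S \<subseteq> M" "M \<subseteq> mcarrier W"
    "\<forall>x\<in>Modules.module.span (mscale W) M.
      (\<forall>v k. mY W v k x \<in> Modules.module.span (mscale W) M) \<and>
      mL0 W x \<in> Modules.module.span (mscale W) M \<and>
      mLm1 W x \<in> Modules.module.span (mscale W) M \<and>
      (\<forall>n. component (mgrade W) n x \<in> Modules.module.span (mscale W) M)"
proof -
  interpret vector_space "mscale W" by (rule m_vector_space)
  interpret V: vector_space "vscale V" by (rule v_vector_space)
  obtain B where B: "countable B" "V.span B = UNIV" by (rule countable_span_V)
  define supp where "supp x = {n. component (mgrade W) n x \<noteq> 0}" for x
  define F where "F X = X \<union> (\<Union>b\<in>B. \<Union>k. mY W b k ` X) \<union> mL0 W ` X \<union> mLm1 W ` X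
      \<union> (\<Union>x\<in>X. (\<lambda>n. component (mgrade W) n x) ` supp x)" for X
  define M where "M = (\<Union>i. (F ^^ i) S)"
  have comp_C: "component (mgrade W) n x \<in> mcarrier W" if "x \<in> mcarrier W" for n x
    using component_decomposes[OF that] unfolding decomposes_def mgrade_def by blast
  have supp: "countable (supp x)" if "x \<in> mcarrier W" for x
    using component_decomposes[OF that] unfolding decomposes_def supp_def
    by (auto intro: countable_finite)
  have F: "countable (F X) \<and> F X \<subseteq> mcarrier W" if X: "countable X" "X \<subseteq> mcarrier W" for X
  proof
    have sX: "countable (supp x)" if "x \<in> X" for x using that X(2) by (intro supp) (rule subsetD)
    show "countable (F X)" unfolding F_def
      by (intro countable_Un countable_UN countable_image X(1) B(1) sX) simp_all
    show "F X \<subseteq> mcarrier W"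
      unfolding F_def using subsetD[OF X(2)]
      by (intro Un_least UN_least image_subsetI)
        (simp_all add: X(2) m_Y_closed m_L0_closed m_Lm1_closed comp_C)
  qed
  have "countable ((F ^^ i) S) \<and> (F ^^ i) S \<subseteq> mcarrier W" for i
    by (induction i) (use S F in auto)
  then have M: "countable M" "M \<subseteq> mcarrier W"
    unfolding M_def by auto
  have SM: "S \<subseteq> M" unfolding M_def using UN_upper[of 0 UNIV "\<lambda>i. (F ^^ i) S"] by simp
  have FM: "y \<in> M" if "x \<in> M" and y: "\<And>X. x \<in> X \<Longrightarrow> y \<in> F X" for x y
  proof -
    from \<open>x \<in> M\<close> obtain i where "x \<in> (F ^^ i) S" unfolding M_def by blast
    then have "y \<in> (F ^^ Suc i) S" using y by simp
    then show ?thesis unfolding M_def by blast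
  qed
  have M_Y: "mY W v k x \<in> span M" if x: "x \<in> M" for v k x
  proof -
    have xW: "x \<in> mcarrier W" using x M(2) by blast
    interpret l: Vector_Spaces.linear "vscale V" "mscale W" "\<lambda>v. mY W v k x"
      by (rule m_Y_linear1[OF xW])
    have "mY W b k x \<in> M" if "b \<in> B" for b
      using x by (rule FM) (use that in \<open>auto simp: F_def\<close>)
    then have "(\<lambda>v. mY W v k x) ` B \<subseteq> M" by blast
    then have "span ((\<lambda>v. mY W v k x) ` B) \<subseteq> span M" by (rule span_mono)
    moreover have "mY W v k x \<in> span ((\<lambda>v. mY W v k x) ` B)"
      unfolding l.span_image using B(2) by auto
    ultimately show ?thesis by blast
  qed
  have M_L0: "mL0 W x \<in> span M" if "x \<in> M" for x
    by (rule span_base, rule FM[OF that]) (auto simp: F_def)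
  have M_Lm1: "mLm1 W x \<in> span M" if "x \<in> M" for x
    by (rule span_base, rule FM[OF that]) (auto simp: F_def)
  have M_comp: "component (mgrade W) n x \<in> span M" if "x \<in> M" for n x
  proof (cases "n \<in> supp x")
    case True
    then show ?thesis by (intro span_base FM[OF that]) (auto simp: F_def)
  next
    case False
    then show ?thesis by (simp add: supp_def span_zero)
  qed
  show ?thesis
  proof (rule that[OF M(1) SM M(2)], intro ballI conjI allI)
    fix x v k n assume x: "x \<in> span M"
    show "mY W v k x \<in> span M" by (rule linear_on_span_closed[OF m_Y_linear2 M(2) M_Y x])
    show "mL0 W x \<in> span M" by (rule linear_on_span_closed[OF m_L0_linear M(2) M_L0 x])
    show "mLm1 W x \<in> span M" by (rule linear_on_span_closed[OF m_Lm1_linear M(2) M_Lm1 x])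
    show "component (mgrade W) n x \<in> span M"
      by (rule linear_on_span_closed[OF component_linear M(2) M_comp x])
  qed
qed

end

lemma vector_space_poly: "vector_space (Polynomial.smult :: complex \<Rightarrow> complex poly \<Rightarrow> complex poly)"
  by unfold_locales (simp_all add: smult_add_right smult_add_left)

lemma countable_span_embedding:
  fixes s :: "complex \<Rightarrow> 'a::ab_group_add \<Rightarrow> 'a"
  assumes "vector_space s" "countable M"
  obtains \<phi> :: "'a \<Rightarrow> complex poly"
    where "Vector_Spaces.linear s Polynomial.smult \<phi>" "inj_on \<phi> (Modules.module.span s M)"
proof -
  interpret vs1: vector_space s by fact
  interpret vs2: vector_space "Polynomial.smult :: complex \<Rightarrow> complex poly \<Rightarrow> complex poly"
    by (rule vector_space_poly)
  interpret vector_space_pair s "Polynomial.smult :: complex \<Rightarrow> complex poly \<Rightarrow> complex poly" ..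
  obtain D where D: "D \<subseteq> M" "vs1.independent D" "M \<subseteq> vs1.span D"
    by (rule vs1.maximal_independent_subset)
  have cD: "countable D" using D(1) assms(2) by (rule countable_subset)
  define e :: "'a \<Rightarrow> complex poly" where "e = (\<lambda>d. Polynomial.monom 1 (to_nat_on D d))"
  define \<phi> where "\<phi> = construct D e"
  have lin: "Vector_Spaces.linear s Polynomial.smult \<phi>"
    unfolding \<phi>_def by (rule linear_construct[OF D(2)])
  have \<phi>_D: "\<phi> d = e d" if "d \<in> D" for d
    unfolding \<phi>_def by (rule construct_basis[OF D(2) that])
  have inj: "inj_on \<phi> D"
    using inj_on_to_nat_on[OF cD] by (auto simp: inj_on_def \<phi>_D e_def monom_eq_iff')
  have "vs2.independent (\<phi> ` D)"
    unfolding vs2.independent_explicit_module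
  proof (intro allI impI)
    fix T c and p :: "complex poly"
    assume T: "finite T" "T \<subseteq> \<phi> ` D" and 0: "(\<Sum>q\<in>T. Polynomial.smult (c q) q) = 0" and p: "p \<in> T"
    have monom: "\<exists>n. q = Polynomial.monom 1 n" if "q \<in> T" for q
      using T(2) that \<phi>_D by (auto simp: e_def)
    obtain n where n: "p = Polynomial.monom 1 n" using monom[OF p] by blast
    have *: "c q * Polynomial.coeff q n = (if q = p then c p else 0)" if "q \<in> T" for q
    proof -
      obtain m where "q = Polynomial.monom 1 m" using monom[OF \<open>q \<in> T\<close>] by blast
      then show ?thesis by (cases "m = n") (simp_all add: n monom_eq_iff')
    qed
    have "0 = Polynomial.coeff (\<Sum>q\<in>T. Polynomial.smult (c q) q) n" by (simp add: 0)
    also have "\<dots> = (\<Sum>q\<in>T. if q = p then c p else 0)"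
      unfolding coeff_sum coeff_smult by (rule sum.cong) (simp_all add: *)
    also have "\<dots> = c p" using T(1) p by simp
    finally show "c p = 0" by simp
  qed
  then have "inj_on \<phi> (vs1.span D)"
    using linear_inj_on_span_iff_independent_image[OF lin] inj by blast
  moreover have "vs1.span M \<subseteq> vs1.span D"
    by (rule vs1.span_minimal[OF D(3) vs1.subspace_span])
  ultimately show ?thesis using that[OF lin] inj_on_subset by blast
qed

theorem Q_inf_subset_theta_kernel:
  fixes V :: "'v::ab_group_add vertex_algebra" and W :: "('v, 'w::ab_group_add) vmodule"
  assumes "lower_bounded_generalized_module V W"
  shows "Q_inf V \<subseteq> theta_kernel V W"
proof
  fix u assume u: "u \<in> Q_inf V"
  interpret W: lower_bounded_generalized_module V W by fact
  interpret vector_space "mscale W" by (rule W.m_vector_space)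
  have "theta_Gr V W u g k = Gr_class V W k 0" if g: "g \<in> Gr V W" for g k
  proof -
    let ?L = "Gr_support V W g"
    have fin: "finite ?L" using g by (simp add: Gr_def)
    have g_cl: "\<exists>w\<in>Omega V W (int l). g l = Gr_class V W l w" for l
      using g unfolding Gr_def Gr_component_def by auto
    have key: "(\<Sum>l\<in>?L. theta_entry V W k l (u k l) (w l)) \<in> Omega V W (int k - 1)"
      if w: "\<forall>l. w l \<in> g l" for w
    proof -
      have g_w: "g l = Gr_class V W l (w l)" and w_Om: "w l \<in> Omega V W (int l)" for l
      proof -
        obtain z where z: "z \<in> Omega V W (int l)" "g l = Gr_class V W l z"
          using g_cl[of l] by blast
        with w obtain y where y: "y \<in> Omega V W (int l - 1)" "w l = z + y"
          unfolding Gr_class_def by blast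
        have "y \<in> Omega V W (int l)"
        proof (cases "l = 0")
          case True
          then have "y = 0" using y(1) by (simp add: Omega_def)
          then show ?thesis by (simp add: W.Omega_0)
        next
          case False
          then have y': "y \<in> mcarrier W"
            "\<And>r v k. v \<in> vgrade V r \<Longrightarrow> r - k - 1 < - (int l - 1) \<Longrightarrow> mY W v k y = 0"
            using y(1) by (simp_all add: Omega_def)
          have "mY W v k y = 0" if "v \<in> vgrade V r" "r - k - 1 < - int l" for r v k
            using that(1) by (rule y'(2)) (use that(2) in linarith)
          then show ?thesis using y'(1) by (simp add: Omega_def)
        qed
        then show "w l \<in> Omega V W (int l)" unfolding y(2) by (rule W.Omega_add[OF z(1)])
        show "g l = Gr_class V W l (w l)"
          by (simp add: z(2) W.Gr_class_eq y(2) W.Omega_minus[OF y(1)])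
      qed
      have Om_C: "Omega V W n \<subseteq> mcarrier W" for n
        using subspace_0[OF W.m_subspace] by (auto simp: Omega_def)
      have wC: "w ` ?L \<subseteq> mcarrier W"
        by (rule image_subsetI) (rule subsetD[OF Om_C w_Om])
      obtain M where M: "countable M" "w ` ?L \<subseteq> M" "M \<subseteq> mcarrier W"
        "\<forall>x\<in>span M. (\<forall>v k. mY W v k x \<in> span M) \<and> mL0 W x \<in> span M \<and>
          mLm1 W x \<in> span M \<and> (\<forall>n. component (mgrade W) n x \<in> span M)"
        by (rule W.countably_spanned_submodule[OF countable_finite[OF finite_imageI[OF fin]] wC])
      obtain \<phi> :: "'w \<Rightarrow> complex poly" where
        \<phi>: "Vector_Spaces.linear (mscale W) Polynomial.smult \<phi>" "inj_on \<phi> (span M)"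
        by (rule countable_span_embedding[OF W.m_vector_space M(1)])
      interpret poly: vector_space "Polynomial.smult :: complex \<Rightarrow> complex poly \<Rightarrow> complex poly"
        by (rule vector_space_poly)
      interpret E: module_embedding V W Polynomial.smult "span M" \<phi>
        using \<phi> M span_minimal[OF M(3) W.m_subspace]
        by unfold_locales (auto simp: linear_on_def Vector_Spaces.linear_iff)
      have u': "u \<in> theta_kernel V E.W'"
        using u E.transported.lower_bounded_generalized_module_axioms by (simp add: Q_inf_def)
      have \<phi>_mem: "\<phi> x \<in> \<phi> ` (X \<inter> span M) \<longleftrightarrow> x \<in> X" if "x \<in> span M" for x X
        using that by (auto simp: E.phi_eq_iff)
      have self: "x \<in> Gr_class V E.W' n x" for n x
        unfolding Gr_class_def by (rule image_eqI[OF _ E.transported.Omega_0]) simp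
      define w' where "w' l = (if l \<in> ?L then w l else 0)" for l
      have w': "w' l \<in> span M" "w' l \<in> Omega V W (int l)" for l
        using M(2) w_Om W.Omega_0 by (auto simp: w'_def span_base span_zero)
      define g' where "g' l = Gr_class V E.W' l (\<phi> (w' l))" for l
      have supp: "Gr_support V E.W' g' = ?L"
      proof -
        have "g' l \<noteq> Gr_class V E.W' l 0 \<longleftrightarrow> g l \<noteq> Gr_class V W l 0" for l
        proof -
          have "g' l = Gr_class V E.W' l 0 \<longleftrightarrow> \<phi> (w' l) \<in> \<phi> ` (Omega V W (int l - 1) \<inter> span M)"
            by (simp add: g'_def E.transported.Gr_class_eq E.Omega_W')
          also have "\<dots> \<longleftrightarrow> w' l \<in> Omega V W (int l - 1)"
            by (rule \<phi>_mem[OF w'(1)])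
          also have "\<dots> \<longleftrightarrow> g l = Gr_class V W l 0"
            using W.Gr_class_eq[of l "w l" 0] g_w[of l] W.Omega_0
            by (auto simp: w'_def Gr_support_def)
          finally show ?thesis by simp
        qed
        then show ?thesis by (simp add: Gr_support_def)
      qed
      have "g' \<in> Gr V E.W'"
        unfolding Gr_def Gr_component_def using supp fin w'
        by (auto simp: g'_def E.Omega_W')
      then have th: "theta_Gr V E.W' u g' k = Gr_class V E.W' k 0"
        using u' unfolding theta_kernel_def by simp
      have "(\<lambda>l. \<phi> (w' l)) \<in> {w. \<forall>l. w l \<in> g' l}"
        unfolding g'_def by (simp add: self)
      then have "Gr_class V E.W' k (\<Sum>l\<in>?L. theta_entry V E.W' k l (u k l) (\<phi> (w' l)))
          \<subseteq> theta_Gr V E.W' u g' k"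
        unfolding theta_Gr_def supp by (rule UN_upper)
      then have "(\<Sum>l\<in>?L. theta_entry V E.W' k l (u k l) (\<phi> (w' l))) \<in> Gr_class V E.W' k 0"
        unfolding th
        by (rule subsetD) (rule self)
      then have "(\<Sum>l\<in>?L. theta_entry V E.W' k l (u k l) (\<phi> (w' l)))
          \<in> \<phi> ` (Omega V W (int k - 1) \<inter> span M)"
        by (simp add: Gr_class_def E.Omega_W')
      also have "(\<Sum>l\<in>?L. theta_entry V E.W' k l (u k l) (\<phi> (w' l))) =
          \<phi> (\<Sum>l\<in>?L. theta_entry V W k l (u k l) (w' l))"
        by (simp add: E.theta_entry_W' w' E.phi_sum)
      finally have "(\<Sum>l\<in>?L. theta_entry V W k l (u k l) (w' l)) \<in> Omega V W (int k - 1)"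
        by (subst (asm) \<phi>_mem) (simp_all add: E.C_sum E.theta_entry_W'(1) w'(1))
      then show ?thesis by (simp add: w'_def)
    qed
    have "\<exists>w. \<forall>l. w l \<in> g l"
    proof -
      have "\<exists>x. x \<in> g l" for l
        using g_cl[of l] W.Omega_0 unfolding Gr_class_def by blast
      then show ?thesis by metis
    qed
    moreover have "Gr_class V W k (\<Sum>l\<in>?L. theta_entry V W k l (u k l) (w l)) = Gr_class V W k 0"
      if "\<forall>l. w l \<in> g l" for w
      using key[OF that] by (simp add: W.Gr_class_eq)
    ultimately show ?thesis unfolding theta_Gr_def by auto
  qed
  then show "u \<in> theta_kernel V W"
    using u unfolding theta_kernel_def Q_inf_def by auto
qed

end

theory Submission
  imports Defs "HOL-Library.Function_Algebras"
begin

text \<open>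
  The kernels \<open>\<vartheta>\<close> are described entrywise, and \<open>\<diamondop>\<close> is designed so that the entries of
  \<open>\<vartheta>(u \<diamondop> v)\<close> are the products of the entries of \<open>\<vartheta>(u)\<close> and \<open>\<vartheta>(v)\<close> (on vectors of
  \<open>\<Omega>\<^sub>l(W)\<close>, even without passing to the quotient). Hence \<open>A\<^sub>0\<^sub>0(V)\<close> is \<open>V\<close> modulo the elements
  whose zero modes vanish on \<open>\<Omega>\<^sub>0(W)\<close> for all \<open>W\<close>, and everything follows once this subspace is
  known to be \<open>O(V)\<close>.

  That \<open>O(V)\<close> acts as zero is a computation. Conversely, given \<open>v\<close> not in \<open>O(V)\<close>, choose a linear
  functional \<open>f\<close> on \<open>V\<close> that vanishes on \<open>O(V)\<close> but not at \<open>v\<close>. Following Li's construction of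
  regular representations, a module is built from functionals on \<open>V\<close> such that \<open>f\<close> is in
  \<open>\<Omega>\<^sub>0\<close> and \<open>(o(v) f)(\<one>) = f(v)\<close>: a vector \<open>w\<close> is thought of as the functional
  \<open>u \<mapsto> \<langle>w', Y(u, 1) w\<rangle>\<close> for a lowest weight vector \<open>w'\<close>. Then \<open>Y(v, y) w\<close> is the expansion at
  \<open>y = 0\<close> of the rational function of \<open>y\<close> whose expansion at \<open>y = 1\<close> is \<open>f(Y(v, y - 1) u)\<close>,
  and the residue theorem turns the Jacobi identity of \<open>V\<close> into the one of the module.
\<close>

section \<open>Binomial transforms of truncated sequences\<close>

text \<open>No rational function is ever formed. What is kept of one is its pairing with the test
  functions \<open>y^s x^r\<close>, where \<open>x = y - 1\<close>: their zeros and poles lie at 0,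
  1 and infinity, like the poles of the function. The relation \<open>y = 1 + x\<close> becomes a
  Pascal recursion for the residues, and this recursion together with truncation takes the place of
  analytic continuation: an identity known for one exponent, or for sufficiently negative ones,
  spreads to the others. The residue theorem reads \<open>Res_(y=0) + Res_(x=0) = 0\<close> and
  requires that there is no residue at infinity. As the function is \<open>O(y^(-a))\<close> there,
  the condition is \<open>s + r \<le> a - 2\<close>, a bound that recurs throughout. The Jacobi
  identity of the module carries no such condition; it is therefore obtained for very negative
  exponents of \<open>x\<close> and then carried to exponent 0. The degree \<open>n\<close> has to
  be recorded along with a functional, because the spaces of functionals of bounded pole order are
  nested; hence the module is an external direct sum.\<close>

lemma Sum_any_eq_lessThan:
  fixes g :: "nat \<Rightarrow> 'a::comm_monoid_add"
  assumes "\<And>i. N \<le> i \<Longrightarrow> g i = 0"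
  shows "Sum_any g = (\<Sum>i<N. g i)"
proof (rule Sum_any.expand_superset)
  show "{i. g i \<noteq> 0} \<subseteq> {..<N}"
    using assms not_le by blast
qed simp

text \<open>\<open>Sum_any\<close> is 0 on infinite support, so even an additive map commutes with
  it only under a finiteness hypothesis. This is why truncation accompanies every manipulation of
  mode sums below.\<close>

lemma Sum_any_additive:
  fixes F :: "'a::ab_group_add \<Rightarrow> 'b::ab_group_add"
  assumes add: "\<And>x y. F (x + y) = F x + F y" and fin: "finite {i. g i \<noteq> 0}"
  shows "F (Sum_any g) = Sum_any (\<lambda>i. F (g i))"
proof -
  have F0: "F 0 = 0" using add[of 0 0] by simp
  have "F (sum g A) = (\<Sum>i\<in>A. F (g i))" for A
    by (induction A rule: infinite_finite_induct) (simp_all add: add F0)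
  moreover have "Sum_any (\<lambda>i. F (g i)) = (\<Sum>i\<in>{i. g i \<noteq> 0}. F (g i))"
    by (rule Sum_any.expand_superset[OF fin]) (auto simp: F0)
  ultimately show ?thesis by (simp add: Sum_any.expand_set)
qed

lemma int_bound: "\<exists>N. (K::int) \<le> r + int N"
  by (rule exI[of _ "nat (K - r)"]) simp

lemma nat_le_add: "nat (K - q) \<le> i \<Longrightarrow> K \<le> q + int i"
  by simp

lemma uniform_bound:
  assumes "\<And>l. l < N \<Longrightarrow> \<exists>M. \<forall>m\<ge>M. P l m"
  shows "\<exists>M::int. \<forall>l<N::nat. \<forall>m\<ge>M. P l m"
  using assms
proof (induction N)
  case (Suc N)
  then obtain M where M: "\<forall>l<N. \<forall>m\<ge>M. P l m" by (meson less_SucI)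
  obtain M' where M': "\<forall>m\<ge>M'. P N m" using Suc.prems by blast
  show ?case
    by (rule exI[of _ "max M M'"]) (use M M' in \<open>auto simp: less_Suc_eq\<close>)
qed simp

lemma finite_nat_support:
  fixes g :: "nat \<Rightarrow> 'a::zero"
  assumes "\<And>i. M \<le> i \<Longrightarrow> g i = 0"
  shows "finite {i. g i \<noteq> 0}"
proof (rule finite_subset)
  show "{i. g i \<noteq> 0} \<subseteq> {..<M}" using assms not_le by blast
qed simp

section \<open>Power series acting on coefficient sequences\<close>

text \<open>With \<open>\<alpha> k\<close> read as the coefficient of \<open>y^(-k-1)\<close>, this
  multiplies the series by the power series \<open>c\<close> in \<open>y\<close>. If
  \<open>\<alpha> m\<close> vanishes for large \<open>m\<close>, the series is a Laurent series and
  all sums are finite.\<close>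

definition seq_act :: "complex fps \<Rightarrow> (int \<Rightarrow> complex) \<Rightarrow> int \<Rightarrow> complex"
  where "seq_act c \<alpha> s = Sum_any (\<lambda>i::nat. fps_nth c i * \<alpha> (s + int i))"

lemma seq_act_eq_sum:
  assumes "\<And>m. M \<le> m \<Longrightarrow> \<alpha> m = 0" "M \<le> s + int N"
  shows "seq_act c \<alpha> s = (\<Sum>i<N. fps_nth c i * \<alpha> (s + int i))"
  unfolding seq_act_def by (rule Sum_any_eq_lessThan) (use assms in auto)

lemma seq_act_vanish:
  assumes "\<And>m. M \<le> m \<Longrightarrow> \<alpha> m = 0" "M \<le> s"
  shows "seq_act c \<alpha> s = 0"
  using seq_act_eq_sum[of M \<alpha> s 0] assms by simp

text \<open>At the lowest power of \<open>y\<close> only the constant term of \<open>c\<close>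
  contributes. The transforms are thus triangular, which is what \<open>dual_modes_unique\<close>
  rests on.\<close>

lemma seq_act_top:
  assumes "\<And>m. s < m \<Longrightarrow> \<alpha> m = 0"
  shows "seq_act c \<alpha> s = fps_nth c 0 * \<alpha> s"
  using seq_act_eq_sum[of "s + 1" \<alpha> s 1] assms by simp

lemma seq_act_mult:
  assumes \<alpha>: "\<And>m. M \<le> m \<Longrightarrow> \<alpha> m = 0"
  shows "seq_act (c * d) \<alpha> s = seq_act c (seq_act d \<alpha>) s"
proof -
  define N where "N = nat (M - s)"
  have "seq_act c (seq_act d \<alpha>) s = (\<Sum>j<N. fps_nth c j * seq_act d \<alpha> (s + int j))"
    by (rule seq_act_eq_sum[of M]) (auto intro: seq_act_vanish \<alpha> simp: N_def)
  also have "\<dots> = (\<Sum>j<N. \<Sum>l<N - j. fps_nth c j * fps_nth d l * \<alpha> (s + int (j + l)))"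
  proof (rule sum.cong[OF refl])
    fix j assume "j \<in> {..<N}"
    then have "seq_act d \<alpha> (s + int j) = (\<Sum>l<N - j. fps_nth d l * \<alpha> (s + int j + int l))"
      by (intro seq_act_eq_sum[of M] \<alpha>) (auto simp: N_def)
    then show "fps_nth c j * seq_act d \<alpha> (s + int j) =
        (\<Sum>l<N - j. fps_nth c j * fps_nth d l * \<alpha> (s + int (j + l)))"
      by (simp add: sum_distrib_left algebra_simps)
  qed
  also have "\<dots> = (\<Sum>(j, l)\<in>{(j, l). j + l < N}. fps_nth c j * fps_nth d l * \<alpha> (s + int (j + l)))"
    by (subst sum.Sigma) (auto intro!: sum.cong)
  also have "\<dots> = (\<Sum>k<N. \<Sum>i\<le>k. fps_nth c i * fps_nth d (k - i) * \<alpha> (s + int k))"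
    by (simp add: sum.triangle_reindex)
  also have "\<dots> = (\<Sum>k<N. fps_nth (c * d) k * \<alpha> (s + int k))"
    by (simp add: fps_mult_nth sum_distrib_right atLeast0AtMost)
  also have "\<dots> = seq_act (c * d) \<alpha> s"
    by (rule seq_act_eq_sum[of M, symmetric]) (auto simp: \<alpha> N_def)
  finally show ?thesis ..
qed

lemma seq_act_add:
  assumes "\<And>m. M \<le> m \<Longrightarrow> \<alpha> m = 0" "\<And>m. M \<le> m \<Longrightarrow> \<beta> m = 0"
  shows "seq_act c (\<lambda>m. \<alpha> m + \<beta> m) s = seq_act c \<alpha> s + seq_act c \<beta> s"
proof -
  let ?N = "nat (M - s)"
  have "seq_act c (\<lambda>m. \<alpha> m + \<beta> m) s = (\<Sum>i<?N. fps_nth c i * (\<alpha> (s + int i) + \<beta> (s + int i)))"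
    by (rule seq_act_eq_sum[of M]) (auto simp: assms)
  then show ?thesis
    using seq_act_eq_sum[of M \<alpha> s ?N c] seq_act_eq_sum[of M \<beta> s ?N c] assms
    by (simp add: distrib_left sum.distrib)
qed

lemma seq_act_scale:
  assumes "\<And>m. M \<le> m \<Longrightarrow> \<alpha> m = 0"
  shows "seq_act c (\<lambda>m. z * \<alpha> m) s = z * seq_act c \<alpha> s"
proof -
  let ?N = "nat (M - s)"
  have "seq_act c (\<lambda>m. z * \<alpha> m) s = (\<Sum>i<?N. fps_nth c i * (z * \<alpha> (s + int i)))"
    by (rule seq_act_eq_sum[of M]) (auto simp: assms)
  then show ?thesis
    using seq_act_eq_sum[of M \<alpha> s ?N c] assms by (simp add: sum_distrib_left mult_ac)
qed

lemma seq_act_1 [simp]: "seq_act 1 \<alpha> = \<alpha>"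
proof
  fix s
  have "seq_act 1 \<alpha> s = (\<Sum>i<1. fps_nth 1 i * \<alpha> (s + int i))"
    unfolding seq_act_def by (rule Sum_any_eq_lessThan) auto
  then show "seq_act 1 \<alpha> s = \<alpha> s" by simp
qed

lemma seq_act_one_minus_X: "seq_act (1 - fps_X) \<alpha> s = \<alpha> s - \<alpha> (s + 1)"
proof -
  have "seq_act (1 - fps_X) \<alpha> s = (\<Sum>i<2. fps_nth (1 - fps_X) i * \<alpha> (s + int i))"
    unfolding seq_act_def by (rule Sum_any_eq_lessThan) auto
  then show ?thesis by (simp add: numeral_2_eq_2)
qed

text \<open>The expansion of \<open>(1 - y)^r\<close> in nonnegative powers of
  \<open>y\<close>.\<close>

definition alt_binomial :: "int \<Rightarrow> complex fps"
  where "alt_binomial r = Abs_fps (\<lambda>i. (- 1) ^ i * (of_int r gchoose i))"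

lemma alt_binomial_add: "alt_binomial (r + s) = alt_binomial r * alt_binomial s"
proof (rule fps_ext)
  fix k
  have "(\<Sum>i\<le>k. (- 1) ^ i * (of_int r gchoose i) * ((- 1) ^ (k - i) * (of_int s gchoose (k - i)))) =
      (\<Sum>i\<le>k. (- 1) ^ k * ((of_int r gchoose i) * (of_int s gchoose (k - i)) :: complex))"
  proof (rule sum.cong[OF refl])
    fix i assume "i \<in> {..k}"
    then have "(- 1 :: complex) ^ k = (- 1) ^ i * (- 1) ^ (k - i)" by (simp flip: power_add)
    then show "(- 1) ^ i * (of_int r gchoose i) * ((- 1) ^ (k - i) * (of_int s gchoose (k - i))) =
        (- 1) ^ k * ((of_int r gchoose i) * (of_int s gchoose (k - i)) :: complex)"
      by simp
  qed
  also have "\<dots> = (- 1) ^ k * (of_int r + of_int s gchoose k)"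
    by (simp only: sum_distrib_left[symmetric] gbinomial_Vandermonde atLeast0AtMost[symmetric])
  finally show "fps_nth (alt_binomial (r + s)) k = fps_nth (alt_binomial r * alt_binomial s) k"
    by (simp add: alt_binomial_def fps_mult_nth atLeast0AtMost)
qed

lemma alt_binomial_0 [simp]: "alt_binomial 0 = 1"
  by (rule fps_ext) (simp add: alt_binomial_def gbinomial_0_left)

lemma alt_binomial_1: "alt_binomial 1 = 1 - fps_X"
proof (rule fps_ext)
  fix k
  consider "k = (0::nat)" | "k = 1" | "k \<ge> 2" by linarith
  then show "fps_nth (alt_binomial 1) k = fps_nth (1 - fps_X) k"
  proof cases
    case 3
    have "(of_nat 1 gchoose k :: complex) = of_nat (1 choose k)" by (rule binomial_gbinomial[symmetric])
    then show ?thesis using 3 by (simp add: alt_binomial_def)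
  qed (simp_all add: alt_binomial_def)
qed

lemma alt_binomial_nth_0 [simp]: "fps_nth (alt_binomial r) 0 = 1"
  by (simp add: alt_binomial_def)

text \<open>
  On the coefficients of \<open>\<Sum>\<^sub>k \<alpha> k y\<^bsup>- k - 1\<^esup>\<close> this is multiplication by \<open>(y - 1)\<^sup>r\<close>,
  expanded in powers of \<open>y\<close>.
\<close>

definition alt_shift :: "int \<Rightarrow> (int \<Rightarrow> complex) \<Rightarrow> int \<Rightarrow> complex"
  where "alt_shift r \<alpha> s = (- 1) powi r * seq_act (alt_binomial r) \<alpha> s"

lemma alt_shift_0 [simp]: "alt_shift 0 \<alpha> = \<alpha>"
  by (rule ext) (simp add: alt_shift_def)

lemma alt_shift_vanish:
  "(\<And>m. M \<le> m \<Longrightarrow> \<alpha> m = 0) \<Longrightarrow> M \<le> s \<Longrightarrow> alt_shift r \<alpha> s = 0"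
  by (simp add: alt_shift_def seq_act_vanish[of M])

lemma alt_shift_top: "(\<And>m. s < m \<Longrightarrow> \<alpha> m = 0) \<Longrightarrow> alt_shift r \<alpha> s = (- 1) powi r * \<alpha> s"
  by (simp add: alt_shift_def seq_act_top)

lemma alt_shift_scale:
  "(\<And>m. M \<le> m \<Longrightarrow> \<alpha> m = 0) \<Longrightarrow> alt_shift r (\<lambda>m. z * \<alpha> m) s = z * alt_shift r \<alpha> s"
  by (simp add: alt_shift_def seq_act_scale[of M])

lemma alt_shift_add:
  "(\<And>m. M \<le> m \<Longrightarrow> \<alpha> m = 0) \<Longrightarrow> (\<And>m. M \<le> m \<Longrightarrow> \<beta> m = 0) \<Longrightarrow>
    alt_shift r (\<lambda>m. \<alpha> m + \<beta> m) s = alt_shift r \<alpha> s + alt_shift r \<beta> s"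
  by (simp add: alt_shift_def seq_act_add[of M] distrib_left)

lemma alt_shift_alt_shift:
  assumes "\<And>m. M \<le> m \<Longrightarrow> \<alpha> m = 0"
  shows "alt_shift r (alt_shift r' \<alpha>) s = alt_shift (r + r') \<alpha> s"
proof -
  have "seq_act (alt_binomial r) (\<lambda>s. (- 1) powi r' * seq_act (alt_binomial r') \<alpha> s) s =
      (- 1) powi r' * seq_act (alt_binomial r) (seq_act (alt_binomial r') \<alpha>) s"
    by (rule seq_act_scale[of M]) (rule seq_act_vanish[OF assms])
  then have "alt_shift r (alt_shift r' \<alpha>) s =
      (- 1) powi r * ((- 1) powi r' * seq_act (alt_binomial r) (seq_act (alt_binomial r') \<alpha>) s)"
    by (simp add: alt_shift_def[abs_def])
  also have "\<dots> = alt_shift (r + r') \<alpha> s"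
    by (simp add: alt_shift_def alt_binomial_add seq_act_mult[OF assms] power_int_add)
  finally show ?thesis .
qed

text \<open>Multiplication by \<open>y\<close> shifts the index by one, so the extra factor
  \<open>y - 1\<close> is a difference. This recursion and \<open>vres_Suc\<close> match each other
  on the two sides of the residue theorem.\<close>

lemma alt_shift_Suc:
  assumes "\<And>m. M \<le> m \<Longrightarrow> \<alpha> m = 0"
  shows "alt_shift (r + 1) \<alpha> s = alt_shift r \<alpha> (s + 1) - alt_shift r \<alpha> s"
proof -
  have "alt_shift (1 + r) \<alpha> s = alt_shift 1 (alt_shift r \<alpha>) s"
    by (rule alt_shift_alt_shift[OF assms, symmetric])
  also have "\<dots> = alt_shift r \<alpha> (s + 1) - alt_shift r \<alpha> s"
    by (simp add: alt_shift_def[of 1] alt_binomial_1 seq_act_one_minus_X)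
  finally show ?thesis by (simp add: add.commute)
qed

lemma alt_shift_diff:
  assumes "\<And>m. M \<le> m \<Longrightarrow> \<alpha> m = 0" "\<And>m. M \<le> m \<Longrightarrow> \<beta> m = 0"
  shows "alt_shift r (\<lambda>m. \<alpha> m - \<beta> m) s = alt_shift r \<alpha> s - alt_shift r \<beta> s"
  using alt_shift_add[of M \<alpha> "\<lambda>m. (- 1) * \<beta> m" r s] alt_shift_scale[of M \<beta> r "- 1" s] assms
  by simp

text \<open>The sequence \<open>of_int s * \<alpha> (s - 1)\<close> holds the coefficients of minus
  the derivative, so this is the product rule for \<open>(y - 1)^r\<close> times the series.\<close>

lemma alt_shift_deriv:
  assumes \<alpha>: "\<And>m. M \<le> m \<Longrightarrow> \<alpha> m = 0"
  shows "alt_shift r (\<lambda>s. of_int s * \<alpha> (s - 1)) s =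
    of_int s * alt_shift r \<alpha> (s - 1) + of_int r * alt_shift (r - 1) \<alpha> s"
proof -
  obtain N where N: "M + 1 \<le> s + int N" by (meson int_bound)
  let ?q = "\<lambda>r i. fps_nth (alt_binomial r) i"
  have coeff: "?q r (Suc i) * of_int (s + int (Suc i)) = of_int s * ?q r (Suc i) - of_int r * ?q (r - 1) i" for i
  proof -
    have "(- 1) ^ i * (of_nat (Suc i) * (of_int r gchoose Suc i)) =
        (- 1) ^ i * (of_int r * (of_int r - 1 gchoose i) :: complex)"
      by (simp only: gbinomial_absorption)
    then show ?thesis by (simp add: alt_binomial_def algebra_simps)
  qed
  have "seq_act (alt_binomial r) (\<lambda>s. of_int s * \<alpha> (s - 1)) s =
      (\<Sum>i<Suc N. ?q r i * of_int (s + int i) * \<alpha> (s + int i - 1))"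
    using seq_act_eq_sum[of "M + 1" "\<lambda>s. of_int s * \<alpha> (s - 1)" s "Suc N" "alt_binomial r"] \<alpha> N
    by (simp add: mult.assoc)
  also have "\<dots> = of_int s * (\<Sum>i<Suc N. ?q r i * \<alpha> (s - 1 + int i)) -
      of_int r * (\<Sum>i<N. ?q (r - 1) i * \<alpha> (s + int i))"
    unfolding sum.lessThan_Suc_shift coeff left_diff_distrib sum_subtractf
    by (simp add: sum_distrib_left algebra_simps)
  also have "\<dots> = of_int s * seq_act (alt_binomial r) \<alpha> (s - 1) -
      of_int r * seq_act (alt_binomial (r - 1)) \<alpha> s"
    using seq_act_eq_sum[of M \<alpha> "s - 1" "Suc N", OF \<alpha>] seq_act_eq_sum[of M \<alpha> s N, OF \<alpha>] N
    by simp
  finally show ?thesis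
    by (simp add: alt_shift_def power_int_diff right_diff_distrib)
qed

text \<open>
  On the coefficients of \<open>\<Sum> G i j x\<^sub>1\<^bsup>- i - 1\<^esup> x\<^sub>2\<^bsup>- j - 1\<^esup>\<close> this is multiplication by
  \<open>(x\<^sub>1 - x\<^sub>2)\<^bsup>r\<^esup>\<close>, expanded in nonnegative powers of \<open>x\<^sub>2\<close>.
\<close>

definition cross :: "int \<Rightarrow> (int \<Rightarrow> int \<Rightarrow> complex) \<Rightarrow> int \<Rightarrow> int \<Rightarrow> complex"
  where "cross r G s t =
    Sum_any (\<lambda>l::nat. (- 1) ^ l * (of_int r gchoose l) * G (s + r - int l) (t + int l))"

text \<open>All terms lie on the antidiagonal of total index \<open>s + t + r\<close>, so the
  product in two variables is the one-variable transform along it.\<close>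

lemma cross_seq_act: "cross r G s t = seq_act (alt_binomial r) (\<lambda>j. G (s + t + r - j) j) t"
  unfolding cross_def seq_act_def alt_binomial_def
  by (rule arg_cong[of _ _ Sum_any]) (auto simp: algebra_simps)

lemma cross_Suc:
  assumes "\<And>i j. M \<le> j \<Longrightarrow> G i j = 0"
  shows "cross (r + 1) G s t = cross r G (s + 1) t - cross r G s (t + 1)"
proof -
  let ?\<alpha> = "\<lambda>j. G (s + t + r + 1 - j) j"
  have "cross (r + 1) G s t = seq_act (alt_binomial 1 * alt_binomial r) ?\<alpha> t"
    by (simp add: cross_seq_act alt_binomial_add algebra_simps)
  also have "\<dots> = seq_act (alt_binomial r) ?\<alpha> t - seq_act (alt_binomial r) ?\<alpha> (t + 1)"
    by (subst seq_act_mult[of M]) (auto simp: assms alt_binomial_1 seq_act_one_minus_X)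
  finally show ?thesis by (simp add: cross_seq_act algebra_simps)
qed

lemma cross_0 [simp]: "cross 0 G s t = G s t"
  by (simp add: cross_seq_act)

lemma cross_vanish:
  "(\<And>i j. M \<le> j \<Longrightarrow> G i j = 0) \<Longrightarrow> M \<le> t \<Longrightarrow> cross r G s t = 0"
  unfolding cross_seq_act by (rule seq_act_vanish[of M]) auto

lemma cross_eq_0:
  "(\<And>l::nat. G (s + r - int l) (t + int l) = 0) \<Longrightarrow> cross r G s t = 0"
  by (simp add: cross_def)

lemma cross_add:
  assumes "\<And>i j. M \<le> j \<Longrightarrow> G i j = 0" "\<And>i j. M \<le> j \<Longrightarrow> H i j = 0"
  shows "cross r (\<lambda>i j. G i j + H i j) s t = cross r G s t + cross r H s t"
  unfolding cross_seq_act by (rule seq_act_add[of M]) (auto simp: assms)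

lemma cross_diff:
  assumes "\<And>i j. M \<le> j \<Longrightarrow> G i j = 0" "\<And>i j. M \<le> j \<Longrightarrow> H i j = 0"
  shows "cross r (\<lambda>i j. G i j - H i j) s t = cross r G s t - cross r H s t"
proof -
  have "cross r (\<lambda>i j. G i j + (- 1) * H i j) s t = cross r G s t + cross r (\<lambda>i j. (- 1) * H i j) s t"
    by (rule cross_add[of M]) (simp_all add: assms)
  moreover have "cross r (\<lambda>i j. (- 1) * H i j) s t = (- 1) * cross r H s t"
    unfolding cross_seq_act by (rule seq_act_scale[of M]) (simp add: assms)
  ultimately show ?thesis by simp
qed

lemma cross_shift1: "cross r (\<lambda>i j. G (i + 1) j) s t = cross r G (s + 1) t"
  by (simp add: cross_def algebra_simps)

lemma cross_shift2: "cross r (\<lambda>i j. G i (j + 1)) s t = cross r G s (t + 1)"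
  by (simp add: cross_def algebra_simps)

lemma int_alternating:
  fixes X :: "int \<Rightarrow> complex"
  assumes "\<And>r. X (r + 1) = - X r" "X r0 = 0"
  shows "X r = 0"
proof (induction r rule: int_induct[where k = r0])
  case (step2 i)
  then show ?case using assms(1)[of "i - 1"] by simp
qed (simp_all add: assms)

text \<open>Upwards in \<open>s\<close> the recursion propagates zero directly. Downwards it only
  makes a row alternate in sign, and the vanishing for large \<open>r\<close> is what kills such a
  row.\<close>

lemma pascal_unique:
  fixes X :: "int \<Rightarrow> int \<Rightarrow> complex"
  assumes step: "\<And>s r. X (s + 1) r = X s r + X s (r + 1)" and X0: "\<And>r. X 0 r = 0"
    and van: "\<And>s. \<exists>M. \<forall>r\<ge>M. X s r = 0"
  shows "X s r = 0"
proof -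
  have "\<forall>r. X s r = 0"
  proof (induction s rule: int_induct[where k = 0])
    case base show ?case using X0 by simp
  next
    case (step1 i) then show ?case by (simp add: step)
  next
    case (step2 i)
    have eq: "X (i - 1) r = - X (i - 1) (r + 1)" for r
      using step[of "i - 1" r] step2 by (simp add: eq_neg_iff_add_eq_0)
    obtain M where M: "\<And>r. M \<le> r \<Longrightarrow> X (i - 1) r = 0" using van by blast
    have X0: "X (i - 1) (M - int k) = 0" for k
    proof (induction k)
      case (Suc k)
      then show ?case using eq[of "M - int (Suc k)"] by simp
    qed (simp add: M)
    have "X (i - 1) r = 0" if "r < M" for r
      using X0[of "nat (M - r)"] that by simp
    then show ?case using M by (meson not_le)
  qed
  then show ?thesis by blast
qed


section \<open>Hasse derivatives paired with a functional\<close>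

lemma gchoose_Suc_Suc: "(a + 1 :: complex) gchoose Suc k = (a gchoose Suc k) + (a gchoose k)"
  using gbinomial_addition_formula[of "a + 1" k] by simp

text \<open>
  The \<open>t\<close>-th Hasse derivative of \<open>(1 + x)\<^bsup>s\<^esup> x\<^bsup>r\<^esup>\<close>, times
  \<open>(1 + x)\<^bsup>p\<^esup> x\<^bsup>q\<^esup>\<close>, paired with a functional \<open>g\<close> on the functions
  \<open>(1 + x)\<^bsup>s\<^esup> x\<^bsup>r\<^esup>\<close>.
\<close>

definition hasse ::
    "nat \<Rightarrow> int \<Rightarrow> int \<Rightarrow> int \<Rightarrow> int \<Rightarrow> (int \<Rightarrow> int \<Rightarrow> complex) \<Rightarrow> complex"
  where "hasse t s r p q g = (\<Sum>i\<le>t. (of_int s gchoose i) * (of_int r gchoose (t - i)) *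
    g (s + p - int i) (r + q - int (t - i)))"

lemma hasse_Suc_right:
  assumes "\<And>s r. g (s + 1) r = g s r + g s (r + 1)"
  shows "hasse t s r (p + 1) q g = hasse t s r p q g + hasse t s r p (q + 1) g"
proof -
  have "g (s + (p + 1) - int i) (r + q - int (t - i)) =
      g (s + p - int i) (r + q - int (t - i)) + g (s + p - int i) (r + (q + 1) - int (t - i))" for i
    using assms[of "s + p - int i" "r + q - int (t - i)"] by (simp add: algebra_simps)
  then show ?thesis by (simp only: hasse_def sum.distrib distrib_left)
qed

text \<open>The derivative is taken of
  \<open>(1 + x)^(s+1) x^r = (1 + x)^s x^r + (1 + x)^s x^(r+1)\<close>, and the hypothesis on
  \<open>g\<close> is this relation under the functional. Pascal's rule, applied to the binomial of
  \<open>s\<close> on the left and to that of \<open>r\<close> on the right, yields the same three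
  sums.\<close>

lemma hasse_Suc_left:
  assumes g: "\<And>s r. g (s + 1) r = g s r + g s (r + 1)"
  shows "hasse t (s + 1) r p q g = hasse t s r p q g + hasse t s (r + 1) p q g"
proof (cases t)
  case 0
  then show ?thesis
    using g[of "s + p" "r + q"] by (simp add: hasse_def algebra_simps)
next
  case (Suc t')
  let ?a = "\<lambda>i. (of_int s gchoose i) :: complex" and ?b = "\<lambda>i. (of_int r gchoose i) :: complex"
  let ?h = "\<lambda>i. g (s + p - int i) (r + q + 1 - int (t - i))"
  have g': "g (s + 1 + p - int i) (r + q - int (t - i)) =
      g (s + p - int i) (r + q - int (t - i)) + ?h i" for i
    using g[of "s + p - int i" "r + q - int (t - i)"] by (simp add: algebra_simps)
  have "hasse t (s + 1) r p q g = (\<Sum>i\<le>t. ?a i * ?b (t - i) * g (s + 1 + p - int i) (r + q - int (t - i)))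
      + (\<Sum>i\<le>t'. ?a i * ?b (t' - i) * g (s + p - int i) (r + q - int (t' - i)))"
    unfolding hasse_def Suc sum.atMost_Suc_shift of_int_add of_int_1 gchoose_Suc_Suc distrib_right
      sum.distrib
    by (simp add: algebra_simps)
  also have "(\<Sum>i\<le>t'. ?a i * ?b (t' - i) * g (s + p - int i) (r + q - int (t' - i))) =
      (\<Sum>i\<le>t'. ?a i * ?b (t' - i) * ?h i)"
    by (rule sum.cong) (auto simp: Suc of_nat_diff algebra_simps)
  finally have 1: "hasse t (s + 1) r p q g = hasse t s r p q g + (\<Sum>i\<le>t. ?a i * ?b (t - i) * ?h i)
      + (\<Sum>i\<le>t'. ?a i * ?b (t' - i) * ?h i)"
    by (simp only: g' distrib_left sum.distrib hasse_def)
  have *: "(of_int (r + 1) gchoose (t - i) :: complex) = ?b (t - i) + (if i \<le> t' then ?b (t' - i) else 0)"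
    if "i \<le> t" for i
  proof (cases "i \<le> t'")
    case True
    then have "t - i = Suc (t' - i)" using Suc by simp
    then show ?thesis using True by (simp add: gchoose_Suc_Suc)
  next
    case False
    then show ?thesis using that Suc by simp
  qed
  have "hasse t s (r + 1) p q g = (\<Sum>i\<le>t. ?a i * (of_int (r + 1) gchoose (t - i)) * ?h i)"
    unfolding hasse_def by (rule sum.cong) (simp_all add: algebra_simps)
  also have "\<dots> = (\<Sum>i\<le>t. ?a i * ?b (t - i) * ?h i + (if i \<le> t' then ?a i * ?b (t' - i) * ?h i else 0))"
    by (rule sum.cong[OF refl], simp only: atMost_iff *) (simp add: algebra_simps)
  also have "\<dots> = (\<Sum>i\<le>t. ?a i * ?b (t - i) * ?h i) + (\<Sum>i\<le>t'. ?a i * ?b (t' - i) * ?h i)"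
    by (simp add: sum.distrib Suc)
  finally show ?thesis by (simp add: 1)
qed

lemma hasse_0_left:
  "hasse t 0 r p q g = (of_int r gchoose t) * g p (r + q - int t)"
proof -
  have "hasse t 0 r p q g = (\<Sum>i\<le>t. if i = 0 then (of_int r gchoose t) * g p (r + q - int t) else 0)"
    unfolding hasse_def by (rule sum.cong) (auto simp: gbinomial_0_left)
  then show ?thesis by simp
qed

lemma hasse_0_right:
  "hasse t s 0 p q g = (of_int s gchoose t) * g (s + p - int t) q"
proof -
  have "hasse t s 0 p q g = (\<Sum>i\<le>t. if i = t then (of_int s gchoose t) * g (s + p - int t) q else 0)"
    unfolding hasse_def by (rule sum.cong) (auto simp: gbinomial_0_left)
  then show ?thesis by simp
qed

section \<open>Additivity of the Jacobi identity\<close>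

text \<open>Serves to reduce the Jacobi identity to homogeneous vectors. The truncation hypotheses
  give the three sums finite support, so that they split.\<close>

lemma jacobi_identity_add:
  fixes YW :: "'v::ab_group_add \<Rightarrow> int \<Rightarrow> 'w \<Rightarrow> 'w::ab_group_add"
  assumes s: "\<And>c x y. s c (x + y) = s c x + s c y"
    and s0: "\<And>c. s c 0 = 0"
    and closed: "\<And>v k x. x \<in> C \<Longrightarrow> YW v k x \<in> C"
    and YW1: "\<And>v v' k x. x \<in> C \<Longrightarrow> YW (v + v') k x = YW v k x + YW v' k x"
    and YW2: "\<And>v k x y. x \<in> C \<Longrightarrow> y \<in> C \<Longrightarrow> YW v k (x + y) = YW v k x + YW v k y"
    and YV: "\<And>v v' k x. YV (v + v') k x = YV v k x + YV v' k x"
      "\<And>v k x y. YV v k (x + y) = YV v k x + YV v k y"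
    and trunc: "\<And>v x. x \<in> C \<Longrightarrow> \<exists>K. \<forall>k\<ge>K. YW v k x = 0" "\<And>v x. \<exists>K. \<forall>k\<ge>K. YV v k x = 0"
    and w: "w \<in> C" and C0: "0 \<in> C"
  shows jacobi_identity_add_left: "jacobi_identity s YV YW u v w \<Longrightarrow> jacobi_identity s YV YW u' v w \<Longrightarrow>
      jacobi_identity s YV YW (u + u') v w"
    and jacobi_identity_add_right: "jacobi_identity s YV YW u v w \<Longrightarrow> jacobi_identity s YV YW u v' w \<Longrightarrow>
      jacobi_identity s YV YW u (v + v') w"
proof -
  have YW0: "YW v k 0 = 0" for v k using YW2[OF C0 C0, of v k] by simp
  have YW0': "YW 0 k x = 0" if "x \<in> C" for k x using YW1[OF that, of 0 0 k] by simp
  define A where "A p q r u v = (\<lambda>i::nat. s ((-1) ^ i * (of_int r gchoose i))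
      (YW u (p + r - int i) (YW v (q + int i) w)))" for p q r u v
  define B where "B p q r u v = (\<lambda>i::nat. s ((-1) powi r * (-1) ^ i * (of_int r gchoose i))
      (YW v (q + r - int i) (YW u (p + int i) w)))" for p q r u v
  define D where "D p q r u v = (\<lambda>i::nat. s (of_int p gchoose i)
      (YW (YV u (r + int i) v) (p + q - int i) w))" for p q r u v
  have J: "jacobi_identity s YV YW u v w \<longleftrightarrow>
      (\<forall>p q r. Sum_any (A p q r u v) - Sum_any (B p q r u v) = Sum_any (D p q r u v))" for u v
    unfolding jacobi_identity_def A_def B_def D_def ..
  have fin: "finite {i::nat. g i \<noteq> 0}" if "\<And>i. K \<le> q + int i \<Longrightarrow> g i = 0"
    for g :: "nat \<Rightarrow> 'w" and K q
  proof (rule finite_subset)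
    show "{i. g i \<noteq> 0} \<subseteq> {..<nat (K - q)}" using that by (auto intro: ccontr)
  qed simp
  have finA: "finite {i. A p q r u v i \<noteq> 0}" for p q r u v
  proof -
    obtain K where "\<forall>k\<ge>K. YW v k w = 0" using trunc(1)[OF w] by blast
    then show ?thesis by (intro fin[of K q]) (simp add: A_def YW0 s0)
  qed
  have finB: "finite {i. B p q r u v i \<noteq> 0}" for p q r u v
  proof -
    obtain K where "\<forall>k\<ge>K. YW u k w = 0" using trunc(1)[OF w] by blast
    then show ?thesis by (intro fin[of K p]) (simp add: B_def YW0 s0)
  qed
  have finD: "finite {i. D p q r u v i \<noteq> 0}" for p q r u v
  proof -
    obtain K where "\<forall>k\<ge>K. YV u k v = 0" using trunc(2) by blast
    then show ?thesis by (intro fin[of K r]) (simp add: D_def YW0'[OF w] s0)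
  qed
  have add: "A p q r (u + u') v = (\<lambda>i. A p q r u v i + A p q r u' v i)"
    "A p q r u (v + v') = (\<lambda>i. A p q r u v i + A p q r u v' i)"
    "B p q r (u + u') v = (\<lambda>i. B p q r u v i + B p q r u' v i)"
    "B p q r u (v + v') = (\<lambda>i. B p q r u v i + B p q r u v' i)"
    "D p q r (u + u') v = (\<lambda>i. D p q r u v i + D p q r u' v i)"
    "D p q r u (v + v') = (\<lambda>i. D p q r u v i + D p q r u v' i)" for p q r u u' v v'
    unfolding A_def B_def D_def by (simp_all add: YW1 YW2 YV closed w s)
  show "jacobi_identity s YV YW u v w \<Longrightarrow> jacobi_identity s YV YW u' v w \<Longrightarrow>
      jacobi_identity s YV YW (u + u') v w"
    "jacobi_identity s YV YW u v w \<Longrightarrow> jacobi_identity s YV YW u v' w \<Longrightarrow>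
      jacobi_identity s YV YW u (v + v') w"
    unfolding J add by (simp_all add: Sum_any.distrib finA finB finD add_diff_add)
qed

section \<open>Homogeneous components and smeared modes\<close>

context grading_restricted_vertex_algebra
begin

sublocale vs: vector_space "vscale V" by (rule v_vector_space)

lemma Y_add_left: "vY V (v + v') k u = vY V v k u + vY V v' k u"
  and Y_scale_left: "vY V (vscale V c v) k u = vscale V c (vY V v k u)"
  and Y_add_right: "vY V v k (u + u') = vY V v k u + vY V v k u'"
  and Y_scale_right: "vY V v k (vscale V c u) = vscale V c (vY V v k u)"
  and Lm1_add: "vLm1 V (v + v') = vLm1 V v + vLm1 V v'"
  and Lm1_scale: "vLm1 V (vscale V c v) = vscale V c (vLm1 V v)"
  and L0_add: "vL0 V (v + v') = vL0 V v + vL0 V v'"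
  using v_Y_linear1 v_Y_linear2 v_Lm1_linear v_L0_linear
  unfolding Vector_Spaces.linear_iff by blast+

lemma Y_0_left [simp]: "vY V 0 k u = 0"
  using Y_add_left[of 0 0] by simp

lemma Y_0_right [simp]: "vY V v k 0 = 0"
  using Y_add_right[of v k 0 0] by simp

lemma Lm1_0 [simp]: "vLm1 V 0 = 0"
  using Lm1_add[of 0 0] by simp

lemma component_decomposes_V: "decomposes (vgrade V) v (\<lambda>r. component (vgrade V) r v)"
proof -
  from v_direct_sum have "\<exists>!f. decomposes (vgrade V) v f"
    unfolding direct_sum_decomposition_def by blast
  from theI'[OF this] show ?thesis by (simp add: component_def)
qed

lemma component_eqI_V: "decomposes (vgrade V) v f \<Longrightarrow> component (vgrade V) r v = f r"
proof -
  assume "decomposes (vgrade V) v f"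
  then have "(\<lambda>r. component (vgrade V) r v) = f"
    using v_direct_sum component_decomposes_V[of v] unfolding direct_sum_decomposition_def by blast
  then show ?thesis by (rule fun_cong)
qed

lemma component_in_grade: "component (vgrade V) r v \<in> vgrade V r"
  and finite_components: "finite {r. component (vgrade V) r v \<noteq> 0}"
  and component_sum: "Sum_any (\<lambda>r. component (vgrade V) r v) = v"
  using component_decomposes_V[of v] by (simp_all add: decomposes_def)

lemma zero_in_grade [simp]: "0 \<in> vgrade V n"
  by (rule vs.subspace_0[OF v_grade_subspace])

lemma component_homogeneous:
  assumes "v \<in> vgrade V a"
  shows "component (vgrade V) r v = (if r = a then v else 0)"
proof (rule component_eqI_V)
  have "finite {r. (if r = a then v else 0) \<noteq> 0}"
    by (rule finite_subset[of _ "{a}"]) auto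
  moreover have "Sum_any (\<lambda>r. if r = a then v else 0) = v"
    by simp
  ultimately show "decomposes (vgrade V) v (\<lambda>r. if r = a then v else 0)"
    using assms by (simp add: decomposes_def)
qed

lemma component_add:
  "component (vgrade V) r (v + w) = component (vgrade V) r v + component (vgrade V) r w"
proof (rule component_eqI_V)
  have "finite {r. component (vgrade V) r v + component (vgrade V) r w \<noteq> 0}"
    by (rule finite_subset[OF _ finite_UnI[OF finite_components[of v] finite_components[of w]]]) auto
  then show "decomposes (vgrade V) (v + w) (\<lambda>r. component (vgrade V) r v + component (vgrade V) r w)"
    by (simp add: decomposes_def Sum_any.distrib finite_components component_sum component_in_grade
        vs.subspace_add[OF v_grade_subspace])
qed

lemma component_scale:
  "component (vgrade V) r (vscale V c v) = vscale V c (component (vgrade V) r v)"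
proof (rule component_eqI_V)
  have "finite {r. vscale V c (component (vgrade V) r v) \<noteq> 0}"
    by (rule finite_subset[OF _ finite_components[of v]]) auto
  moreover have "vscale V c v = Sum_any (\<lambda>r. vscale V c (component (vgrade V) r v))"
    using Sum_any_additive[of "vscale V c" "\<lambda>r. component (vgrade V) r v"]
    by (simp add: vs.scale_right_distrib finite_components component_sum)
  ultimately show "decomposes (vgrade V) (vscale V c v) (\<lambda>r. vscale V c (component (vgrade V) r v))"
    by (simp add: decomposes_def component_in_grade vs.subspace_scale[OF v_grade_subspace])
qed

lemma component_0 [simp]: "component (vgrade V) r 0 = 0"
  using component_add[of r 0 0] by simp

lemma homogeneous_induct [case_names homogeneous add]:
  assumes "\<And>a v. v \<in> vgrade V a \<Longrightarrow> P v" "\<And>v w. P v \<Longrightarrow> P w \<Longrightarrow> P (v + w)"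
  shows "P v"
proof -
  have "P (\<Sum>r\<in>A. component (vgrade V) r v)" for A
    by (induction A rule: infinite_finite_induct)
      (auto intro: assms(1)[of 0 0] assms component_in_grade)
  then show ?thesis
    using component_sum[of v] by (metis Sum_any.expand_set)
qed

text \<open>The axioms say that \<open>vgrade V n\<close> consists of eigenvectors; the converse
  comes from comparing homogeneous components. It turns the \<open>L(0)\<close> commutator formula
  into the degree formula \<open>Y_grade\<close>.\<close>

lemma L0_eigen_in_grade:
  assumes "vL0 V v = vscale V (of_int n) v"
  shows "v \<in> vgrade V n"
proof -
  have "component (vgrade V) r v = 0" if "r \<noteq> n" for r
  proof -
    have "vL0 V v = Sum_any (\<lambda>r. vL0 V (component (vgrade V) r v))"
      using Sum_any_additive[of "vL0 V" "\<lambda>r. component (vgrade V) r v"]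
      by (simp add: L0_add finite_components component_sum)
    also have "\<dots> = Sum_any (\<lambda>r. vscale V (of_int r) (component (vgrade V) r v))"
      by (simp add: v_L0_grade[OF component_in_grade])
    finally have "vL0 V v = Sum_any (\<lambda>r. vscale V (of_int r) (component (vgrade V) r v))" .
    moreover have "finite {r. vscale V (of_int r) (component (vgrade V) r v) \<noteq> 0}"
      by (rule finite_subset[OF _ finite_components[of v]]) auto
    ultimately have "decomposes (vgrade V) (vL0 V v) (\<lambda>r. vscale V (of_int r) (component (vgrade V) r v))"
      by (simp add: decomposes_def component_in_grade vs.subspace_scale[OF v_grade_subspace])
    then have "component (vgrade V) r (vL0 V v) = vscale V (of_int r) (component (vgrade V) r v)"
      by (rule component_eqI_V)
    then have "vscale V (of_int n - of_int r) (component (vgrade V) r v) = 0"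
      by (simp add: assms component_scale vs.scale_left_diff_distrib)
    then show ?thesis using that by simp
  qed
  then have "v = (\<Sum>r\<in>{n}. component (vgrade V) r v)"
    using Sum_any.expand_superset[of "{n}" "\<lambda>r. component (vgrade V) r v"] component_sum[of v]
    by auto
  then have "v = component (vgrade V) n v" by simp
  then show ?thesis by (metis component_in_grade)
qed

lemma Y_grade:
  assumes "u \<in> vgrade V a" "v \<in> vgrade V b"
  shows "vY V u k v \<in> vgrade V (a + b - k - 1)"
proof (rule L0_eigen_in_grade)
  have "vL0 V (vY V u k v) = vscale V (of_int b) (vY V u k v) +
      (vscale V (- of_int k - 1) (vY V u k v) + vscale V (of_int a) (vY V u k v))"
    using v_L0_commutator[of u k v] assms
    by (simp add: v_L0_grade Y_scale_left Y_scale_right algebra_simps)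
  also have "\<dots> = vscale V (of_int (a + b - k - 1)) (vY V u k v)"
    by (simp add: vs.scale_left_distrib vs.scale_left_diff_distrib)
  finally show "vL0 V (vY V u k v) = vscale V (of_int (a + b - k - 1)) (vY V u k v)" .
qed

text \<open>The creation property for \<open>vLm1 V v\<close> combined with the derivative property.
  It exhibits \<open>vLm1\<close> as a mode, from which \<open>Lm1_grade\<close> reads off its
  degree.\<close>

lemma Lm1_eq: "vLm1 V v = vY V v (- 2) (vac V)"
  using v_creation(2)[of "vLm1 V v"] v_Lm1_derivative[of v "- 1" "vac V"] by simp

lemma Lm1_grade: "v \<in> vgrade V a \<Longrightarrow> vLm1 V v \<in> vgrade V (a + 1)"
  using Y_grade[of v a "vac V" 0 "- 2"] v_vac_grade by (simp add: Lm1_eq add.commute)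

text \<open>The residue of \<open>(1 + x)\<^bsup>s\<^esup> x\<^bsup>r\<^esup> Y(v, x) u\<close>.\<close>

definition vres :: "int \<Rightarrow> int \<Rightarrow> 'v \<Rightarrow> 'v \<Rightarrow> 'v"
  where "vres s r v u = Sum_any (\<lambda>i::nat. vscale V (of_int s gchoose i) (vY V v (r + int i) u))"

lemma vres_eq_sum:
  assumes "\<And>m. M \<le> m \<Longrightarrow> vY V v m u = 0" "M \<le> r + int N"
  shows "vres s r v u = (\<Sum>i<N. vscale V (of_int s gchoose i) (vY V v (r + int i) u))"
  unfolding vres_def by (rule Sum_any_eq_lessThan) (use assms in auto)

lemma vres_vanish:
  assumes "\<And>m. M \<le> m \<Longrightarrow> vY V v m u = 0" "M \<le> r"
  shows "vres s r v u = 0"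
  using vres_eq_sum[of M v u r 0] assms by simp

lemma vres_0 [simp]: "vres 0 r v u = vY V v r u"
proof -
  have "vres 0 r v u = (\<Sum>i<1. vscale V (of_int 0 gchoose i) (vY V v (r + int i) u))"
    unfolding vres_def by (rule Sum_any_eq_lessThan) (auto simp: gbinomial_0_left)
  then show ?thesis by simp
qed

text \<open>\<open>(1 + x)^(s+1) = (1 + x)^s + x (1 + x)^s\<close> under the residue: the Pascal
  recursion on which the later extension arguments run.\<close>

lemma vres_Suc: "vres (s + 1) r v u = vres s r v u + vres s (r + 1) v u"
proof -
  obtain K where K: "\<And>m. K \<le> m \<Longrightarrow> vY V v m u = 0" using v_truncation by blast
  let ?N = "nat (K - r)"
  have "vres (s + 1) r v u =
      (\<Sum>i<Suc ?N. vscale V (of_int s + 1 gchoose i) (vY V v (r + int i) u))"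
    using vres_eq_sum[OF K, where r = r and N = "Suc ?N" and s = "s + 1"] by simp
  also have "\<dots> = vY V v r u +
      (\<Sum>i<?N. vscale V (of_int s gchoose Suc i) (vY V v (r + int (Suc i)) u)) +
      (\<Sum>i<?N. vscale V (of_int s gchoose i) (vY V v (r + 1 + int i) u))"
    unfolding sum.lessThan_Suc_shift gchoose_Suc_Suc vs.scale_left_distrib sum.distrib
    by (simp add: algebra_simps)
  also have "vY V v r u +
      (\<Sum>i<?N. vscale V (of_int s gchoose Suc i) (vY V v (r + int (Suc i)) u)) = vres s r v u"
    using vres_eq_sum[OF K, where r = r and N = "Suc ?N" and s = s] unfolding sum.lessThan_Suc_shift by simp
  also have "(\<Sum>i<?N. vscale V (of_int s gchoose i) (vY V v (r + 1 + int i) u)) = vres s (r + 1) v u"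
    using vres_eq_sum[OF K, where r = "r + 1" and N = ?N and s = s] by simp
  finally show ?thesis .
qed

lemma vres_add_left: "vres s r (v + v') u = vres s r v u + vres s r v' u"
proof -
  obtain K where K: "\<And>m. K \<le> m \<Longrightarrow> vY V v m u = 0" using v_truncation by blast
  obtain K' where K': "\<And>m. K' \<le> m \<Longrightarrow> vY V v' m u = 0" using v_truncation by blast
  obtain N where N: "max K K' \<le> r + int N" by (meson int_bound)
  show ?thesis
    using vres_eq_sum[of "max K K'" v u r N s] vres_eq_sum[of "max K K'" v' u r N s]
      vres_eq_sum[of "max K K'" "v + v'" u r N s] K K' N
    by (simp add: Y_add_left vs.scale_right_distrib sum.distrib)
qed

lemma vres_scale_left: "vres s r (vscale V c v) u = vscale V c (vres s r v u)"
proof -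
  obtain K where K: "\<And>m. K \<le> m \<Longrightarrow> vY V v m u = 0" using v_truncation by blast
  let ?N = "nat (K - r)"
  show ?thesis
    using vres_eq_sum[of K v u r ?N s] vres_eq_sum[of K "vscale V c v" u r ?N s] K
    by (simp add: Y_scale_left vs.scale_sum_right mult.commute)
qed

lemma vres_add_right: "vres s r v (u + u') = vres s r v u + vres s r v u'"
proof -
  obtain K where K: "\<And>m. K \<le> m \<Longrightarrow> vY V v m u = 0" using v_truncation by blast
  obtain K' where K': "\<And>m. K' \<le> m \<Longrightarrow> vY V v m u' = 0" using v_truncation by blast
  obtain N where N: "max K K' \<le> r + int N" by (meson int_bound)
  show ?thesis
    using vres_eq_sum[of "max K K'" v u r N s] vres_eq_sum[of "max K K'" v u' r N s]
      vres_eq_sum[of "max K K'" v "u + u'" r N s] K K' N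
    by (simp add: Y_add_right vs.scale_right_distrib sum.distrib)
qed

lemma vres_scale_right: "vres s r v (vscale V c u) = vscale V c (vres s r v u)"
proof -
  obtain K where K: "\<And>m. K \<le> m \<Longrightarrow> vY V v m u = 0" using v_truncation by blast
  let ?N = "nat (K - r)"
  show ?thesis
    using vres_eq_sum[of K v u r ?N s] vres_eq_sum[of K v "vscale V c u" r ?N s] K
    by (simp add: Y_scale_right vs.scale_sum_right mult.commute)
qed

lemma vres_0_right [simp]: "vres s r v 0 = 0"
  using vres_add_right[of s r v 0 0] by simp

lemma vres_0_left [simp]: "vres s r 0 u = 0"
  using vres_add_left[of s r 0 0 u] by simp

lemma Lm1_vres: "vLm1 V (vres s r v u) = vres s r v (vLm1 V u) + vres s r (vLm1 V v) u"
proof -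
  obtain K1 where 1: "\<And>m. K1 \<le> m \<Longrightarrow> vY V v m u = 0" using v_truncation by blast
  obtain K2 where 2: "\<And>m. K2 \<le> m \<Longrightarrow> vY V v m (vLm1 V u) = 0" using v_truncation by blast
  obtain K3 where 3: "\<And>m. K3 \<le> m \<Longrightarrow> vY V (vLm1 V v) m u = 0" using v_truncation by blast
  define K where "K = max K1 (max K2 K3)"
  obtain N where N: "K \<le> r + int N" by (meson int_bound)
  have sum: "vLm1 V (sum g A) = (\<Sum>i\<in>A. vLm1 V (g i))" for g :: "nat \<Rightarrow> 'v" and A
    by (induction A rule: infinite_finite_induct) (simp_all add: Lm1_add)
  have c: "vLm1 V (vY V v k u) = vY V v k (vLm1 V u) + vY V (vLm1 V v) k u" for k
    using v_Lm1_commutator[of v k u] by (simp add: algebra_simps)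
  show ?thesis
    using vres_eq_sum[of K v u r N s] vres_eq_sum[of K v "vLm1 V u" r N s]
      vres_eq_sum[of K "vLm1 V v" u r N s] 1 2 3 N
    by (simp add: K_def sum Lm1_scale c vs.scale_right_distrib sum.distrib)
qed

text \<open>Integration by parts: \<open>Y(L(-1) v, x)\<close> is the derivative of
  \<open>Y(v, x)\<close>, and a total derivative has no residue.\<close>

lemma vres_Lm1:
  "vres s r (vLm1 V v) u =
    - vscale V (of_int s) (vres (s - 1) r v u) - vscale V (of_int r) (vres s (r - 1) v u)"
proof -
  obtain K where K: "\<And>m. K \<le> m \<Longrightarrow> vY V v m u = 0" using v_truncation by blast
  have K': "vY V (vLm1 V v) m u = 0" if "K + 1 \<le> m" for m
    using that by (simp add: v_Lm1_derivative K)
  let ?N = "nat (K - r)"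
  have coeff: "(of_int s gchoose Suc i) * (- of_int (r + int (Suc i))) =
      - of_int s * (of_int (s - 1) gchoose i) - of_int r * (of_int s gchoose Suc i :: complex)" for i
    using gbinomial_absorption[of i "of_int s :: complex"] by (simp add: algebra_simps)
  have "vres s r (vLm1 V v) u =
      (\<Sum>i<Suc ?N. vscale V ((of_int s gchoose i) * (- of_int (r + int i))) (vY V v (r - 1 + int i) u))"
    using vres_eq_sum[OF K', where r = r and N = "Suc ?N" and s = s] by (simp add: v_Lm1_derivative algebra_simps)
  also have "\<dots> = - vscale V (of_int r) (vY V v (r - 1) u) -
      (\<Sum>i<?N. vscale V (of_int s * (of_int (s - 1) gchoose i)) (vY V v (r + int i) u)) -
      (\<Sum>i<?N. vscale V (of_int r * (of_int s gchoose Suc i)) (vY V v (r - 1 + int (Suc i)) u))"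
    unfolding sum.lessThan_Suc_shift coeff vs.scale_left_diff_distrib sum_subtractf
    by (simp add: sum_negf)
  also have "\<dots> = - vscale V (of_int s) (vres (s - 1) r v u) -
      vscale V (of_int r) (vres s (r - 1) v u)"
    using vres_eq_sum[OF K, where r = r and N = ?N and s = "s - 1"] vres_eq_sum[OF K, where r = "r - 1" and N = "Suc ?N" and s = s]
    unfolding sum.lessThan_Suc_shift by (simp add: vs.scale_sum_right vs.scale_right_distrib)
  finally show ?thesis .
qed

lemma vres_vac_right: "vres s (- 1) v (vac V) = v"
  using vres_eq_sum[of 0 v "vac V" "- 1" 1 s] v_creation by simp

section \<open>The Jacobi identity with rational test functions\<close>

definition functional :: "('v \<Rightarrow> complex) \<Rightarrow> bool"
  where "functional f \<longleftrightarrow> (\<forall>x y. f (x + y) = f x + f y) \<and> (\<forall>c x. f (vscale V c x) = c * f x)"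

lemma functional_add: "functional f \<Longrightarrow> f (x + y) = f x + f y"
  and functional_scale: "functional f \<Longrightarrow> f (vscale V c x) = c * f x"
  by (simp_all add: functional_def)

lemma functional_0: "functional f \<Longrightarrow> f 0 = 0"
  using functional_add[of f 0 0] by simp

lemma functional_minus: "functional f \<Longrightarrow> f (- x) = - f x"
  using functional_add[of f x "- x"] functional_0[of f] by (simp add: eq_neg_iff_add_eq_0 add.commute)

lemma functional_diff: "functional f \<Longrightarrow> f (x - y) = f x - f y"
  using functional_add[of f x "- y"] by (simp add: functional_minus)

lemma functional_Sum_any:
  "functional f \<Longrightarrow> finite {i. g i \<noteq> 0} \<Longrightarrow> f (Sum_any g) = Sum_any (\<lambda>i. f (g i))"
  by (rule Sum_any_additive) (simp add: functional_add)

text \<open>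
  The residues in \<open>x\<^sub>1\<close> and \<open>x\<^sub>2\<close> of
  \<open>(1 + x\<^sub>1)\<^bsup>s\<^sub>1\<^esup> x\<^sub>1\<^bsup>r\<^sub>1\<^esup> (1 + x\<^sub>2)\<^bsup>s\<^sub>2\<^esup> x\<^sub>2\<^bsup>r\<^sub>2\<^esup> (x\<^sub>2 - x\<^sub>1)\<^bsup>\<rho>\<^esup>
  f (Y(v\<^sub>2, x\<^sub>2) Y(v\<^sub>1, x\<^sub>1) u)\<close>, expanded in nonnegative powers of \<open>x\<^sub>1\<close>.
\<close>

definition mixed ::
    "('v \<Rightarrow> complex) \<Rightarrow> 'v \<Rightarrow> int \<Rightarrow> int \<Rightarrow> 'v \<Rightarrow> int \<Rightarrow> int \<Rightarrow> int \<Rightarrow> 'v \<Rightarrow> complex"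
  where "mixed f v1 s1 r1 v2 s2 r2 \<rho> u =
    cross \<rho> (\<lambda>i j. f (vres s2 i v2 (vres s1 j v1 u))) r2 r1"

text \<open>The residue of \<open>(x1 - x2)^\<rho> f(Y(Y(v1, x1 - x2) v2, x2) u)\<close> against the
  same test functions. The one in \<open>x1\<close> is Taylor expanded at \<open>x1 = x2\<close>:
  its \<open>t\<close>-th Hasse derivative is the coefficient of \<open>(x1 - x2)^t\<close> and
  picks out the mode \<open>\<rho> + t\<close> of \<open>v1\<close>.\<close>

definition iterate ::
    "('v \<Rightarrow> complex) \<Rightarrow> 'v \<Rightarrow> int \<Rightarrow> int \<Rightarrow> 'v \<Rightarrow> int \<Rightarrow> int \<Rightarrow> int \<Rightarrow> 'v \<Rightarrow> complex"
  where "iterate f v1 s1 r1 v2 s2 r2 \<rho> u =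
    Sum_any (\<lambda>t::nat. hasse t s1 r1 s2 r2 (\<lambda>s r. f (vres s r (vY V v1 (\<rho> + int t) v2) u)))"

context
  fixes f assumes f: "functional f"
begin

lemma mixed_bound: "\<exists>M. \<forall>i j. M \<le> j \<longrightarrow> f (vres s2 i v2 (vres s1 j v1 u)) = 0"
proof -
  obtain K where "\<And>m. K \<le> m \<Longrightarrow> vY V v1 m u = 0" using v_truncation by blast
  then show ?thesis by (intro exI[of _ K]) (simp add: vres_vanish[of K] functional_0[OF f])
qed

lemma mixed_Suc_rho:
  "mixed f v1 s1 r1 v2 s2 r2 (\<rho> + 1) u =
    mixed f v1 s1 r1 v2 s2 (r2 + 1) \<rho> u - mixed f v1 s1 (r1 + 1) v2 s2 r2 \<rho> u"
proof -
  obtain M where "\<And>i j. M \<le> j \<Longrightarrow> f (vres s2 i v2 (vres s1 j v1 u)) = 0"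
    using mixed_bound by blast
  then show ?thesis unfolding mixed_def by (rule cross_Suc)
qed

lemma mixed_Suc_s1:
  "mixed f v1 (s1 + 1) r1 v2 s2 r2 \<rho> u =
    mixed f v1 s1 r1 v2 s2 r2 \<rho> u + mixed f v1 s1 (r1 + 1) v2 s2 r2 \<rho> u"
proof -
  let ?G = "\<lambda>i j. f (vres s2 i v2 (vres s1 j v1 u))"
  obtain M where M: "\<And>i j. M \<le> j \<Longrightarrow> ?G i j = 0"
    using mixed_bound by blast
  have "mixed f v1 (s1 + 1) r1 v2 s2 r2 \<rho> u = cross \<rho> (\<lambda>i j. ?G i j + ?G i (j + 1)) r2 r1"
    by (simp add: mixed_def vres_Suc vres_add_right functional_add[OF f])
  also have "\<dots> = cross \<rho> ?G r2 r1 + cross \<rho> (\<lambda>i j. ?G i (j + 1)) r2 r1"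
    by (rule cross_add[of M]) (simp_all add: M)
  finally show ?thesis by (simp add: mixed_def cross_shift2[of \<rho> ?G])
qed

lemma mixed_Suc_s2:
  "mixed f v1 s1 r1 v2 (s2 + 1) r2 \<rho> u =
    mixed f v1 s1 r1 v2 s2 r2 \<rho> u + mixed f v1 s1 r1 v2 s2 (r2 + 1) \<rho> u"
proof -
  let ?G = "\<lambda>i j. f (vres s2 i v2 (vres s1 j v1 u))"
  obtain M where M: "\<And>i j. M \<le> j \<Longrightarrow> ?G i j = 0"
    using mixed_bound by blast
  have "mixed f v1 s1 r1 v2 (s2 + 1) r2 \<rho> u = cross \<rho> (\<lambda>i j. ?G i j + ?G (i + 1) j) r2 r1"
    by (simp add: mixed_def vres_Suc functional_add[OF f])
  also have "\<dots> = cross \<rho> ?G r2 r1 + cross \<rho> (\<lambda>i j. ?G (i + 1) j) r2 r1"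
    by (rule cross_add[of M]) (simp_all add: M)
  finally show ?thesis by (simp add: mixed_def cross_shift1[of \<rho> ?G])
qed

text \<open>\<open>x2 - x1 = (1 + x2) - (1 + x1)\<close>: a factor of the difference may be traded
  for factors \<open>y2\<close> and \<open>y1\<close> instead of \<open>x2\<close> and
  \<open>x1\<close>.\<close>

lemma mixed_Suc_rho':
  "mixed f v1 s1 r1 v2 s2 r2 (\<rho> + 1) u =
    mixed f v1 s1 r1 v2 (s2 + 1) r2 \<rho> u - mixed f v1 (s1 + 1) r1 v2 s2 r2 \<rho> u"
  by (simp add: mixed_Suc_rho mixed_Suc_s1 mixed_Suc_s2)

lemma mixed_vanish1: "\<exists>M. \<forall>r1\<ge>M. mixed f v1 s1 r1 v2 s2 r2 \<rho> u = 0"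
proof -
  obtain M where "\<And>i j. M \<le> j \<Longrightarrow> f (vres s2 i v2 (vres s1 j v1 u)) = 0"
    using mixed_bound by blast
  then show ?thesis unfolding mixed_def by (intro exI[of _ M] allI impI cross_vanish[of M])
qed

text \<open>Only finitely many of the vectors \<open>vres s1 (r1 + int l) v1 u\<close> are nonzero,
  so the truncation bounds of \<open>v2\<close> on them have a maximum.\<close>

lemma mixed_vanish2: "\<exists>M. \<forall>r2\<ge>M. mixed f v1 s1 r1 v2 s2 r2 \<rho> u = 0"
proof -
  obtain K where K: "\<And>m. K \<le> m \<Longrightarrow> vY V v1 m u = 0" using v_truncation by blast
  let ?z = "\<lambda>l::nat. vres s1 (r1 + int l) v1 u" and ?N = "nat (K - r1)"
  have z: "?z l = 0" if "\<not> l < ?N" for l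
    using that by (intro vres_vanish[of K] K) auto
  obtain M where M: "\<And>l m. l < ?N \<Longrightarrow> M \<le> m \<Longrightarrow> vY V v2 m (?z l) = 0"
    using uniform_bound[of ?N "\<lambda>l m. vY V v2 m (?z l) = 0"] v_truncation by blast
  have "mixed f v1 s1 r1 v2 s2 r2 \<rho> u = 0" if "M - \<rho> + int ?N \<le> r2" for r2
    unfolding mixed_def
  proof (rule cross_eq_0)
    fix l
    have "vres s2 (r2 + \<rho> - int l) v2 (?z l) = 0"
    proof (cases "l < ?N")
      case True
      then show ?thesis using that by (intro vres_vanish[of M] M) linarith+
    qed (simp add: z)
    then show "f (vres s2 (r2 + \<rho> - int l) v2 (?z l)) = 0" by (simp add: functional_0[OF f])
  qed
  then show ?thesis by blast
qed

lemma iterate_eq_sum: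
  assumes "\<And>t. N \<le> t \<Longrightarrow> vY V v1 (\<rho> + int t) v2 = 0"
  shows "iterate f v1 s1 r1 v2 s2 r2 \<rho> u =
    (\<Sum>t<N. hasse t s1 r1 s2 r2 (\<lambda>s r. f (vres s r (vY V v1 (\<rho> + int t) v2) u)))"
  unfolding iterate_def
  by (rule Sum_any_eq_lessThan) (simp add: assms hasse_def functional_0[OF f])

lemma iterate_bound: "\<exists>N. \<forall>t\<ge>N. vY V v1 (\<rho> + int t) v2 = 0"
proof -
  obtain K where "\<And>m. K \<le> m \<Longrightarrow> vY V v1 m v2 = 0" using v_truncation by blast
  then show ?thesis by (intro exI[of _ "nat (K - \<rho>)"]) auto
qed

lemma iterate_Suc:
  "iterate f v1 (s1 + 1) r1 v2 s2 r2 \<rho> u =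
    iterate f v1 s1 r1 v2 s2 r2 \<rho> u + iterate f v1 s1 (r1 + 1) v2 s2 r2 \<rho> u" (is ?A)
  "iterate f v1 s1 r1 v2 (s2 + 1) r2 \<rho> u =
    iterate f v1 s1 r1 v2 s2 r2 \<rho> u + iterate f v1 s1 r1 v2 s2 (r2 + 1) \<rho> u" (is ?B)
proof -
  obtain N where N: "\<And>t. N \<le> t \<Longrightarrow> vY V v1 (\<rho> + int t) v2 = 0" using iterate_bound by blast
  have g: "f (vres (s + 1) r w u) = f (vres s r w u) + f (vres s (r + 1) w u)" for s r w
    by (simp add: vres_Suc functional_add[OF f])
  show ?A ?B
    by (simp_all add: iterate_eq_sum[OF N] sum.distrib[symmetric]
        hasse_Suc_left[of "\<lambda>s r. f (vres s r (vY V v1 (\<rho> + int t) v2) u)" for t, OF g]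
        hasse_Suc_right[of "\<lambda>s r. f (vres s r (vY V v1 (\<rho> + int t) v2) u)" for t, OF g])
qed

lemma iterate_vanish: "\<exists>M. \<forall>r1 r2. M \<le> r1 + r2 \<longrightarrow> iterate f v1 s1 r1 v2 s2 r2 \<rho> u = 0"
proof -
  obtain N where N: "\<And>t. N \<le> t \<Longrightarrow> vY V v1 (\<rho> + int t) v2 = 0" using iterate_bound by blast
  obtain M where M: "\<And>t m. t < N \<Longrightarrow> M \<le> m \<Longrightarrow> vY V (vY V v1 (\<rho> + int t) v2) m u = 0"
    using uniform_bound[of N "\<lambda>t m. vY V (vY V v1 (\<rho> + int t) v2) m u = 0"] v_truncation by blast
  have "iterate f v1 s1 r1 v2 s2 r2 \<rho> u = 0" if "M + int N \<le> r1 + r2" for r1 r2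
  proof (subst iterate_eq_sum[OF N], assumption, intro sum.neutral ballI)
    fix t assume "t \<in> {..<N}"
    then have "vres s (r1 + r2 - int (t - i)) (vY V v1 (\<rho> + int t) v2) u = 0" for s i
      using that by (intro vres_vanish[of M] M) auto
    then show "hasse t s1 r1 s2 r2 (\<lambda>s r. f (vres s r (vY V v1 (\<rho> + int t) v2) u)) = 0"
      by (simp only: hasse_def functional_0[OF f] mult_zero_right sum.neutral_const)
  qed
  then show ?thesis by blast
qed

text \<open>For \<open>s1 = s2 = 0\<close> this is the Jacobi identity of \<open>V\<close>. The
  difference of the two sides obeys the Pascal recursion in \<open>(s1, r1)\<close> and in
  \<open>(s2, r2)\<close> and vanishes for large \<open>r1\<close> or \<open>r2\<close>, so
  \<open>pascal_unique\<close> extends it to all powers of \<open>1 + x1\<close> and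
  \<open>1 + x2\<close>, one variable at a time.\<close>

theorem smeared_jacobi:
  "mixed f v2 s2 r2 v1 s1 r1 \<rho> u - (- 1) powi \<rho> * mixed f v1 s1 r1 v2 s2 r2 \<rho> u =
    iterate f v1 s1 r1 v2 s2 r2 \<rho> u"
proof -
  define X where "X s1 r1 s2 r2 = mixed f v2 s2 r2 v1 s1 r1 \<rho> u
    - (- 1) powi \<rho> * mixed f v1 s1 r1 v2 s2 r2 \<rho> u - iterate f v1 s1 r1 v2 s2 r2 \<rho> u" for s1 r1 s2 r2
  have X1: "X (s1 + 1) r1 s2 r2 = X s1 r1 s2 r2 + X s1 (r1 + 1) s2 r2"
    and X2: "X s1 r1 (s2 + 1) r2 = X s1 r1 s2 r2 + X s1 r1 s2 (r2 + 1)" for s1 r1 s2 r2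
    unfolding X_def mixed_Suc_s1 mixed_Suc_s2 iterate_Suc by (simp_all add: algebra_simps)
  have V1: "\<exists>M. \<forall>r1\<ge>M. X s1 r1 s2 r2 = 0" for s1 s2 r2
  proof -
    obtain A B C where "\<forall>r1\<ge>A. mixed f v2 s2 r2 v1 s1 r1 \<rho> u = 0"
      "\<forall>r1\<ge>B. mixed f v1 s1 r1 v2 s2 r2 \<rho> u = 0"
      "\<forall>r1 r2. C \<le> r1 + r2 \<longrightarrow> iterate f v1 s1 r1 v2 s2 r2 \<rho> u = 0"
      using mixed_vanish1 mixed_vanish2 iterate_vanish by metis
    then show ?thesis by (intro exI[of _ "max A (max B (C - r2))"]) (auto simp: X_def)
  qed
  have V2: "\<exists>M. \<forall>r2\<ge>M. X s1 r1 s2 r2 = 0" for s1 r1 s2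
  proof -
    obtain A B C where "\<forall>r2\<ge>A. mixed f v2 s2 r2 v1 s1 r1 \<rho> u = 0"
      "\<forall>r2\<ge>B. mixed f v1 s1 r1 v2 s2 r2 \<rho> u = 0"
      "\<forall>r1 r2. C \<le> r1 + r2 \<longrightarrow> iterate f v1 s1 r1 v2 s2 r2 \<rho> u = 0"
      using mixed_vanish1 mixed_vanish2 iterate_vanish by metis
    then show ?thesis by (intro exI[of _ "max A (max B (C - r1))"]) (auto simp: X_def)
  qed
  have X0: "X 0 r1 0 r2 = 0" for r1 r2
  proof -
    obtain N where N: "\<And>t. N \<le> t \<Longrightarrow> vY V v1 (\<rho> + int t) v2 = 0" using iterate_bound by blast
    obtain K where K: "\<And>m. K \<le> m \<Longrightarrow> vY V v1 m u = 0" using v_truncation by blast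
    obtain L where L: "\<And>m. L \<le> m \<Longrightarrow> vY V v2 m u = 0" using v_truncation by blast
    let ?A = "\<lambda>i::nat. vscale V ((-1) ^ i * (of_int \<rho> gchoose i))
        (vY V v1 (r1 + \<rho> - int i) (vY V v2 (r2 + int i) u))"
    let ?B = "\<lambda>i::nat. vscale V ((-1) powi \<rho> * (-1) ^ i * (of_int \<rho> gchoose i))
        (vY V v2 (r2 + \<rho> - int i) (vY V v1 (r1 + int i) u))"
    let ?C = "\<lambda>i::nat. vscale V (of_int r1 gchoose i)
        (vY V (vY V v1 (\<rho> + int i) v2) (r1 + r2 - int i) u)"
    have fin: "finite {i. ?A i \<noteq> 0}" "finite {i. ?B i \<noteq> 0}" "finite {i. ?C i \<noteq> 0}"
    proof -
      have "{i. ?A i \<noteq> 0} \<subseteq> {..<nat (L - r2)}" "{i. ?B i \<noteq> 0} \<subseteq> {..<nat (K - r1)}"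
        "{i. ?C i \<noteq> 0} \<subseteq> {..<N}"
        using K L N by (auto intro: ccontr)
      then show "finite {i. ?A i \<noteq> 0}" "finite {i. ?B i \<noteq> 0}" "finite {i. ?C i \<noteq> 0}"
        by (auto intro: finite_subset)
    qed
    have "f (Sum_any ?A) - f (Sum_any ?B) = f (Sum_any ?C)"
      using v_jacobi[of v1 v2 u] unfolding jacobi_identity_def
      by (simp only: functional_diff[OF f, symmetric])
    moreover have "f (Sum_any ?A) = mixed f v2 0 r2 v1 0 r1 \<rho> u"
      by (simp add: functional_Sum_any[OF f fin(1)] functional_scale[OF f] mixed_def cross_def)
    moreover have "f (Sum_any ?B) = (- 1) powi \<rho> * mixed f v1 0 r1 v2 0 r2 \<rho> u"
    proof -
      have "f (Sum_any ?B) = Sum_any (\<lambda>i. (- 1) powi \<rho> * ((- 1) ^ i * (of_int \<rho> gchoose i) *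
          f (vY V v2 (r2 + \<rho> - int i) (vY V v1 (r1 + int i) u))))"
        by (simp only: functional_Sum_any[OF f fin(2)] functional_scale[OF f] mult.assoc[symmetric])
      also have "\<dots> = (- 1) powi \<rho> * Sum_any (\<lambda>i. (- 1) ^ i * (of_int \<rho> gchoose i) *
          f (vY V v2 (r2 + \<rho> - int i) (vY V v1 (r1 + int i) u)))"
      proof (rule Sum_any_right_distrib[symmetric])
        have "{i::nat. (- 1) ^ i * (of_int \<rho> gchoose i) *
          f (vY V v2 (r2 + \<rho> - int i) (vY V v1 (r1 + int i) u)) \<noteq> 0} \<subseteq> {..<nat (K - r1)}"
          using K by (auto intro: ccontr simp: functional_0[OF f])
        then show "finite {i::nat. (- 1) ^ i * (of_int \<rho> gchoose i) *
          f (vY V v2 (r2 + \<rho> - int i) (vY V v1 (r1 + int i) u)) \<noteq> 0}"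
          by (rule finite_subset) simp
      qed
      finally show ?thesis by (simp add: mixed_def cross_def)
    qed
    moreover have "f (Sum_any ?C) = iterate f v1 0 r1 v2 0 r2 \<rho> u"
      by (simp add: functional_Sum_any[OF f fin(3)] functional_scale[OF f] iterate_def hasse_0_left)
    ultimately show ?thesis by (simp add: X_def)
  qed
  have X0': "X 0 r1 s2 r2 = 0" for r1 s2 r2
    by (rule pascal_unique[of "\<lambda>s2 r2. X 0 r1 s2 r2", OF X2 X0 V2])
  have "X s1 r1 s2 r2 = 0"
    by (rule pascal_unique[of "\<lambda>s1 r1. X s1 r1 s2 r2", OF X1 X0' V1])
  then show ?thesis by (simp add: X_def)
qed

end

section \<open>Functionals of bounded pole order\<close>

text \<open>
  Let \<open>y = 1 + x\<close>. A functional \<open>f\<close> in this space behaves like \<open>u \<mapsto> \<langle>w', Y(u, 1) w\<rangle>\<close> for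
  a lowest weight vector \<open>w'\<close> and a vector \<open>w\<close> of degree \<open>n\<close>: for \<open>v\<close> of weight \<open>a\<close> the
  series \<open>f (Y(v, x) u)\<close> expands a rational function of \<open>y\<close> that has a pole of order at most
  \<open>a + n\<close> at \<open>y = 0\<close> and is \<open>O(y\<^bsup>- a\<^esup>)\<close> at infinity.
\<close>

definition dual_grade :: "int \<Rightarrow> ('v \<Rightarrow> complex) set"
  where "dual_grade n = {f. functional f \<and>
    (\<forall>a. \<forall>v\<in>vgrade V a. \<forall>u s r. a + n \<le> s \<longrightarrow> s + r \<le> a - 2 \<longrightarrow> f (vres s r v u) = 0)}"

lemma dual_grade_functional: "f \<in> dual_grade n \<Longrightarrow> functional f"
  by (simp add: dual_grade_def)

lemma dual_gradeD:
  "f \<in> dual_grade n \<Longrightarrow> v \<in> vgrade V a \<Longrightarrow> a + n \<le> s \<Longrightarrow> s + r \<le> a - 2 \<Longrightarrow> f (vres s r v u) = 0"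
  by (simp add: dual_grade_def)

text \<open>\<open>v2\<close> stands outermost, so the condition defining \<open>dual_grade\<close>
  applies to each term of the expansion of \<open>(x2 - x1)^\<rho>\<close>, in which
  \<open>x2\<close> has exponent at most \<open>r2 + \<rho>\<close>.\<close>

lemma mixed_eq_0:
  assumes f: "f \<in> dual_grade n" and v2: "v2 \<in> vgrade V a2"
    and "a2 + n \<le> s2" "s2 + r2 + \<rho> \<le> a2 - 2"
  shows "mixed f v1 s1 r1 v2 s2 r2 \<rho> u = 0"
  unfolding mixed_def by (intro cross_eq_0 dual_gradeD[OF f v2]) (use assms in auto)

text \<open>The weight \<open>a1 + a2 - \<rho> - t - 1\<close> of
  \<open>vY V v1 (\<rho> + int t) v2\<close> falls with \<open>t\<close> as fast as \<open>t\<close>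
  derivatives can lower the exponent of \<open>y\<close>, so the pole order condition holds term by
  term.\<close>

lemma iterate_eq_0:
  assumes f: "f \<in> dual_grade n" and v: "v1 \<in> vgrade V a1" "v2 \<in> vgrade V a2"
    and "a1 + a2 + n - 1 \<le> s1 + s2 + \<rho>" "s1 + r1 + s2 + r2 + \<rho> \<le> a1 + a2 - 3"
  shows "iterate f v1 s1 r1 v2 s2 r2 \<rho> u = 0"
proof -
  have "hasse t s1 r1 s2 r2 (\<lambda>s r. f (vres s r (vY V v1 (\<rho> + int t) v2) u)) = 0" for t
    unfolding hasse_def
  proof (intro sum.neutral ballI)
    fix i assume i: "i \<in> {..t}"
    have "f (vres (s1 + s2 - int i) (r1 + r2 - int (t - i)) (vY V v1 (\<rho> + int t) v2) u) = 0"
      by (rule dual_gradeD[OF f Y_grade[OF v]]) (use assms i in \<open>auto simp: of_nat_diff\<close>)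
    then show "(of_int s1 gchoose i) * (of_int r1 gchoose (t - i)) *
        f (vres (s1 + s2 - int i) (r1 + r2 - int (t - i)) (vY V v1 (\<rho> + int t) v2) u) = 0" by simp
  qed
  then show ?thesis by (simp add: iterate_def)
qed

text \<open>
  Since \<open>(x\<^sub>2 - x\<^sub>1) = (y\<^sub>2 - y\<^sub>1)\<close>, factors \<open>y\<^sub>1\<close> and \<open>y\<^sub>2\<close> can be gained at the expense of
  negative powers of \<open>x\<^sub>2 - x\<^sub>1\<close> until one of the pole order conditions on \<open>f\<close> applies.
\<close>

lemma mixed_eq_0_total:
  assumes f: "f \<in> dual_grade n" and v: "v1 \<in> vgrade V a1" "v2 \<in> vgrade V a2"
  shows "a1 + a2 + n - 1 \<le> s1 + s2 + \<rho> \<Longrightarrow> s1 + r1 + \<rho> \<le> a1 - 2 \<Longrightarrow> s2 + r2 + \<rho> \<le> a2 - 2 \<Longrightarrow>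
    s1 + r1 + s2 + r2 + \<rho> \<le> a1 + a2 - 3 \<Longrightarrow> mixed f v1 s1 r1 v2 s2 r2 \<rho> u = 0"
proof (induction "nat (a1 + n - s1) + nat (a2 + n - s2)" arbitrary: s1 s2 \<rho> rule: less_induct)
  case less
  note F = dual_grade_functional[OF f]
  consider "a1 + n \<le> s1" | "a2 + n \<le> s2" | "s1 < a1 + n" "s2 < a2 + n" by linarith
  then show ?case
  proof cases
    case 1
    \<comment> \<open>The opposite order has \<open>v1\<close> outermost and vanishes by its pole
      order; the Jacobi identity carries this over to the order at hand.\<close>
    have "mixed f v2 s2 r2 v1 s1 r1 \<rho> u = 0"
      by (rule mixed_eq_0[OF f v(1)]) (use 1 less in auto)
    moreover have "iterate f v1 s1 r1 v2 s2 r2 \<rho> u = 0"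
      by (rule iterate_eq_0[OF f v]) (use less in auto)
    ultimately show ?thesis
      using smeared_jacobi[OF F, of v2 s2 r2 v1 s1 r1 \<rho> u] by simp
  next
    case 2
    then show ?thesis using less by (intro mixed_eq_0[OF f v(2)])
  next
    case 3
    have "mixed f v1 (s1 + 1) r1 v2 s2 r2 (\<rho> - 1) u = 0"
      by (rule less.hyps) (use 3 less.prems in auto)
    moreover have "mixed f v1 s1 r1 v2 (s2 + 1) r2 (\<rho> - 1) u = 0"
      by (rule less.hyps) (use 3 less.prems in auto)
    ultimately show ?thesis
      using mixed_Suc_rho'[OF F, of v1 s1 r1 v2 s2 r2 "\<rho> - 1" u] by simp
  qed
qed

section \<open>The dual module\<close>

text \<open>
  The coefficients at \<open>y = 0\<close> of the rational function of \<^const>\<open>dual_grade\<close>. They are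
  determined by the residue theorem \<open>dual_modes_residue\<close> below, which holds for the test functions
  \<open>y\<^bsup>s\<^esup> (y - 1)\<^bsup>r\<^esup>\<close> such that there is no residue at infinity; here \<open>r = - n - 1\<close> is used.
\<close>

definition dual_modes :: "int \<Rightarrow> int \<Rightarrow> 'v \<Rightarrow> ('v \<Rightarrow> complex) \<Rightarrow> 'v \<Rightarrow> int \<Rightarrow> complex"
  where "dual_modes a n v f u =
    alt_shift (n + 1) (\<lambda>s. if s < a + n then - f (vres s (- n - 1) v u) else 0)"

lemma dual_modes_vanish: "a + n \<le> k \<Longrightarrow> dual_modes a n v f u k = 0"
  unfolding dual_modes_def by (rule alt_shift_vanish[of "a + n"]) auto

text \<open>For \<open>r = - n - 1\<close> the condition \<open>s + r \<le> a - 2\<close> is exactly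
  \<open>s < a + n\<close>, so there the identity holds by construction; for
  \<open>a + n \<le> s\<close> both sides vanish by the pole order. Descending in \<open>s\<close>,
  the recursion makes the defect \<open>X\<close> alternate in sign along each row, so its zero at
  \<open>r = - n - 1\<close> spreads in both directions.\<close>

lemma dual_modes_residue:
  assumes f: "f \<in> dual_grade n" and v: "v \<in> vgrade V a"
  shows "s + r \<le> a - 2 \<Longrightarrow> alt_shift r (dual_modes a n v f u) s = - f (vres s r v u)"
proof -
  note F = dual_grade_functional[OF f]
  define X where "X s r = alt_shift r (dual_modes a n v f u) s + f (vres s r v u)" for s r
  have step: "X s (r + 1) = X (s + 1) r - X s r" for s r
    using alt_shift_Suc[of "a + n" "dual_modes a n v f u" r s, OF dual_modes_vanish]
    by (simp add: X_def vres_Suc functional_add[OF F])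
  have high: "X s r = 0" if "a + n \<le> s" "s + r \<le> a - 2" for s r
    using that alt_shift_vanish[of "a + n" "dual_modes a n v f u", OF dual_modes_vanish]
    by (simp add: X_def dual_gradeD[OF f v])
  have base: "X s (- n - 1) = 0" if "s < a + n" for s
  proof -
    have "alt_shift (- n - 1) (dual_modes a n v f u) s = - f (vres s (- n - 1) v u)"
      unfolding dual_modes_def by (subst alt_shift_alt_shift[of "a + n"]) (use that in auto)
    then show ?thesis by (simp add: X_def)
  qed
  have "\<forall>s r. a + n - int k \<le> s \<longrightarrow> s + r \<le> a - 2 \<longrightarrow> X s r = 0" for k
  proof (induction k)
    case 0
    then show ?case using high by simp
  next
    case (Suc k)
    show ?case
    proof (intro allI impI)
      fix s r assume s: "a + n - int (Suc k) \<le> s" and sr: "s + r \<le> a - 2"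
      show "X s r = 0"
      proof (cases "a + n - int k \<le> s")
        case True
        then show ?thesis using Suc sr by blast
      next
        case False
        then have *: "X s (r + 1) = - X s r" if "s + 1 + r \<le> a - 2" for r
          using Suc s that step[of s r] by auto
        have low: "X s (- n - 1) = 0" using False by (intro base) linarith
        show ?thesis
        proof (cases "r \<le> - n - 1")
          case True
          then show ?thesis
          proof (induction r rule: int_le_induct)
            case base show ?case by (rule low)
          next
            case (step i)
            then show ?case using *[of "i - 1"] False by simp
          qed
        next
          case r: False
          then have "- n - 1 \<le> r" by simp
          then have "s + r \<le> a - 2 \<longrightarrow> X s r = 0"
          proof (induction r rule: int_ge_induct)
            case base show ?case using low by simp
          next
            case (step i)
            then show ?case using *[of i] by simp
          qed
          then show ?thesis using sr by blast
        qed
      qed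
    qed
  qed
  from this[of "nat (a + n - s)"] show "s + r \<le> a - 2 \<Longrightarrow> ?thesis"
    by (simp add: X_def eq_neg_iff_add_eq_0)
qed

text \<open>At the largest index where two candidates differ, \<open>alt_shift r\<close> changes the
  difference by a sign only, whatever \<open>r\<close> is. One admissible \<open>r\<close> for each
  \<open>s\<close> therefore determines the sequence. This is how the modes of the vacuum and those
  involving \<open>vLm1\<close> are identified.\<close>

lemma dual_modes_unique:
  assumes f: "f \<in> dual_grade n" and v: "v \<in> vgrade V a"
    and van: "\<And>k. a + n \<le> k \<Longrightarrow> \<beta> k = 0"
    and res: "\<And>s. s < a + n \<Longrightarrow> \<exists>r. s + r \<le> a - 2 \<and> alt_shift r \<beta> s = - f (vres s r v u)"
  shows "dual_modes a n v f u k = \<beta> k"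
proof -
  define X where "X k = dual_modes a n v f u k - \<beta> k" for k
  have "\<forall>s. a + n - int k \<le> s \<longrightarrow> X s = 0" for k
  proof (induction k)
    case 0
    then show ?case by (simp add: X_def van dual_modes_vanish)
  next
    case (Suc k)
    show ?case
    proof (intro allI impI)
      fix s assume s: "a + n - int (Suc k) \<le> s"
      show "X s = 0"
      proof (cases "a + n - int k \<le> s")
        case True
        then show ?thesis using Suc by blast
      next
        case False
        then obtain r where r: "s + r \<le> a - 2" "alt_shift r \<beta> s = - f (vres s r v u)"
          using res[of s] by auto
        have "alt_shift r X s = alt_shift r (dual_modes a n v f u) s - alt_shift r \<beta> s"
          unfolding X_def by (rule alt_shift_diff[of "a + n"]) (simp_all add: dual_modes_vanish van)
        also have "\<dots> = 0" by (simp add: r dual_modes_residue[OF f v])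
        finally have "(- 1) powi r * X s = 0"
          using alt_shift_top[of s X r] Suc s False by auto
        then show ?thesis by simp
      qed
    qed
  qed
  from this[of "nat (a + n - k)"] show ?thesis by (simp add: X_def)
qed

lemma dual_modes_zero_functional [simp]: "dual_modes a n v (\<lambda>_. 0) u k = 0"
  unfolding dual_modes_def using alt_shift_scale[of 0 "\<lambda>_. 0" "n + 1" 0 k] by (simp cong: if_cong)

lemma dual_modes_add_v:
  assumes F: "functional f"
  shows "dual_modes a n (v + w) f u k = dual_modes a n v f u k + dual_modes a n w f u k"
  unfolding dual_modes_def
  by (subst alt_shift_add[of "a + n", symmetric])
    (auto simp: vres_add_left functional_add[OF F] intro!: arg_cong[of _ _ "\<lambda>x. alt_shift _ x _"])

lemma dual_modes_scale_v:
  assumes F: "functional f"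
  shows "dual_modes a n (vscale V c v) f u k = c * dual_modes a n v f u k"
  unfolding dual_modes_def
  by (subst alt_shift_scale[of "a + n", symmetric])
    (auto simp: vres_scale_left functional_scale[OF F] intro!: arg_cong[of _ _ "\<lambda>x. alt_shift _ x _"])

lemma dual_modes_add_u:
  assumes F: "functional f"
  shows "dual_modes a n v f (u + u') k = dual_modes a n v f u k + dual_modes a n v f u' k"
  unfolding dual_modes_def
  by (subst alt_shift_add[of "a + n", symmetric])
    (auto simp: vres_add_right functional_add[OF F] intro!: arg_cong[of _ _ "\<lambda>x. alt_shift _ x _"])

lemma dual_modes_scale_u:
  assumes F: "functional f"
  shows "dual_modes a n v f (vscale V c u) k = c * dual_modes a n v f u k"
  unfolding dual_modes_def
  by (subst alt_shift_scale[of "a + n", symmetric])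
    (auto simp: vres_scale_right functional_scale[OF F] intro!: arg_cong[of _ _ "\<lambda>x. alt_shift _ x _"])

lemma dual_modes_add_f:
  "dual_modes a n v (\<lambda>u. f u + g u) u k = dual_modes a n v f u k + dual_modes a n v g u k"
  unfolding dual_modes_def
  by (subst alt_shift_add[of "a + n", symmetric])
    (auto intro!: arg_cong[of _ _ "\<lambda>x. alt_shift _ x _"])

lemma dual_modes_scale_f:
  "dual_modes a n v (\<lambda>u. c * f u) u k = c * dual_modes a n v f u k"
  unfolding dual_modes_def
  by (subst alt_shift_scale[of "a + n", symmetric])
    (auto intro!: arg_cong[of _ _ "\<lambda>x. alt_shift _ x _"])

lemma dual_modes_functional: "functional f \<Longrightarrow> functional (\<lambda>u. dual_modes a n v f u k)"
  by (simp add: functional_def[of "\<lambda>u. dual_modes a n v f u k"] dual_modes_add_u dual_modes_scale_u)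

text \<open>The coefficient at \<open>k\<close> is a combination of the values
  \<open>f (vres t (- n - 1) v u)\<close> with \<open>k \<le> t < a + n\<close>. On
  \<open>u = vres s r v1 u'\<close> each of these involves two vertex operators and vanishes by
  \<open>mixed_eq_0_total\<close> with \<open>\<rho> = 0\<close>; the bound \<open>k \<le> t\<close>
  supplies its condition on the total pole order.\<close>

lemma dual_modes_in_dual_grade:
  assumes f: "f \<in> dual_grade n" and v: "v \<in> vgrade V a"
  shows "(\<lambda>u. dual_modes a n v f u k) \<in> dual_grade (a + n - 1 - k)"
  unfolding dual_grade_def
proof (intro CollectI conjI allI ballI impI)
  show "functional (\<lambda>u. dual_modes a n v f u k)"
    by (rule dual_modes_functional[OF dual_grade_functional[OF f]])
  fix b v1 u s r
  assume v1: "v1 \<in> vgrade V b" and s: "b + (a + n - 1 - k) \<le> s" "s + r \<le> b - 2"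
  have "seq_act (alt_binomial (n + 1))
      (\<lambda>t. if t < a + n then - f (vres t (- n - 1) v (vres s r v1 u)) else 0) k = 0"
  proof -
    have "f (vres t (- n - 1) v (vres s r v1 u)) = 0" if "k \<le> t" "t < a + n" for t
      using mixed_eq_0_total[OF f v1 v, of s t 0 r "- n - 1" u] that s by (simp add: mixed_def)
    then show ?thesis unfolding seq_act_def by (simp add: if_distrib cong: if_cong)
  qed
  then show "dual_modes a n v f (vres s r v1 u) k = 0"
    by (simp add: dual_modes_def alt_shift_def)
qed

text \<open>For the vacuum the exponents \<open>s = r = - 1\<close> are admissible as soon as
  \<open>n \<le> - 1\<close>, and the residue returns \<open>u\<close> itself. This makes the
  grading of the module bounded below.\<close>

lemma dual_grade_neg:
  assumes f: "f \<in> dual_grade n" and "n < 0"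
  shows "f = (\<lambda>_. 0)"
proof
  fix u
  have "vres (- 1) (- 1) (vac V) u = u"
    using vres_eq_sum[of 0 "vac V" u "- 1" 1 "- 1"] by (simp add: v_vacuum)
  then show "f u = 0"
    using dual_gradeD[OF f v_vac_grade, of "- 1" "- 1" u] assms(2) by simp
qed

lemma dual_grade_0: "(\<lambda>_. 0) \<in> dual_grade n"
  by (simp add: dual_grade_def functional_def)

lemma dual_grade_add: "f \<in> dual_grade n \<Longrightarrow> g \<in> dual_grade n \<Longrightarrow> (\<lambda>u. f u + g u) \<in> dual_grade n"
  by (simp add: dual_grade_def functional_def distrib_left)

lemma dual_grade_scale: "f \<in> dual_grade n \<Longrightarrow> (\<lambda>u. c * f u) \<in> dual_grade n"
  by (simp add: dual_grade_def functional_def distrib_left)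

text \<open>The function of \<open>y\<close> attached to the vacuum is the constant
  \<open>f u\<close>, whose only mode has index \<open>- 1\<close>.\<close>

lemma dual_modes_vac:
  assumes f: "f \<in> dual_grade n"
  shows "dual_modes 0 n (vac V) f u k = (if k = - 1 then f u else 0)"
proof (rule dual_modes_unique[OF f v_vac_grade])
  fix k assume k: "0 + n \<le> k"
  \<comment> \<open>Either \<open>0 \<le> n\<close>, so that \<open>k\<close> is not
    \<open>- 1\<close>, or \<open>f\<close> is zero.\<close>
  show "(if k = - 1 then f u else 0) = 0"
    using dual_grade_neg[OF f] k by auto
next
  fix s
  let ?\<beta> = "\<lambda>k::int. if k = - 1 then f u else 0"
  show "\<exists>r. s + r \<le> 0 - 2 \<and> alt_shift r ?\<beta> s = - f (vres s r (vac V) u)"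
  proof (cases "s < 0")
    case True
    \<comment> \<open>The geometric series \<open>1 / (1 - y)\<close>: for every
      \<open>s < 0\<close> the transform meets the single nonzero coefficient with factor 1.\<close>
    have "fps_nth (alt_binomial (- 1)) i = 1" for i
      using gbinomial_minus[of "1::complex" i] gbinomial_of_nat_symmetric[of i i]
      by (simp add: alt_binomial_def)
    moreover have "s + int i = - 1 \<longleftrightarrow> i = nat (- 1 - s)" for i using True by auto
    ultimately have "seq_act (alt_binomial (- 1)) ?\<beta> s = (\<Sum>i<nat (- s). if i = nat (- 1 - s) then f u else 0)"
      using seq_act_eq_sum[of 0 ?\<beta> s "nat (- s)" "alt_binomial (- 1)"] True by simp
    also have "\<dots> = f u" using True by simp
    finally have "alt_shift (- 1) ?\<beta> s = - f u" by (simp add: alt_shift_def)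
    moreover have "vres s (- 1) (vac V) u = u"
      using vres_eq_sum[of 0 "vac V" u "- 1" 1 s] by (simp add: v_vacuum)
    ultimately show ?thesis using True by (intro exI[of _ "- 1"]) simp
  next
    case False
    let ?N = "nat (s + 2)"
    \<comment> \<open>The residue of \<open>(1 + x)^s x^(-2-s)\<close> asks for the coefficient of
      \<open>x^(s+1)\<close> in a polynomial of degree \<open>s\<close>.\<close>
    have "(of_int s gchoose nat (s + 1) :: complex) = of_nat (nat s choose nat (s + 1))"
      using False by (simp add: binomial_gbinomial)
    also have "\<dots> = 0" using False by (simp add: binomial_eq_0)
    finally have "vscale V (of_int s gchoose i) (vY V (vac V) (- 2 - s + int i) u) = 0" for i
      by (cases "i = nat (s + 1)") (use False in \<open>auto simp: v_vacuum\<close>)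
    then have "vres s (- 2 - s) (vac V) u = 0" by (simp only: vres_def Sum_any.neutral)
    moreover have "alt_shift (- 2 - s) ?\<beta> s = 0"
      by (rule alt_shift_vanish[of 0]) (use False in auto)
    ultimately show ?thesis
      using functional_0[OF dual_grade_functional[OF f]] by (intro exI[of _ "- 2 - s"]) simp
  qed
qed

text \<open>The product rule \<open>alt_shift_deriv\<close> at \<open>y = 0\<close> and integration
  by parts \<open>vres_Lm1\<close> at \<open>x = 0\<close> produce the same two terms.\<close>

lemma dual_modes_deriv:
  assumes f: "f \<in> dual_grade n" and v: "v \<in> vgrade V a"
  shows "dual_modes (a + 1) n (vLm1 V v) f u k = - of_int k * dual_modes a n v f u (k - 1)"
proof (rule dual_modes_unique[OF f Lm1_grade[OF v]])
  note F = dual_grade_functional[OF f]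
  let ?\<alpha> = "dual_modes a n v f u"
  show "- of_int k * ?\<alpha> (k - 1) = 0" if "a + 1 + n \<le> k" for k
    using that by (simp add: dual_modes_vanish)
  fix s
  obtain r where r: "s + r \<le> a - 1" by (rule that[of "a - 1 - s"]) simp
  have "alt_shift r (\<lambda>k. (- 1) * (of_int k * ?\<alpha> (k - 1))) s = (- 1) * alt_shift r (\<lambda>k. of_int k * ?\<alpha> (k - 1)) s"
    by (rule alt_shift_scale[of "a + n + 1"]) (simp add: dual_modes_vanish)
  also have "alt_shift r (\<lambda>k. of_int k * ?\<alpha> (k - 1)) s =
      of_int s * alt_shift r ?\<alpha> (s - 1) + of_int r * alt_shift (r - 1) ?\<alpha> s"
    by (rule alt_shift_deriv[of "a + n"]) (rule dual_modes_vanish)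
  finally have "alt_shift r (\<lambda>k. - of_int k * ?\<alpha> (k - 1)) s = - f (vres s r (vLm1 V v) u)"
    using r by (simp add: dual_modes_residue[OF f v] vres_Lm1 functional_diff[OF F]
        functional_minus[OF F] functional_scale[OF F])
  then show "\<exists>r. s + r \<le> a + 1 - 2 \<and> alt_shift r (\<lambda>k. - of_int k * ?\<alpha> (k - 1)) s =
      - f (vres s r (vLm1 V v) u)"
    using r by (intro exI[of _ r]) simp
qed

text \<open>In the model \<open>f u = <w', Y(u, 1) w>\<close>, replace \<open>w\<close> by
  \<open>L(-1) w\<close> and commute: the result is \<open>- f (L(-1) u)\<close>, since a lowest
  weight \<open>w'\<close> vanishes on the image of \<open>L(-1)\<close>.\<close>

lemma dual_grade_Lm1:
  assumes f: "f \<in> dual_grade n"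
  shows "(\<lambda>u. - f (vLm1 V u)) \<in> dual_grade (n + 1)"
proof -
  note F = dual_grade_functional[OF f]
  have "f (vLm1 V (vres s r v u)) = 0"
    if v: "v \<in> vgrade V a" and "a + (n + 1) \<le> s" "s + r \<le> a - 2" for a v u s r
    using that dual_gradeD[OF f v, of s r "vLm1 V u"] dual_gradeD[OF f Lm1_grade[OF v], of s r u]
    by (simp add: Lm1_vres functional_add[OF F])
  then show ?thesis
    by (simp add: dual_grade_def functional_def Lm1_add Lm1_scale functional_add[OF F]
        functional_scale[OF F])
qed

lemma dual_modes_Lm1_commutator:
  assumes f: "f \<in> dual_grade n" and v: "v \<in> vgrade V a"
  shows "- dual_modes a n v f (vLm1 V u) k - dual_modes a (n + 1) v (\<lambda>u. - f (vLm1 V u)) u k =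
    dual_modes (a + 1) n (vLm1 V v) f u k"
proof -
  note F = dual_grade_functional[OF f]
  let ?\<beta> = "\<lambda>k. - dual_modes a n v f (vLm1 V u) k - dual_modes (a + 1) n (vLm1 V v) f u k"
  have "dual_modes a (n + 1) v (\<lambda>u. - f (vLm1 V u)) u k = ?\<beta> k"
  proof (rule dual_modes_unique[OF dual_grade_Lm1[OF f] v])
    show "?\<beta> k = 0" if "a + (n + 1) \<le> k" for k
      using that by (simp add: dual_modes_vanish)
    fix s
    have "alt_shift r (\<lambda>k. (- 1) * dual_modes a n v f (vLm1 V u) k - dual_modes (a + 1) n (vLm1 V v) f u k) s =
        alt_shift r (\<lambda>k. (- 1) * dual_modes a n v f (vLm1 V u) k) s
        - alt_shift r (dual_modes (a + 1) n (vLm1 V v) f u) s" for r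
      by (rule alt_shift_diff[of "a + n + 1"]) (simp_all add: dual_modes_vanish)
    moreover have "alt_shift r (\<lambda>k. (- 1) * dual_modes a n v f (vLm1 V u) k) s =
        (- 1) * alt_shift r (dual_modes a n v f (vLm1 V u)) s" for r
      by (rule alt_shift_scale[of "a + n"]) (rule dual_modes_vanish)
    ultimately have "alt_shift (a - 2 - s) ?\<beta> s = - (- f (vLm1 V (vres s (a - 2 - s) v u)))"
      by (simp add: dual_modes_residue[OF f v] dual_modes_residue[OF f Lm1_grade[OF v]]
          Lm1_vres functional_add[OF F])
    then show "\<exists>r. s + r \<le> a - 2 \<and> alt_shift r ?\<beta> s = - (- f (vLm1 V (vres s r v u)))"
      by (intro exI[of _ "a - 2 - s"]) simp
  qed
  then show ?thesis by simp
qed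


section \<open>Two modes acting in succession\<close>

text \<open>The coefficients of \<open>(y1 - 1)^r1 (y2 - 1)^r2\<close> times
  \<open>Y(v1, y1) Y(v2, y2) f\<close>, evaluated at \<open>u\<close>. The degree
  \<open>a2 + n - 1 - k2\<close> is the one reached after the mode \<open>k2\<close> of
  \<open>v2\<close>.\<close>

definition dual_pair ::
    "int \<Rightarrow> ('v \<Rightarrow> complex) \<Rightarrow> 'v \<Rightarrow> int \<Rightarrow> 'v \<Rightarrow> int \<Rightarrow> int \<Rightarrow> 'v \<Rightarrow> int \<Rightarrow> int \<Rightarrow> int \<Rightarrow> complex"
  where "dual_pair n f u a1 v1 r1 a2 v2 r2 i j =
    alt_shift r2 (\<lambda>k2. alt_shift r1
      (dual_modes a1 (a2 + n - 1 - k2) v1 (\<lambda>u. dual_modes a2 n v2 f u k2) u) i) j"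

lemma dual_pair_0:
  "dual_pair n f u a1 v1 0 a2 v2 0 i j =
    dual_modes a1 (a2 + n - 1 - j) v1 (\<lambda>u. dual_modes a2 n v2 f u j) u i"
  by (simp add: dual_pair_def)

lemma dual_pair_inner_vanish:
  assumes "a2 + n \<le> k2"
  shows "alt_shift r1 (dual_modes a1 m v1 (\<lambda>u. dual_modes a2 n v2 f u k2) u) i = 0"
  using alt_shift_vanish[of i "dual_modes a1 m v1 (\<lambda>u. 0) u" i r1]
  by (simp add: dual_modes_vanish[OF assms])

lemma dual_pair_vanish: "a2 + n \<le> j \<Longrightarrow> dual_pair n f u a1 v1 r1 a2 v2 r2 i j = 0"
  unfolding dual_pair_def by (rule alt_shift_vanish[of "a2 + n"]) (simp_all add: dual_pair_inner_vanish)

text \<open>Beyond this bound the two modes together lead to a negative degree.\<close>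

lemma dual_pair_total:
  assumes "a1 + a2 + n - 1 \<le> i + j"
  shows "dual_pair n f u a1 v1 r1 a2 v2 r2 i j = 0"
  unfolding dual_pair_def
proof (rule alt_shift_vanish[OF _ order_refl])
  fix k assume "j \<le> k"
  then show "alt_shift r1 (dual_modes a1 (a2 + n - 1 - k) v1 (\<lambda>u. dual_modes a2 n v2 f u k) u) i = 0"
    using assms by (intro alt_shift_vanish[OF dual_modes_vanish]) auto
qed

lemma dual_pair_Suc:
  "dual_pair n f u a1 v1 (r1 + 1) a2 v2 r2 i j =
    dual_pair n f u a1 v1 r1 a2 v2 r2 (i + 1) j - dual_pair n f u a1 v1 r1 a2 v2 r2 i j" (is ?A)
  "dual_pair n f u a1 v1 r1 a2 v2 (r2 + 1) i j =
    dual_pair n f u a1 v1 r1 a2 v2 r2 i (j + 1) - dual_pair n f u a1 v1 r1 a2 v2 r2 i j" (is ?B)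
proof -
  have *: "alt_shift (r + 1) (dual_modes a m v g u) i =
      alt_shift r (dual_modes a m v g u) (i + 1) - alt_shift r (dual_modes a m v g u) i" for r a m v g i
    by (rule alt_shift_Suc[of "a + m"]) (rule dual_modes_vanish)
  show ?A
    unfolding dual_pair_def *
    by (rule alt_shift_diff[of "a2 + n"]) (simp_all add: dual_pair_inner_vanish)
  show ?B
    unfolding dual_pair_def
    by (rule alt_shift_Suc[of "a2 + n"]) (simp add: dual_pair_inner_vanish)
qed

text \<open>The residue theorem is used once for each variable and the two signs cancel. The order
  is reversed: \<open>v2\<close> acts on \<open>f\<close> before \<open>v1\<close> does, so its
  residue ends up outermost in \<open>V\<close>.\<close>

lemma dual_pair_residue:
  assumes f: "f \<in> dual_grade n" and v: "v1 \<in> vgrade V a1" "v2 \<in> vgrade V a2"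
    and le: "i + r1 \<le> a1 - 2" "j + r2 \<le> a2 - 2"
  shows "dual_pair n f u a1 v1 r1 a2 v2 r2 i j = f (vres j r2 v2 (vres i r1 v1 u))"
proof -
  have "dual_pair n f u a1 v1 r1 a2 v2 r2 i j =
      alt_shift r2 (\<lambda>k. (- 1) * dual_modes a2 n v2 f (vres i r1 v1 u) k) j"
    unfolding dual_pair_def
    by (simp add: dual_modes_residue[OF dual_modes_in_dual_grade[OF f v(2)] v(1) le(1)])
  also have "\<dots> = (- 1) * alt_shift r2 (dual_modes a2 n v2 f (vres i r1 v1 u)) j"
    by (rule alt_shift_scale[of "a2 + n"]) (rule dual_modes_vanish)
  finally show ?thesis by (simp add: dual_modes_residue[OF f v(2) le(2)])
qed

definition dual_mixed ::
    "int \<Rightarrow> ('v \<Rightarrow> complex) \<Rightarrow> 'v \<Rightarrow> int \<Rightarrow> 'v \<Rightarrow> int \<Rightarrow> int \<Rightarrow> int \<Rightarrow> 'v \<Rightarrow> int \<Rightarrow> int \<Rightarrow> int \<Rightarrow> complex"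
  where "dual_mixed n f u a1 v1 s1 r1 a2 v2 s2 r2 \<rho> =
    cross \<rho> (dual_pair n f u a1 v1 r1 a2 v2 r2) s1 s2"

lemma dual_mixed_Suc_rho:
  "dual_mixed n f u a1 v1 s1 r1 a2 v2 s2 r2 (\<rho> + 1) =
    dual_mixed n f u a1 v1 (s1 + 1) r1 a2 v2 s2 r2 \<rho> - dual_mixed n f u a1 v1 s1 r1 a2 v2 (s2 + 1) r2 \<rho>"
  unfolding dual_mixed_def by (rule cross_Suc[of "a2 + n"]) (rule dual_pair_vanish)

lemma dual_mixed_Suc_r1:
  "dual_mixed n f u a1 v1 s1 (r1 + 1) a2 v2 s2 r2 \<rho> =
    dual_mixed n f u a1 v1 (s1 + 1) r1 a2 v2 s2 r2 \<rho> - dual_mixed n f u a1 v1 s1 r1 a2 v2 s2 r2 \<rho>"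
proof -
  let ?G = "dual_pair n f u a1 v1 r1 a2 v2 r2"
  have "cross \<rho> (\<lambda>i j. ?G (i + 1) j - ?G i j) s1 s2 = cross \<rho> (\<lambda>i j. ?G (i + 1) j) s1 s2 - cross \<rho> ?G s1 s2"
    by (rule cross_diff[of "a2 + n"]) (simp_all add: dual_pair_vanish)
  then show ?thesis
    by (simp add: dual_mixed_def dual_pair_Suc(1)[abs_def] cross_shift1[of \<rho> ?G])
qed

lemma dual_mixed_Suc_r2:
  "dual_mixed n f u a1 v1 s1 r1 a2 v2 s2 (r2 + 1) \<rho> =
    dual_mixed n f u a1 v1 s1 r1 a2 v2 (s2 + 1) r2 \<rho> - dual_mixed n f u a1 v1 s1 r1 a2 v2 s2 r2 \<rho>"
proof -
  let ?G = "dual_pair n f u a1 v1 r1 a2 v2 r2"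
  have "cross \<rho> (\<lambda>i j. ?G i (j + 1) - ?G i j) s1 s2 = cross \<rho> (\<lambda>i j. ?G i (j + 1)) s1 s2 - cross \<rho> ?G s1 s2"
    by (rule cross_diff[of "a2 + n"]) (simp_all add: dual_pair_vanish)
  then show ?thesis
    by (simp add: dual_mixed_def dual_pair_Suc(2)[abs_def] cross_shift2[of \<rho> ?G])
qed

lemma dual_mixed_total:
  "a1 + a2 + n - 1 \<le> s1 + s2 + \<rho> \<Longrightarrow> dual_mixed n f u a1 v1 s1 r1 a2 v2 s2 r2 \<rho> = 0"
  unfolding dual_mixed_def by (intro cross_eq_0 dual_pair_total) auto

text \<open>
  Both sides obey the same recursion in \<open>\<rho>\<close> and vanish for large \<open>s\<^sub>2\<close>; the bound on \<open>r\<^sub>2\<close>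
  ensures that increasing \<open>s\<^sub>2\<close> creates no residue at infinity before that happens.
\<close>

lemma dual_mixed_eq_mixed:
  assumes f: "f \<in> dual_grade n" and v: "v1 \<in> vgrade V a1" "v2 \<in> vgrade V a2"
    and r2: "r2 \<le> - n - 2"
  shows "s1 + r1 + \<rho> \<le> a1 - 2 \<Longrightarrow> s2 + r2 + \<rho> \<le> a2 - 2 \<Longrightarrow>
    dual_mixed n f u a1 v1 s1 r1 a2 v2 s2 r2 \<rho> = (- 1) powi \<rho> * mixed f v1 s1 r1 v2 s2 r2 \<rho> u"
proof -
  note F = dual_grade_functional[OF f]
  let ?P = "\<lambda>\<rho>. \<forall>s1 s2. s1 + r1 + \<rho> \<le> a1 - 2 \<longrightarrow> s2 + r2 + \<rho> \<le> a2 - 2 \<longrightarrow>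
    dual_mixed n f u a1 v1 s1 r1 a2 v2 s2 r2 \<rho> = (- 1) powi \<rho> * mixed f v1 s1 r1 v2 s2 r2 \<rho> u"
  have "?P \<rho>"
  proof (induction \<rho> rule: int_induct[where k = 0])
    case base
    show ?case
      using dual_pair_residue[OF f v] by (simp add: dual_mixed_def mixed_def)
  next
    case (step1 \<rho>)
    show ?case
    proof (intro allI impI)
      fix s1 s2 assume le: "s1 + r1 + (\<rho> + 1) \<le> a1 - 2" "s2 + r2 + (\<rho> + 1) \<le> a2 - 2"
      have "dual_mixed n f u a1 v1 (s1 + 1) r1 a2 v2 s2 r2 \<rho> =
          (- 1) powi \<rho> * mixed f v1 (s1 + 1) r1 v2 s2 r2 \<rho> u"
        "dual_mixed n f u a1 v1 s1 r1 a2 v2 (s2 + 1) r2 \<rho> =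
          (- 1) powi \<rho> * mixed f v1 s1 r1 v2 (s2 + 1) r2 \<rho> u"
        using step1 le by auto
      then show "dual_mixed n f u a1 v1 s1 r1 a2 v2 s2 r2 (\<rho> + 1) =
          (- 1) powi (\<rho> + 1) * mixed f v1 s1 r1 v2 s2 r2 (\<rho> + 1) u"
        unfolding dual_mixed_Suc_rho mixed_Suc_rho'[OF F] by (simp add: power_int_add right_diff_distrib)
    qed
  next
    case (step2 \<rho>)
    have "s1 + r1 + (\<rho> - 1) \<le> a1 - 2 \<longrightarrow> s2 + r2 + (\<rho> - 1) \<le> a2 - 2 \<longrightarrow>
        dual_mixed n f u a1 v1 s1 r1 a2 v2 s2 r2 (\<rho> - 1) =
        (- 1) powi (\<rho> - 1) * mixed f v1 s1 r1 v2 s2 r2 (\<rho> - 1) u" for s1 s2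
    proof (induction "nat (a2 + n - s2)" arbitrary: s1 s2 rule: less_induct)
      case less
      show ?case
      proof (intro impI)
        assume le: "s1 + r1 + (\<rho> - 1) \<le> a1 - 2" "s2 + r2 + (\<rho> - 1) \<le> a2 - 2"
        show "dual_mixed n f u a1 v1 s1 r1 a2 v2 s2 r2 (\<rho> - 1) =
          (- 1) powi (\<rho> - 1) * mixed f v1 s1 r1 v2 s2 r2 (\<rho> - 1) u"
        proof (cases "a2 + n \<le> s2")
          case True
          have "dual_mixed n f u a1 v1 s1 r1 a2 v2 s2 r2 (\<rho> - 1) = 0"
            unfolding dual_mixed_def
            by (rule cross_vanish[of "a2 + n"]) (simp_all add: dual_pair_vanish True)
          then show ?thesis using mixed_eq_0[OF f v(2) True] le by simp
        next
          case False
          have 1: "dual_mixed n f u a1 v1 (s1 - 1) r1 a2 v2 (s2 + 1) r2 (\<rho> - 1) =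
              (- 1) powi (\<rho> - 1) * mixed f v1 (s1 - 1) r1 v2 (s2 + 1) r2 (\<rho> - 1) u"
            using less[of "s2 + 1" "s1 - 1"] False le r2 step2.hyps by auto
          have 2: "dual_mixed n f u a1 v1 (s1 - 1) r1 a2 v2 s2 r2 \<rho> =
              (- 1) powi \<rho> * mixed f v1 (s1 - 1) r1 v2 s2 r2 \<rho> u"
            using step2 False le r2 by auto
          have "dual_mixed n f u a1 v1 s1 r1 a2 v2 s2 r2 (\<rho> - 1) =
              dual_mixed n f u a1 v1 (s1 - 1) r1 a2 v2 s2 r2 \<rho> +
              dual_mixed n f u a1 v1 (s1 - 1) r1 a2 v2 (s2 + 1) r2 (\<rho> - 1)"
            using dual_mixed_Suc_rho[of n f u a1 v1 "s1 - 1" r1 a2 v2 s2 r2 "\<rho> - 1"] by simp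
          moreover have "mixed f v1 s1 r1 v2 s2 r2 (\<rho> - 1) u =
              mixed f v1 (s1 - 1) r1 v2 (s2 + 1) r2 (\<rho> - 1) u - mixed f v1 (s1 - 1) r1 v2 s2 r2 \<rho> u"
            using mixed_Suc_rho'[OF F, of v1 "s1 - 1" r1 v2 s2 r2 "\<rho> - 1" u] by simp
          ultimately show ?thesis
            by (simp only: 1 2) (simp add: power_int_diff right_diff_distrib)
        qed
      qed
    qed
    then show ?case by blast
  qed
  then show "s1 + r1 + \<rho> \<le> a1 - 2 \<Longrightarrow> s2 + r2 + \<rho> \<le> a2 - 2 \<Longrightarrow> ?thesis" by blast
qed

text \<open>As \<open>iterate\<close>, with coefficients at \<open>y = 0\<close> in place of
  residues at \<open>x = 0\<close>.\<close>

definition dual_iterate ::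
    "int \<Rightarrow> ('v \<Rightarrow> complex) \<Rightarrow> 'v \<Rightarrow> int \<Rightarrow> 'v \<Rightarrow> int \<Rightarrow> int \<Rightarrow> int \<Rightarrow> 'v \<Rightarrow> int \<Rightarrow> int \<Rightarrow> int \<Rightarrow> complex"
  where "dual_iterate n f u a1 v1 s1 r1 a2 v2 s2 r2 \<rho> =
    Sum_any (\<lambda>t::nat. hasse t s1 r1 s2 r2 (\<lambda>s r.
      alt_shift r (dual_modes (a1 + a2 - \<rho> - int t - 1) n (vY V v1 (\<rho> + int t) v2) f u) s))"

lemma dual_modes_zero_v: "functional f \<Longrightarrow> dual_modes a n 0 f u k = 0"
  using dual_modes_add_v[of f a n 0 0 u k] by simp

lemma dual_iterate_eq_sum:
  assumes F: "functional f" and N: "\<And>t. N \<le> t \<Longrightarrow> vY V v1 (\<rho> + int t) v2 = 0"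
  shows "dual_iterate n f u a1 v1 s1 r1 a2 v2 s2 r2 \<rho> =
    (\<Sum>t<N. hasse t s1 r1 s2 r2 (\<lambda>s r.
      alt_shift r (dual_modes (a1 + a2 - \<rho> - int t - 1) n (vY V v1 (\<rho> + int t) v2) f u) s))"
proof -
  have "alt_shift r (dual_modes a n 0 f u) s = 0" for r a s
    by (rule alt_shift_vanish[of s]) (simp_all add: dual_modes_zero_v[OF F])
  then show ?thesis
    unfolding dual_iterate_def
    by (intro Sum_any_eq_lessThan) (simp add: N hasse_def)
qed

lemma dual_iterate_Suc:
  assumes F: "functional f"
  shows "dual_iterate n f u a1 v1 s1 (r1 + 1) a2 v2 s2 r2 \<rho> =
      dual_iterate n f u a1 v1 (s1 + 1) r1 a2 v2 s2 r2 \<rho> - dual_iterate n f u a1 v1 s1 r1 a2 v2 s2 r2 \<rho>" (is ?A)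
    "dual_iterate n f u a1 v1 s1 r1 a2 v2 s2 (r2 + 1) \<rho> =
      dual_iterate n f u a1 v1 s1 r1 a2 v2 (s2 + 1) r2 \<rho> - dual_iterate n f u a1 v1 s1 r1 a2 v2 s2 r2 \<rho>" (is ?B)
proof -
  obtain N where N: "\<And>t. N \<le> t \<Longrightarrow> vY V v1 (\<rho> + int t) v2 = 0" using iterate_bound[OF F] by blast
  let ?g = "\<lambda>t s r. alt_shift r (dual_modes (a1 + a2 - \<rho> - int t - 1) n (vY V v1 (\<rho> + int t) v2) f u) s"
  have g: "?g t (s + 1) r = ?g t s r + ?g t s (r + 1)" for t s r
    by (simp add: alt_shift_Suc[OF dual_modes_vanish])
  show ?A ?B
    by (simp_all add: dual_iterate_eq_sum[OF F N] hasse_Suc_left[of "?g t" for t, OF g]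
        hasse_Suc_right[of "?g t" for t, OF g] sum.distrib)
qed

lemma dual_iterate_total:
  assumes "a1 + a2 + n - 1 \<le> s1 + s2 + \<rho>"
  shows "dual_iterate n f u a1 v1 s1 r1 a2 v2 s2 r2 \<rho> = 0"
proof -
  have "alt_shift r (dual_modes (a1 + a2 - \<rho> - int t - 1) n v f u) (s1 + s2 - int i) = 0"
    if "i \<le> t" for i t r v
    using assms that by (intro alt_shift_vanish[OF dual_modes_vanish]) auto
  then show ?thesis by (simp add: dual_iterate_def hasse_def)
qed

lemma dual_iterate_eq_iterate:
  assumes f: "f \<in> dual_grade n" and v: "v1 \<in> vgrade V a1" "v2 \<in> vgrade V a2"
    and le: "s1 + r1 + s2 + r2 + \<rho> \<le> a1 + a2 - 3"
  shows "dual_iterate n f u a1 v1 s1 r1 a2 v2 s2 r2 \<rho> = - iterate f v1 s1 r1 v2 s2 r2 \<rho> u"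
proof -
  note F = dual_grade_functional[OF f]
  obtain N where N: "\<And>t. N \<le> t \<Longrightarrow> vY V v1 (\<rho> + int t) v2 = 0" using iterate_bound[OF F] by blast
  have "vY V v1 (\<rho> + int t) v2 \<in> vgrade V (a1 + a2 - \<rho> - int t - 1)" for t
    using Y_grade[OF v, of "\<rho> + int t"] by (simp add: algebra_simps)
  then have "hasse t s1 r1 s2 r2 (\<lambda>s r. alt_shift r
      (dual_modes (a1 + a2 - \<rho> - int t - 1) n (vY V v1 (\<rho> + int t) v2) f u) s) =
    - hasse t s1 r1 s2 r2 (\<lambda>s r. f (vres s r (vY V v1 (\<rho> + int t) v2) u))" for t
    unfolding hasse_def sum_negf[symmetric]
    by (intro sum.cong refl, subst dual_modes_residue[OF f]) (use le in \<open>auto simp: of_nat_diff\<close>)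
  then show ?thesis by (simp add: dual_iterate_eq_sum[OF F N] iterate_eq_sum[OF F N] sum_negf)
qed

text \<open>
  By decreasing induction on the total order \<open>s\<^sub>1 + s\<^sub>2 + \<rho>\<close> the identity for given \<open>s\<^sub>1, s\<^sub>2\<close>
  holds for all \<open>r\<^sub>1, r\<^sub>2\<close> as soon as it holds for sufficiently small ones, where it is the
  Jacobi identity of \<open>V\<close>.
\<close>

theorem dual_jacobi_smeared:
  assumes f: "f \<in> dual_grade n" and v: "v1 \<in> vgrade V a1" "v2 \<in> vgrade V a2"
  shows "dual_mixed n f u a1 v1 s1 r1 a2 v2 s2 r2 \<rho>
      - (- 1) powi \<rho> * dual_mixed n f u a2 v2 s2 r2 a1 v1 s1 r1 \<rho> =
    dual_iterate n f u a1 v1 s1 r1 a2 v2 s2 r2 \<rho>"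
proof -
  note F = dual_grade_functional[OF f]
  define X where "X s1 r1 s2 r2 = dual_mixed n f u a1 v1 s1 r1 a2 v2 s2 r2 \<rho>
      - (- 1) powi \<rho> * dual_mixed n f u a2 v2 s2 r2 a1 v1 s1 r1 \<rho>
      - dual_iterate n f u a1 v1 s1 r1 a2 v2 s2 r2 \<rho>" for s1 r1 s2 r2
  have X1: "X s1 (r1 + 1) s2 r2 = X (s1 + 1) r1 s2 r2 - X s1 r1 s2 r2"
    and X2: "X s1 r1 s2 (r2 + 1) = X s1 r1 (s2 + 1) r2 - X s1 r1 s2 r2" for s1 r1 s2 r2
    unfolding X_def dual_mixed_Suc_r1 dual_mixed_Suc_r2 dual_iterate_Suc[OF F]
    by (simp_all add: algebra_simps)
  have low: "X s1 r1 s2 r2 = 0"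
    if "r1 \<le> - n - 2" "r2 \<le> - n - 2" "s1 + r1 + \<rho> \<le> a1 - 2" "s2 + r2 + \<rho> \<le> a2 - 2"
      "s1 + r1 + s2 + r2 + \<rho> \<le> a1 + a2 - 3" for s1 r1 s2 r2
  proof -
    have "(- 1 :: complex) powi \<rho> * (- 1) powi \<rho> = 1"
      by (simp flip: power_int_mult_distrib)
    then have "X s1 r1 s2 r2 = (- 1) powi \<rho> * mixed f v1 s1 r1 v2 s2 r2 \<rho> u
        - mixed f v2 s2 r2 v1 s1 r1 \<rho> u + iterate f v1 s1 r1 v2 s2 r2 \<rho> u"
      unfolding X_def using that
      by (simp add: dual_mixed_eq_mixed[OF f v] dual_mixed_eq_mixed[OF f v(2,1)]
          dual_iterate_eq_iterate[OF f v] flip: mult.assoc)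
    also have "\<dots> = 0"
      using smeared_jacobi[OF F, of v2 s2 r2 v1 s1 r1 \<rho> u] by (simp add: algebra_simps)
    finally show ?thesis .
  qed
  have "\<forall>s1 r1 s2 r2. a1 + a2 + n - 1 - int m \<le> s1 + s2 + \<rho> \<longrightarrow> X s1 r1 s2 r2 = 0" for m
  proof (induction m)
    case 0
    then show ?case by (simp add: X_def dual_mixed_total dual_iterate_total)
  next
    case (Suc m)
    show ?case
    proof (intro allI impI)
      fix s1 r1 s2 r2 assume s: "a1 + a2 + n - 1 - int (Suc m) \<le> s1 + s2 + \<rho>"
      have 1: "X s1 (r1 + 1) s2 r2 = - X s1 r1 s2 r2" and 2: "X s1 r1 s2 (r2 + 1) = - X s1 r1 s2 r2"
        for r1 r2
        using Suc s unfolding X1 X2 by auto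
      \<comment> \<open>The bound by 0 serves the condition in which both exponents enter: it gives
        \<open>R + R \<le> R\<close>.\<close>
      define R where "R = min (- n - 2) (min (min (a1 - 2 - s1 - \<rho>) (a2 - 2 - s2 - \<rho>))
        (min 0 (a1 + a2 - 3 - s1 - s2 - \<rho>)))"
      have "R \<le> - n - 2" "R \<le> a1 - 2 - s1 - \<rho>" "R \<le> a2 - 2 - s2 - \<rho>" "R \<le> 0"
        "R \<le> a1 + a2 - 3 - s1 - s2 - \<rho>"
        by (simp_all add: R_def)
      then have "X s1 R s2 R = 0" by (intro low) linarith+
      then have "X s1 r1 s2 R = 0" using int_alternating[of "\<lambda>r. X s1 r s2 R", OF 1] by blast
      then show "X s1 r1 s2 r2 = 0" using int_alternating[of "\<lambda>r. X s1 r1 s2 r", OF 2] by blast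
    qed
  qed
  from this[of "nat (a1 + a2 + n - 1 - (s1 + s2 + \<rho>))"] have "X s1 r1 s2 r2 = 0"
    by simp
  then show ?thesis by (simp add: X_def)
qed

text \<open>The case \<open>r1 = r2 = 0\<close>: the powers of \<open>y - 1\<close>, which served to
  suppress residues at infinity, are gone, and the coefficients of the Jacobi identity of the module
  remain.\<close>

corollary dual_jacobi:
  assumes f: "f \<in> dual_grade n" and v: "v1 \<in> vgrade V a1" "v2 \<in> vgrade V a2"
  shows "cross \<rho> (\<lambda>i j. dual_modes a1 (a2 + n - 1 - j) v1 (\<lambda>u. dual_modes a2 n v2 f u j) u i) p q
      - (- 1) powi \<rho> *
        cross \<rho> (\<lambda>i j. dual_modes a2 (a1 + n - 1 - j) v2 (\<lambda>u. dual_modes a1 n v1 f u j) u i) q p =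
    Sum_any (\<lambda>t::nat. (of_int p gchoose t) *
      dual_modes (a1 + a2 - \<rho> - int t - 1) n (vY V v1 (\<rho> + int t) v2) f u (p + q - int t))"
  using dual_jacobi_smeared[OF assms, of u p 0 q 0 \<rho>]
  by (simp add: dual_mixed_def dual_pair_0[abs_def] dual_iterate_def hasse_0_right)


section \<open>The module as a direct sum over degrees\<close>

text \<open>A vector is a finite family and not a sum inside the dual of \<open>V\<close>:
  \<open>dual_grade n\<close> increases with \<open>n\<close>, so the degree of a functional is
  extra data. In \<open>mY\<close> the component of degree \<open>m\<close> comes from degree
  \<open>m - a + k + 1\<close>, because the mode \<open>k\<close> of a vector of weight
  \<open>a\<close> shifts degrees by \<open>a - k - 1\<close>.\<close>

definition dual_module :: "('v, int \<Rightarrow> 'v \<Rightarrow> complex) vmodule"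
  where "dual_module =
    \<lparr>mcarrier = {w. (\<forall>n. w n \<in> dual_grade n) \<and> finite {n. w n \<noteq> 0}},
     mscale = (\<lambda>c w n u. c * w n u),
     mY = (\<lambda>v k w m u. \<Sum>a | component (vgrade V) a v \<noteq> 0.
       dual_modes a (m - a + k + 1) (component (vgrade V) a v) (w (m - a + k + 1)) u k),
     mL0 = (\<lambda>w n u. of_int n * w n u),
     mLm1 = (\<lambda>w n u. - w (n - 1) (vLm1 V u))\<rparr>"

abbreviation "dC \<equiv> mcarrier dual_module"
abbreviation "dY \<equiv> mY dual_module"

lemma dual_module_simps:
  "mscale dual_module c w n u = c * w n u"
  "mL0 dual_module w n u = of_int n * w n u"
  "mLm1 dual_module w n u = - w (n - 1) (vLm1 V u)"
  by (simp_all add: dual_module_def)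

lemma mscale_dual: "mscale dual_module c w n = (\<lambda>u. c * w n u)"
  and mL0_dual: "mL0 dual_module w n = (\<lambda>u. of_int n * w n u)"
  and mLm1_dual: "mLm1 dual_module w n = (\<lambda>u. - w (n - 1) (vLm1 V u))"
  by (simp_all add: dual_module_def)

lemma dual_modes_plus:
  "dual_modes a n v (f + g) u k = dual_modes a n v f u k + dual_modes a n v g u k"
  by (simp add: plus_fun_def dual_modes_add_f)

lemma dC_iff: "w \<in> dC \<longleftrightarrow> (\<forall>n. w n \<in> dual_grade n) \<and> finite {n. w n \<noteq> 0}"
  by (simp add: dual_module_def)

lemma dC_grade: "w \<in> dC \<Longrightarrow> w n \<in> dual_grade n"
  and dC_functional: "w \<in> dC \<Longrightarrow> functional (w n)"
  by (auto simp: dC_iff dest: dual_grade_functional)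

lemma dC_add: "w \<in> dC \<Longrightarrow> w' \<in> dC \<Longrightarrow> w + w' \<in> dC"
proof -
  assume w: "w \<in> dC" "w' \<in> dC"
  have "{n. (w + w') n \<noteq> 0} \<subseteq> {n. w n \<noteq> 0} \<union> {n. w' n \<noteq> 0}" by auto
  then show ?thesis
    using w by (auto simp: dC_iff plus_fun_def intro: dual_grade_add finite_subset)
qed

lemma dC_scale: "w \<in> dC \<Longrightarrow> mscale dual_module c w \<in> dC"
proof -
  assume w: "w \<in> dC"
  have "{n. mscale dual_module c w n \<noteq> 0} \<subseteq> {n. w n \<noteq> 0}"
    by (auto simp: dual_module_simps fun_eq_iff)
  then show ?thesis
    using w by (auto simp: dC_iff mscale_dual mL0_dual mLm1_dual intro: dual_grade_scale finite_subset)
qed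

lemma dC_0: "0 \<in> dC"
  by (simp add: dC_iff zero_fun_def dual_grade_0)

lemma dY_homogeneous:
  assumes w: "w \<in> dC" and v: "v \<in> vgrade V a"
  shows "dY v k w m u = dual_modes a (m - a + k + 1) v (w (m - a + k + 1)) u k"
proof (cases "v = 0")
  case True
  then show ?thesis
    by (simp add: dual_module_def dual_modes_zero_v[OF dC_functional[OF w]])
next
  case False
  then have "{b. component (vgrade V) b v \<noteq> 0} = {a}"
    by (auto simp: component_homogeneous[OF v])
  then show ?thesis by (simp add: dual_module_def component_homogeneous[OF v])
qed

lemma dY_superset:
  assumes w: "w \<in> dC" and "finite A" "{a. component (vgrade V) a v \<noteq> 0} \<subseteq> A"
  shows "dY v k w m u =
    (\<Sum>a\<in>A. dual_modes a (m - a + k + 1) (component (vgrade V) a v) (w (m - a + k + 1)) u k)"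
  unfolding dual_module_def vmodule.simps
  by (rule sum.mono_neutral_left[OF assms(2,3)]) (auto simp: dual_modes_zero_v[OF dC_functional[OF w]])

lemma dY_add_left:
  assumes w: "w \<in> dC"
  shows "dY (v + v') k w = dY v k w + dY v' k w"
proof (intro ext)
  fix m u
  obtain A where A: "finite A" "{a. component (vgrade V) a v \<noteq> 0} \<subseteq> A"
    "{a. component (vgrade V) a v' \<noteq> 0} \<subseteq> A" "{a. component (vgrade V) a (v + v') \<noteq> 0} \<subseteq> A"
    using finite_UnI[OF finite_UnI[OF finite_components finite_components] finite_components] by blast
  show "dY (v + v') k w m u = (dY v k w + dY v' k w) m u"
    by (simp add: dY_superset[OF w A(1,2)] dY_superset[OF w A(1,3)] dY_superset[OF w A(1,4)]
        component_add dual_modes_add_v[OF dC_functional[OF w]] sum.distrib)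
qed

lemma dY_scale_left:
  assumes w: "w \<in> dC"
  shows "dY (vscale V c v) k w = mscale dual_module c (dY v k w)"
proof (intro ext)
  fix m u
  let ?A = "{a. component (vgrade V) a v \<noteq> 0}"
  have "finite ?A" by (simp add: finite_components)
  then show "dY (vscale V c v) k w m u = mscale dual_module c (dY v k w) m u"
    by (simp add: dY_superset[OF w, of ?A] component_scale subset_iff dual_module_simps
        dual_modes_scale_v[OF dC_functional[OF w]] sum_distrib_left)
qed

lemma dY_add_right:
  assumes "w \<in> dC" "w' \<in> dC"
  shows "dY v k (w + w') = dY v k w + dY v k w'" (is "?P v")
proof (rule homogeneous_induct[of ?P v])
  fix a v assume homogeneous: "v \<in> vgrade V a"
  have *: "dY v k (w + w') m u = (dY v k w + dY v k w') m u" for m u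
    using assms by (simp add: dY_homogeneous[OF _ homogeneous] dC_add dual_modes_plus)
  show "?P v" by (intro ext) (rule *)
next
  fix v v' assume add: "?P v" "?P v'"
  have "dY (v + v') k (w + w') = dY (v + v') k w + dY (v + v') k w'"
    unfolding dY_add_left[OF dC_add[OF assms]] dY_add_left[OF assms(1)] dY_add_left[OF assms(2)] add
    by (simp only: add_ac)
  then show "?P (v + v')" .
qed

lemma mscale_dual_add: "mscale dual_module c (w + w') = mscale dual_module c w + mscale dual_module c w'"
  by (simp add: fun_eq_iff dual_module_simps distrib_left)

lemma dY_scale_right:
  assumes "w \<in> dC"
  shows "dY v k (mscale dual_module c w) = mscale dual_module c (dY v k w)" (is "?P v")
proof (rule homogeneous_induct[of ?P v])
  fix a v assume homogeneous: "v \<in> vgrade V a"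
  have *: "dY v k (mscale dual_module c w) m u = mscale dual_module c (dY v k w) m u" for m u
    using assms
    by (simp add: dY_homogeneous[OF _ homogeneous] dC_scale mscale_dual dual_modes_scale_f)
  show "?P v" by (intro ext) (rule *)
next
  fix v v' assume add: "?P v" "?P v'"
  have "dY (v + v') k (mscale dual_module c w) = mscale dual_module c (dY (v + v') k w)"
    unfolding dY_add_left[OF dC_scale[OF assms]] dY_add_left[OF assms] mscale_dual_add add ..
  then show "?P (v + v')" .
qed

lemma dY_closed:
  assumes w: "w \<in> dC"
  shows "dY v k w \<in> dC" (is "?P v")
proof (rule homogeneous_induct[of ?P v])
  fix a v assume homogeneous: "v \<in> vgrade V a"
  have eq: "dY v k w m = (\<lambda>u. dual_modes a (m - a + k + 1) v (w (m - a + k + 1)) u k)" for m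
    by (rule ext) (rule dY_homogeneous[OF w homogeneous])
  have "dY v k w m \<in> dual_grade m" for m
    unfolding eq
    using dual_modes_in_dual_grade[OF dC_grade[OF w] homogeneous, of "m - a + k + 1" k] by simp
  moreover have "finite {m. dY v k w m \<noteq> 0}"
  proof (rule finite_subset)
    have "w (m - a + k + 1) \<noteq> 0" if "dY v k w m \<noteq> 0" for m
      using that unfolding eq by (auto simp: zero_fun_def)
    then show "{m. dY v k w m \<noteq> 0} \<subseteq> (\<lambda>n. n + a - k - 1) ` {n. w n \<noteq> 0}"
      by (force intro: image_eqI[of _ _ "m - a + k + 1" for m])
    show "finite ((\<lambda>n. n + a - k - 1) ` {n. w n \<noteq> 0})" using w by (simp add: dC_iff)
  qed
  ultimately show "?P v" by (simp add: dC_iff)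
next
  fix v v' assume add: "?P v" "?P v'"
  have "dY (v + v') k w \<in> dC"
    unfolding dY_add_left[OF w] by (rule dC_add[OF add])
  then show "?P (v + v')" .
qed

text \<open>\<open>dual_modes_vanish\<close> bounds \<open>k\<close> in terms of the degree, and a
  finite family has a largest degree.\<close>

lemma dY_truncation:
  assumes w: "w \<in> dC"
  shows "\<exists>K. \<forall>k\<ge>K. dY v k w = 0" (is "?P v")
proof (rule homogeneous_induct[of ?P v])
  fix a v assume homogeneous: "v \<in> vgrade V a"
  have "finite {n. w n \<noteq> 0}" using w by (simp add: dC_iff)
  then obtain B where B: "\<And>n. w n \<noteq> 0 \<Longrightarrow> n \<le> B"
    using bdd_above_finite[of "{n. w n \<noteq> 0}"] unfolding bdd_above_def by blast
  have "dY v k w = 0" if "a + B \<le> k" for k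
  proof (intro ext)
    fix m u
    show "dY v k w m u = 0 m u"
    proof (cases "w (m - a + k + 1) = 0")
      case True
      then show ?thesis by (simp add: dY_homogeneous[OF w homogeneous] zero_fun_def)
    next
      case False
      then have "a + (m - a + k + 1) \<le> k" using B[OF False] that by linarith
      then show ?thesis by (simp add: dY_homogeneous[OF w homogeneous] dual_modes_vanish)
    qed
  qed
  then show "?P v" by blast
next
  fix v v' assume add: "?P v" "?P v'"
  then obtain K K' where "\<forall>k\<ge>K. dY v k w = 0" "\<forall>k\<ge>K'. dY v' k w = 0" by blast
  then show "?P (v + v')" by (intro exI[of _ "max K K'"]) (simp add: dY_add_left[OF w])
qed

lemma dY_jacobi_homogeneous:
  assumes w: "w \<in> dC" and v1: "v1 \<in> vgrade V a1" and v2: "v2 \<in> vgrade V a2"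
  shows "jacobi_identity (mscale dual_module) (vY V) dY v1 v2 w"
  unfolding jacobi_identity_def
proof (intro allI ext)
  fix p q r m u
  let ?A = "\<lambda>i::nat. mscale dual_module ((-1) ^ i * (of_int r gchoose i))
      (dY v1 (p + r - int i) (dY v2 (q + int i) w))"
  let ?B = "\<lambda>i::nat. mscale dual_module ((-1) powi r * (-1) ^ i * (of_int r gchoose i))
      (dY v2 (q + r - int i) (dY v1 (p + int i) w))"
  let ?C = "\<lambda>i::nat. mscale dual_module (of_int p gchoose i)
      (dY (vY V v1 (r + int i) v2) (p + q - int i) w)"
  \<comment> \<open>The degree of the component of \<open>w\<close> that all three terms send to
    degree \<open>m\<close>.\<close>
  define n where "n = m - a1 - a2 + p + q + r + 2"
  have s0: "mscale dual_module c 0 = 0" for c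
    by (simp add: fun_eq_iff dual_module_simps)
  have Y0: "dY v k 0 = 0" for v k
    using dY_add_right[OF dC_0 dC_0, of v k] by simp
  have Y0': "dY 0 k w = 0" for k
    using dY_add_left[OF w, of 0 0 k] by simp
  obtain K1 where K1: "\<And>k. K1 \<le> k \<Longrightarrow> dY v1 k w = 0" using dY_truncation[OF w] by blast
  obtain K2 where K2: "\<And>k. K2 \<le> k \<Longrightarrow> dY v2 k w = 0" using dY_truncation[OF w] by blast
  obtain N where N: "\<And>t. N \<le> t \<Longrightarrow> vY V v1 (r + int t) v2 = 0"
    using iterate_bound[OF dC_functional[OF w]] by blast
  have fin: "finite {i. ?A i \<noteq> 0}" "finite {i. ?B i \<noteq> 0}" "finite {i. ?C i \<noteq> 0}"
  proof -
    have "?A i = 0" if "nat (K2 - q) \<le> i" for i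
      unfolding K2[of "q + int i", OF that[THEN nat_le_add]] Y0 s0 ..
    then show "finite {i. ?A i \<noteq> 0}" by (rule finite_nat_support)
    have "?B i = 0" if "nat (K1 - p) \<le> i" for i
      unfolding K1[of "p + int i", OF that[THEN nat_le_add]] Y0 s0 ..
    then show "finite {i. ?B i \<noteq> 0}" by (rule finite_nat_support)
    have "?C i = 0" if "N \<le> i" for i
      unfolding N[OF that] Y0' s0 ..
    then show "finite {i. ?C i \<noteq> 0}" by (rule finite_nat_support)
  qed
  have eval: "(Sum_any F) m u = Sum_any (\<lambda>i. F i m u)" if "finite {i. F i \<noteq> 0}"
    for F :: "nat \<Rightarrow> int \<Rightarrow> 'v \<Rightarrow> complex"
    using that by (rule Sum_any_additive[of "\<lambda>w. w m u", rotated]) simp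
  let ?G1 = "\<lambda>i j. dual_modes a1 (a2 + n - 1 - j) v1 (\<lambda>u. dual_modes a2 n v2 (w n) u j) u i"
  let ?G2 = "\<lambda>i j. dual_modes a2 (a1 + n - 1 - j) v2 (\<lambda>u. dual_modes a1 n v1 (w n) u j) u i"
  have "(Sum_any ?A) m u = cross r ?G1 p q"
  proof -
    have "?A i m u = (-1) ^ i * (of_int r gchoose i) * ?G1 (p + r - int i) (q + int i)" for i
    proof -
      have deg: "m - a1 + (p + r - int i) + 1 = a2 + n - 1 - (q + int i)" by (simp add: n_def)
      have inner: "dY v2 (q + int i) w (a2 + n - 1 - (q + int i)) =
          (\<lambda>u. dual_modes a2 n v2 (w n) u (q + int i))"
        by (rule ext) (simp add: dY_homogeneous[OF w v2])
      show ?thesis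
        unfolding dual_module_simps dY_homogeneous[OF dY_closed[OF w] v1] deg inner ..
    qed
    then show ?thesis by (simp add: eval[OF fin(1)] cross_def)
  qed
  moreover have "(Sum_any ?B) m u = (-1) powi r * cross r ?G2 q p"
  proof -
    have *: "?B i m u = (-1) powi r * ((-1) ^ i * (of_int r gchoose i) * ?G2 (q + r - int i) (p + int i))" for i
    proof -
      have deg: "m - a2 + (q + r - int i) + 1 = a1 + n - 1 - (p + int i)" by (simp add: n_def)
      have inner: "dY v1 (p + int i) w (a1 + n - 1 - (p + int i)) =
          (\<lambda>u. dual_modes a1 n v1 (w n) u (p + int i))"
        by (rule ext) (simp add: dY_homogeneous[OF w v1])
      show ?thesis
        unfolding dual_module_simps dY_homogeneous[OF dY_closed[OF w] v2] deg inner
        by (simp only: mult.assoc)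
    qed
    have "?G2 (q + r - int i) (p + int i) = 0" if "nat (a1 + n - p) \<le> i" for i
      unfolding dual_modes_vanish[of a1 n "p + int i", OF that[THEN nat_le_add]] dual_modes_zero_functional ..
    then have "finite {i::nat. ?G2 (q + r - int i) (p + int i) \<noteq> 0}"
      by (rule finite_nat_support)
    then have "finite {i::nat. (-1) ^ i * (of_int r gchoose i) * ?G2 (q + r - int i) (p + int i) \<noteq> 0}"
      by (rule rev_finite_subset) auto
    then show ?thesis
      unfolding eval[OF fin(2)] * cross_def by (rule Sum_any_right_distrib[symmetric])
  qed
  moreover have "(Sum_any ?C) m u = Sum_any (\<lambda>t::nat. (of_int p gchoose t) *
      dual_modes (a1 + a2 - r - int t - 1) n (vY V v1 (r + int t) v2) (w n) u (p + q - int t))"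
  proof -
    have "?C t m u = (of_int p gchoose t) *
      dual_modes (a1 + a2 - r - int t - 1) n (vY V v1 (r + int t) v2) (w n) u (p + q - int t)" for t
    proof -
      have gr: "vY V v1 (r + int t) v2 \<in> vgrade V (a1 + a2 - r - int t - 1)"
        using Y_grade[OF v1 v2, of "r + int t"] by (simp add: algebra_simps)
      have deg: "m - (a1 + a2 - r - int t - 1) + (p + q - int t) + 1 = n" by (simp add: n_def)
      show ?thesis unfolding dual_module_simps dY_homogeneous[OF w gr] deg ..
    qed
    then show ?thesis by (simp add: eval[OF fin(3)])
  qed
  ultimately show "(Sum_any ?A - Sum_any ?B) m u = (Sum_any ?C) m u"
    using dual_jacobi[OF dC_grade[OF w] v1 v2, of r n u p q] by (simp add: fun_diff_def)
qed

lemma dY_jacobi: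
  assumes w: "w \<in> dC"
  shows "jacobi_identity (mscale dual_module) (vY V) dY u v w"
proof -
  have s0: "mscale dual_module c 0 = 0" for c
    by (simp add: fun_eq_iff dual_module_simps)
  note jacobi_add = jacobi_identity_add[of "mscale dual_module" dC dY "vY V", OF mscale_dual_add s0 dY_closed
      dY_add_left dY_add_right Y_add_left Y_add_right dY_truncation v_truncation w dC_0]
  have hom: "jacobi_identity (mscale dual_module) (vY V) dY u v w" (is "?P v") if u: "u \<in> vgrade V a" for a u
  proof (rule homogeneous_induct[of ?P v])
    show "?P v" if "v \<in> vgrade V b" for b v
      using that by (rule dY_jacobi_homogeneous[OF w u])
    show "?P (v + v')" if "?P v" "?P v'" for v v'
      using that by - (rule jacobi_add(2), assumption+)
  qed
  show ?thesis (is "?Q u")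
  proof (rule homogeneous_induct[of ?Q u])
    show "?Q u" if "u \<in> vgrade V a" for a u using that by (rule hom)
    show "?Q (u + u')" if "?Q u" "?Q u'" for u u'
      using that by - (rule jacobi_add(1), assumption+)
  qed
qed

text \<open>\<open>mL0\<close> multiplies by the integer degree. It is diagonalizable, so a
  generalized eigenvector is a family concentrated in one degree.\<close>

lemma mgrade_dual_module:
  "mgrade dual_module c = {w \<in> dC. \<forall>n. of_int n \<noteq> c \<longrightarrow> w n = 0}"
proof -
  have pow: "((\<lambda>w. mL0 dual_module w - mscale dual_module c w) ^^ m) w n u = (of_int n - c) ^ m * w n u" for m w n u
    by (induction m arbitrary: n u) (simp_all add: dual_module_simps algebra_simps)
  show ?thesis
  proof (intro equalityI subsetI)
    fix w assume "w \<in> mgrade dual_module c"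
    then obtain m where w: "w \<in> dC"
      "((\<lambda>w. mL0 dual_module w - mscale dual_module c w) ^^ m) w = 0"
      by (auto simp: mgrade_def)
    then have "(of_int n - c) ^ m * w n u = 0" for n u
      using pow[of m w n u] by simp
    then show "w \<in> {w \<in> dC. \<forall>n. of_int n \<noteq> c \<longrightarrow> w n = 0}"
      using w(1) by (auto simp: fun_eq_iff)
  next
    fix w assume w: "w \<in> {w \<in> dC. \<forall>n. of_int n \<noteq> c \<longrightarrow> w n = 0}"
    have "(of_int n - c) * w n u = 0" for n u
      using w by (cases "of_int n = c") auto
    then have "((\<lambda>w. mL0 dual_module w - mscale dual_module c w) ^^ 1) w = 0"
      by (simp add: fun_eq_iff dual_module_simps left_diff_distrib)
    then show "w \<in> mgrade dual_module c" using w by (auto simp: mgrade_def simp del: funpow.simps)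
  qed
qed

lemma dual_direct_sum: "direct_sum_decomposition (mgrade dual_module) dC"
  unfolding direct_sum_decomposition_def
proof (intro conjI allI ballI)
  show "mgrade dual_module i \<subseteq> dC" for i by (auto simp: mgrade_dual_module)
  fix w assume w: "w \<in> dC"
  let ?f = "\<lambda>(c::complex) n. if of_int n = c then w n else 0"
  have eval: "(Sum_any F) n = Sum_any (\<lambda>i. F i n)" if "finite {i. F i \<noteq> 0}"
    for F :: "complex \<Rightarrow> int \<Rightarrow> 'v \<Rightarrow> complex" and n
    using that by (rule Sum_any_additive[of "\<lambda>w. w n", rotated]) simp
  have fn: "w n = g (of_int n) n" if "decomposes (mgrade dual_module) w g" for g n
  proof -
    have g: "finite {i. g i \<noteq> 0}" "\<And>c. g c \<in> mgrade dual_module c" "w = Sum_any g"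
      using that by (auto simp: decomposes_def)
    have "w n = Sum_any (\<lambda>c. g c n)" by (subst g(3)) (rule eval[OF g(1)])
    also have "\<dots> = (\<Sum>c\<in>{of_int n}. g c n)"
      by (rule Sum_any.expand_superset) (use g(2) in \<open>auto simp: mgrade_dual_module\<close>)
    finally show ?thesis by simp
  qed
  show "\<exists>!f. decomposes (mgrade dual_module) w f"
  proof (rule ex1I)
    have sub: "{c. ?f c \<noteq> 0} \<subseteq> of_int ` {n. w n \<noteq> 0}"
      by (auto simp: fun_eq_iff split: if_splits)
    then have fin: "finite {c. ?f c \<noteq> 0}"
      using w by (auto simp: dC_iff intro: finite_subset)
    have "w = Sum_any ?f"
    proof
      fix n
      have "Sum_any ?f n = Sum_any (\<lambda>c. ?f c n)" by (rule eval[OF fin])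
      also have "(\<lambda>c. ?f c n) = (\<lambda>c. if c = of_int n then w n else 0)" by (rule ext) simp
      finally show "w n = Sum_any ?f n" by simp
    qed
    moreover have "?f c \<in> mgrade dual_module c" for c
    proof -
      have "finite {n. ?f c n \<noteq> 0}"
        by (rule finite_subset[of _ "{n. w n \<noteq> 0}"]) (use w in \<open>auto simp: dC_iff\<close>)
      then show ?thesis
        using w by (auto simp: mgrade_dual_module dC_iff zero_fun_def dual_grade_0)
    qed
    ultimately show "decomposes (mgrade dual_module) w ?f" by (simp add: decomposes_def fin)
    fix g assume g: "decomposes (mgrade dual_module) w g"
    then have "\<And>c. g c \<in> mgrade dual_module c" by (simp add: decomposes_def)
    then have "g c n = ?f c n" for c n
      using fn[OF g] by (auto simp: mgrade_dual_module)
    then show "g = ?f" by (simp add: fun_eq_iff)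
  qed
qed

text \<open>The commutator and derivative formulas are additive in \<open>v\<close>, hence reduced
  to homogeneous \<open>v\<close>, where each component of \<open>dY v k w\<close> is a single
  \<open>dual_modes\<close>.\<close>

theorem dual_module: "lower_bounded_generalized_module V dual_module"
proof (intro lower_bounded_generalized_module.intro lower_bounded_generalized_module_axioms.intro)
  show "grading_restricted_vertex_algebra V" by (rule grading_restricted_vertex_algebra_axioms)
  show vs: "vector_space (mscale dual_module)"
    by unfold_locales (simp_all add: fun_eq_iff dual_module_simps algebra_simps)
  interpret W: vector_space "mscale dual_module" by (rule vs)
  show "W.subspace dC"
    by (rule W.subspaceI) (simp_all add: dC_0 dC_add dC_scale)
  show "direct_sum_decomposition (mgrade dual_module) dC" by (rule dual_direct_sum)
  show "linear_on dC (mscale dual_module) (mscale dual_module) (dY v k)" for v k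
    by (simp add: linear_on_def dY_add_right dY_scale_right)
  show "linear_on dC (mscale dual_module) (mscale dual_module) (mL0 dual_module)"
    "linear_on dC (mscale dual_module) (mscale dual_module) (mLm1 dual_module)"
    by (simp_all add: linear_on_def fun_eq_iff dual_module_simps algebra_simps)
  show "\<exists>R. \<forall>n. Re n < R \<longrightarrow> mgrade dual_module n = {0}"
  proof (intro exI allI impI)
    fix c :: complex assume c: "Re c < 0"
    have "w n = 0" if "w \<in> mgrade dual_module c" for w n
    proof (cases "of_int n = c")
      case True
      then have "n < 0" using c by auto
      then show ?thesis
        using dual_grade_neg[of "w n" n] that by (auto simp: mgrade_dual_module dC_iff zero_fun_def)
    next
      case False
      then show ?thesis using that by (auto simp: mgrade_dual_module)
    qed
    moreover have "0 \<in> mgrade dual_module c" by (simp add: mgrade_dual_module dC_0)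
    ultimately show "mgrade dual_module c = {0}" by (auto simp: fun_eq_iff)
  qed
  fix w v u k assume w: "w \<in> dC"
  note F = dC_functional[OF w]
  show "dY v k w \<in> dC" by (rule dY_closed[OF w])
  have "{n. mL0 dual_module w n \<noteq> 0} \<subseteq> {n. w n \<noteq> 0}"
    by (auto simp: fun_eq_iff dual_module_simps)
  then show "mL0 dual_module w \<in> dC"
    using w by (auto simp: dC_iff mscale_dual mL0_dual mLm1_dual intro: dual_grade_scale finite_subset)
  have "{n. mLm1 dual_module w n \<noteq> 0} \<subseteq> (\<lambda>n. n + 1) ` {n. w n \<noteq> 0}"
    by (force simp: fun_eq_iff dual_module_simps intro: image_eqI[of _ _ "n - 1" for n])
  moreover have "mLm1 dual_module w n \<in> dual_grade n" for n
    using dual_grade_Lm1[OF dC_grade[OF w], of "n - 1"] by (simp add: mscale_dual mL0_dual mLm1_dual)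
  ultimately show "mLm1 dual_module w \<in> dC"
    using w by (auto simp: dC_iff intro: finite_subset)
  show "Vector_Spaces.linear (vscale V) (mscale dual_module) (\<lambda>v. dY v k w)"
    by (simp add: Vector_Spaces.linear_iff vs vs.vector_space_axioms dY_add_left[OF w] dY_scale_left[OF w]
        v_vector_space)
  show "\<exists>K. \<forall>k\<ge>K. dY v k w = 0" by (rule dY_truncation[OF w])
  show "dY (vac V) k w = (if k = - 1 then w else 0)"
    by (intro ext) (simp add: dY_homogeneous[OF w v_vac_grade] dual_modes_vac[OF dC_grade[OF w]])
  show "jacobi_identity (mscale dual_module) (vY V) dY u v w" by (rule dY_jacobi[OF w])
  show "mL0 dual_module (mLm1 dual_module w) - mLm1 dual_module (mL0 dual_module w) = mLm1 dual_module w"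
    by (simp add: fun_eq_iff dual_module_simps algebra_simps)
  have L0w: "mL0 dual_module w \<in> dC" by fact
  have Lm1w: "mLm1 dual_module w \<in> dC" by fact
  have L0_add': "mL0 dual_module (x + y) = mL0 dual_module x + mL0 dual_module y"
    and Lm1_add': "mLm1 dual_module (x + y) = mLm1 dual_module x + mLm1 dual_module y" for x y
    by (simp_all add: fun_eq_iff dual_module_simps algebra_simps)
  show "mL0 dual_module (dY v k w) - dY v k (mL0 dual_module w) =
      mscale dual_module (- of_int k - 1) (dY v k w) + dY (vL0 V v) k w" (is "?P v")
  proof (rule homogeneous_induct[of ?P v])
    fix a v assume homogeneous: "v \<in> vgrade V a"
    have *: "(mL0 dual_module (dY v k w) - dY v k (mL0 dual_module w)) m u =
      (mscale dual_module (- of_int k - 1) (dY v k w) + dY (vL0 V v) k w) m u" for m u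
    proof -
      have 1: "dY v k (mL0 dual_module w) m u = of_int (m - a + k + 1) * dY v k w m u"
        unfolding dY_homogeneous[OF L0w homogeneous] dY_homogeneous[OF w homogeneous] mL0_dual
          dual_modes_scale_f ..
      have 2: "dY (vL0 V v) k w = mscale dual_module (of_int a) (dY v k w)"
        unfolding v_L0_grade[OF homogeneous] dY_scale_left[OF w] ..
      show ?thesis by (simp add: 1 2 dual_module_simps algebra_simps)
    qed
    show "?P v" by (intro ext) (rule *)
  next
    fix v v' assume add: "?P v" "?P v'"
    have "?P (v + v')"
      unfolding dY_add_left[OF w] dY_add_left[OF L0w] L0_add L0_add' mscale_dual_add add_diff_add add
      by (simp only: add_ac)
    then show "?P (v + v')" .
  qed
  show "mLm1 dual_module (dY v k w) - dY v k (mLm1 dual_module w) = dY (vLm1 V v) k w" (is "?Q v")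
  proof (rule homogeneous_induct[of ?Q v])
    fix a v assume homogeneous: "v \<in> vgrade V a"
    have *: "(mLm1 dual_module (dY v k w) - dY v k (mLm1 dual_module w)) m u = dY (vLm1 V v) k w m u" for m u
    proof -
      have deg: "m - (a + 1) + k + 1 = m - a + k" "m - 1 - a + k + 1 = m - a + k"
        "m - a + k + 1 - 1 = m - a + k" by simp_all
      have "dual_modes a (m - a + k + 1) v (mLm1 dual_module w (m - a + k + 1)) u k =
          dual_modes a (m - a + k + 1) v (\<lambda>u. - w (m - a + k) (vLm1 V u)) u k"
        by (simp only: mLm1_dual deg)
      then show ?thesis
        using dual_modes_Lm1_commutator[OF dC_grade[OF w] homogeneous, of "m - a + k" u k]
        unfolding fun_diff_def mLm1_dual[of "dY v k w"] dY_homogeneous[OF w Lm1_grade[OF homogeneous]]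
          dY_homogeneous[OF w homogeneous] dY_homogeneous[OF Lm1w homogeneous] deg
        by simp
    qed
    show "?Q v" by (intro ext) (rule *)
  next
    fix v v' assume add: "?Q v" "?Q v'"
    have "?Q (v + v')"
      unfolding dY_add_left[OF w] dY_add_left[OF Lm1w] Lm1_add Lm1_add' add_diff_add add ..
    then show "?Q (v + v')" .
  qed
  show "dY (vLm1 V v) k w = mscale dual_module (- of_int k) (dY v (k - 1) w)" (is "?R v")
  proof (rule homogeneous_induct[of ?R v])
    fix a v assume homogeneous: "v \<in> vgrade V a"
    have *: "dY (vLm1 V v) k w m u = mscale dual_module (- of_int k) (dY v (k - 1) w) m u" for m u
    proof -
      have "m - (a + 1) + k + 1 = m - a + (k - 1) + 1" by simp
      then show ?thesis
        using dual_modes_deriv[OF dC_grade[OF w] homogeneous, of "m - a + (k - 1) + 1" u k]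
        by (simp add: dY_homogeneous[OF w Lm1_grade[OF homogeneous]] dY_homogeneous[OF w homogeneous]
            mscale_dual)
    qed
    show "?R v" by (intro ext) (rule *)
  next
    fix v v' assume add: "?R v" "?R v'"
    have "?R (v + v')"
      unfolding dY_add_left[OF w] Lm1_add mscale_dual_add add ..
    then show "?R (v + v')" .
  qed
qed

end

section \<open>Residues of twisted vertex operators\<close>

lemma laurent_times_eq_sum:
  assumes "vector_space s" and "\<And>j. j < J \<Longrightarrow> fls_nth f j = 0" and "\<And>n. n < N \<Longrightarrow> a n = 0"
  shows "laurent_times s f a n = (\<Sum>j=J..n - N. s (fls_nth f j) (a (n - j)))"
proof -
  interpret vector_space s by fact
  show ?thesis
    unfolding laurent_times_def
  proof (rule Sum_any.expand_superset)
    show "{j. s (fls_nth f j) (a (n - j)) \<noteq> 0} \<subseteq> {J..n - N}"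
    proof
      fix j assume "j \<in> {j. s (fls_nth f j) (a (n - j)) \<noteq> 0}"
      then have "fls_nth f j \<noteq> 0" "a (n - j) \<noteq> 0" by auto
      then have "\<not> j < J" "\<not> n - j < N" using assms by blast+
      then show "j \<in> {J..n - N}" by auto
    qed
  qed simp
qed

text \<open>Vanishing of \<open>a\<close> in low degrees makes all coefficients finite sums, which
  may then be reordered by total exponent.\<close>

lemma laurent_times_assoc:
  assumes s: "vector_space s" and a: "\<And>n. n < N \<Longrightarrow> a n = 0"
  shows "laurent_times s f (laurent_times s g a) n = laurent_times s (f * g) a n"
proof -
  interpret vector_space s by fact
  let ?F = "fls_subdegree f" and ?G = "fls_subdegree g"
  have ga: "laurent_times s g a m = (\<Sum>j=?G..m - N. s (fls_nth g j) (a (m - j)))" for m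
    by (rule laurent_times_eq_sum[OF s _ a]) auto
  have "laurent_times s f (laurent_times s g a) n =
      (\<Sum>i=?F..n - (N + ?G). s (fls_nth f i) (laurent_times s g a (n - i)))"
    by (rule laurent_times_eq_sum[OF s]) (auto simp: ga)
  also have "\<dots> = (\<Sum>i=?F..n - (N + ?G). \<Sum>j=?G..n - i - N. s (fls_nth f i * fls_nth g j) (a (n - i - j)))"
    by (simp add: ga scale_sum_right)
  also have "\<dots> = (\<Sum>(i, j)\<in>Sigma {?F..n - (N + ?G)} (\<lambda>i. {?G..n - i - N}).
      s (fls_nth f i * fls_nth g j) (a (n - i - j)))"
    by (rule sum.Sigma) auto
  also have "\<dots> = (\<Sum>(m, i)\<in>Sigma {?F + ?G..n - N} (\<lambda>m. {?F..m - ?G}).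
      s (fls_nth f i * fls_nth g (m - i)) (a (n - m)))"
    by (rule sum.reindex_bij_witness[of _ "\<lambda>(m, i). (i, m - i)" "\<lambda>(i, j). (i + j, i)"])
      (auto simp: algebra_simps)
  also have "\<dots> = (\<Sum>m=?F + ?G..n - N. \<Sum>i=?F..m - ?G. s (fls_nth f i * fls_nth g (m - i)) (a (n - m)))"
    by (rule sum.Sigma[symmetric]) auto
  also have "\<dots> = (\<Sum>m=?F + ?G..n - N. s (fls_nth (f * g) m) (a (n - m)))"
    by (simp add: fls_times_nth(2) scale_sum_left)
  also have "\<dots> = laurent_times s (f * g) a n"
    by (rule laurent_times_eq_sum[OF s _ a, symmetric]) (rule fls_times_nth_eq0)
  finally show ?thesis .
qed

lemma laurent_times_truncated:
  assumes "vector_space s" and "\<And>n. n < N \<Longrightarrow> a n = 0" and "n < fls_subdegree g + N"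
  shows "laurent_times s g a n = 0"
  using laurent_times_eq_sum[OF assms(1), of "fls_subdegree g" g N a n] assms(2,3) by auto

lemma laurent_times_sum_right:
  assumes s: "vector_space s" and "finite A" "\<And>r n. r \<in> A \<Longrightarrow> n < N \<Longrightarrow> a r n = 0"
  shows "laurent_times s f (\<lambda>n. \<Sum>r\<in>A. a r n) n = (\<Sum>r\<in>A. laurent_times s f (a r) n)"
proof -
  interpret vector_space s by fact
  have "laurent_times s f (\<lambda>n. \<Sum>r\<in>A. a r n) n =
      (\<Sum>j=fls_subdegree f..n - N. s (fls_nth f j) (\<Sum>r\<in>A. a r (n - j)))"
    by (rule laurent_times_eq_sum[OF s]) (auto simp: assms)
  also have "\<dots> = (\<Sum>r\<in>A. \<Sum>j=fls_subdegree f..n - N. s (fls_nth f j) (a r (n - j)))"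
    unfolding scale_sum_right by (rule sum.swap)
  also have "\<dots> = (\<Sum>r\<in>A. laurent_times s f (a r) n)"
    by (rule sum.cong[OF refl], rule laurent_times_eq_sum[OF s, symmetric]) (auto simp: assms)
  finally show ?thesis .
qed

lemma laurent_times_sum_left:
  assumes s: "vector_space s" and "finite A" "\<And>n. n < N \<Longrightarrow> a n = 0"
  shows "laurent_times s (\<Sum>m\<in>A. fls_const (c m) * f m) a n = (\<Sum>m\<in>A. s (c m) (laurent_times s (f m) a n))"
proof -
  interpret vector_space s by fact
  obtain J where J: "\<And>m j. m \<in> A \<Longrightarrow> j < J \<Longrightarrow> fls_nth (f m) j = 0"
  proof
    fix m j assume "m \<in> A" "j < Min (insert 0 ((\<lambda>m. fls_subdegree (f m)) ` A))"
    then show "fls_nth (f m) j = 0" using assms(2) by auto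
  qed
  have "laurent_times s (\<Sum>m\<in>A. fls_const (c m) * f m) a n =
      (\<Sum>j=J..n - N. s (fls_nth (\<Sum>m\<in>A. fls_const (c m) * f m) j) (a (n - j)))"
    by (rule laurent_times_eq_sum[OF s]) (auto simp: fls_nth_sum J assms)
  also have "\<dots> = (\<Sum>m\<in>A. s (c m) (\<Sum>j=J..n - N. s (fls_nth (f m) j) (a (n - j))))"
    unfolding fls_nth_sum scale_sum_left scale_sum_right fls_mult_const_nth scale_scale
    by (subst sum.swap) simp
  also have "\<dots> = (\<Sum>m\<in>A. s (c m) (laurent_times s (f m) a n))"
    by (intro sum.cong[OF refl] arg_cong[of _ _ "s _"], rule laurent_times_eq_sum[OF s, symmetric])
      (auto simp: assms J)
  finally show ?thesis .
qed

text \<open>\<open>f^L(0)\<close> is a different Laurent series on each weight, so the factor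
  \<open>\<phi>\<close> is merged with it weight by weight; the finitely many weights share a lower
  bound \<open>N\<close>.\<close>

lemma Res_vop_twisted:
  assumes s: "vector_space s" and fin: "finite {r. component G r v \<noteq> 0}"
    and trunc: "\<And>r. \<exists>K. \<forall>k\<ge>K. Y (component G r v) k w = 0"
  shows "Res (laurent_times s \<phi> (vop_twisted s G Y f v w)) =
    (\<Sum>r | component G r v \<noteq> 0. Res (laurent_times s (\<phi> * f powi r) (vop_series Y (component G r v) w)))"
proof -
  let ?A = "{r. component G r v \<noteq> 0}"
  obtain K where K: "\<And>r k. K r \<le> k \<Longrightarrow> Y (component G r v) k w = 0" using trunc by metis
  have a: "vop_series Y (component G r v) w n = 0" if "n < - K r" for r n
    using that by (simp add: vop_series_def K)
  define N where "N = Min (insert 0 ((\<lambda>r. fls_subdegree (f powi r) - K r) ` ?A))"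
  have "laurent_times s (f powi r) (vop_series Y (component G r v) w) n = 0" if "r \<in> ?A" "n < N" for r n
  proof (rule laurent_times_truncated[OF s a])
    show "n < fls_subdegree (f powi r) + - K r" using that fin by (auto simp: N_def)
  qed
  then have "Res (laurent_times s \<phi> (vop_twisted s G Y f v w)) = (\<Sum>r\<in>?A.
      Res (laurent_times s \<phi> (laurent_times s (f powi r) (vop_series Y (component G r v) w))))"
    unfolding vop_twisted_def Res_def by (intro laurent_times_sum_right[OF s fin])
  then show ?thesis
    unfolding Res_def by (simp add: laurent_times_assoc[OF s a])
qed

lemma fls_X_powi: "(fls_X :: complex fls) powi e = fls_X_intpow e"
proof (cases "0 \<le> e")
  case True
  then show ?thesis by (simp add: power_int_def fls_X_power_conv_shift_1)
next
  case False
  then show ?thesis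
    by (simp add: power_int_def fls_inverse_X fls_X_inv_power_conv_shift_1 flip: power_inverse)
qed

lemma Res_laurent_X_power:
  assumes "vector_space s"
  shows "Res (laurent_times s (fls_X powi e) (vop_series Y v w)) = Y v e w"
proof -
  interpret vector_space s by fact
  have "Res (laurent_times s (fls_X powi e) (vop_series Y v w)) =
      Sum_any (\<lambda>j. if j = e then Y v e w else 0)"
    unfolding Res_def laurent_times_def vop_series_def fls_X_powi
    by (rule arg_cong[of _ _ Sum_any]) auto
  then show ?thesis by simp
qed

context grading_restricted_vertex_algebra
begin

text \<open>Links the formal residues of the definitions to the binomial sums on which the arguments
  above are based.\<close>

lemma Res_laurent_vres:
  "Res (laurent_times (vscale V) (fls_X powi e * (1 + fls_X) powi s) (vop_series (vY V) v u)) = vres s e v u"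
proof -
  define c where "c = fls_nth (fls_X powi e * (1 + fls_X) powi s :: complex fls)"
  have c: "c j = (if j < e then 0 else of_int s gchoose nat (j - e))" for j
    by (simp add: c_def fls_X_powi fls_X_intpow_times_conv_shift one_plus_fls_X_powi_eq)
  obtain K where K: "\<And>k. K \<le> k \<Longrightarrow> vY V v k u = 0" using v_truncation by blast
  obtain N where N: "K \<le> e + int N" by (meson int_bound)
  have "Res (laurent_times (vscale V) (fls_X powi e * (1 + fls_X) powi s) (vop_series (vY V) v u)) =
      Sum_any (\<lambda>j. vscale V (c j) (vY V v j u))"
    unfolding Res_def laurent_times_def vop_series_def c_def by (rule arg_cong[of _ _ Sum_any]) auto
  also have "\<dots> = (\<Sum>j=e..<e + int N. vscale V (c j) (vY V v j u))"
  proof (rule Sum_any.expand_superset)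
    have *: "vscale V (c j) (vY V v j u) = 0" if "j < e \<or> e + int N \<le> j" for j
      using that N K[of j] by (auto simp: c)
    show "{j. vscale V (c j) (vY V v j u) \<noteq> 0} \<subseteq> {e..<e + int N}"
    proof
      fix j assume "j \<in> {j. vscale V (c j) (vY V v j u) \<noteq> 0}"
      then have "vscale V (c j) (vY V v j u) \<noteq> 0" by (rule CollectD)
      then have "\<not> (j < e \<or> e + int N \<le> j)" using *[of j] by blast
      then show "j \<in> {e..<e + int N}" by auto
    qed
  qed simp
  also have "\<dots> = (\<Sum>i<N. vscale V (of_int s gchoose i) (vY V v (e + int i) u))"
    by (rule sum.reindex_bij_witness[of _ "\<lambda>i. e + int i" "\<lambda>j. nat (j - e)"]) (auto simp: c)
  also have "\<dots> = vres s e v u"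
    by (rule vres_eq_sum[OF K, symmetric]) (auto simp: N)
  finally show ?thesis .
qed

text \<open>\<open>e = - 2\<close> gives the generators of \<open>zhu_O V\<close>, and
  \<open>e = - 1\<close> the product.\<close>

lemma zhu_O_generator:
  "Res (laurent_times (vscale V) (fls_X powi e) (vop_twisted (vscale V) (vgrade V) (vY V) (1 + fls_X) u v)) =
    (\<Sum>r | component (vgrade V) r u \<noteq> 0. vres r e (component (vgrade V) r u) v)"
  by (subst Res_vop_twisted[OF v_vector_space finite_components])
    (simp_all only: v_truncation Res_laurent_vres)

lemma zhu_mult_eq:
  "zhu_mult V u v = (\<Sum>r | component (vgrade V) r u \<noteq> 0. vres r (- 1) (component (vgrade V) r u) v)"
  unfolding zhu_mult_def by (rule zhu_O_generator)

section \<open>The matrix product in terms of residues\<close>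

definition diamond_entry :: "nat \<Rightarrow> nat \<Rightarrow> nat \<Rightarrow> 'v \<Rightarrow> 'v \<Rightarrow> 'v"
  where "diamond_entry k n l u v =
    Res (laurent_times (vscale V) (T_truncation k n l * (1 + fls_X) ^ l)
      (vop_twisted (vscale V) (vgrade V) (vY V) (1 + fls_X) u v))"

lemma diamond_entry_eq:
  "diamond_entry k n l u v = (\<Sum>r | component (vgrade V) r u \<noteq> 0. \<Sum>m=0..n.
    vscale V (of_int (- int k + int n - int l - 1) gchoose m)
      (vres (int l + r) (- int k + int n - int l - int m - 1) (component (vgrade V) r u) v))"
proof -
  have "Res (laurent_times (vscale V) (T_truncation k n l * (1 + fls_X) ^ l * (1 + fls_X) powi r)
      (vop_series (vY V) w v)) = (\<Sum>m=0..n. vscale V (of_int (- int k + int n - int l - 1) gchoose m)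
      (vres (int l + r) (- int k + int n - int l - int m - 1) w v))" for r w
  proof -
    obtain K where K: "\<And>k. K \<le> k \<Longrightarrow> vY V w k v = 0" using v_truncation by blast
    have pow: "(1 + fls_X :: complex fls) ^ l * (1 + fls_X) powi r = (1 + fls_X) powi (int l + r)"
      unfolding power_int_of_nat[symmetric] one_plus_fls_X_powi_eq of_int_add fps_binomial_add_mult
        fls_times_fps_to_fls ..
    have "T_truncation k n l * (1 + fls_X) ^ l * (1 + fls_X) powi r =
      (\<Sum>m\<in>{0..n}. fls_const (of_int (- int k + int n - int l - 1) gchoose m) *
        (fls_X powi (- int k + int n - int l - int m - 1) * (1 + fls_X) powi (int l + r)))"
      unfolding T_truncation_def mult.assoc[of _ "(1 + fls_X) ^ l"] pow sum_distrib_right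
      by (simp add: mult.assoc)
    moreover have "vop_series (vY V) w v j = 0" if "j < - K" for j
      using that by (simp add: vop_series_def K)
    ultimately show ?thesis
      unfolding Res_def
      by (simp only: laurent_times_sum_left[OF v_vector_space finite_atLeastAtMost, of "- K"]
          Res_laurent_vres[unfolded Res_def])
  qed
  then show ?thesis
    unfolding diamond_entry_def
    by (subst Res_vop_twisted[OF v_vector_space finite_components]) (simp_all only: v_truncation)
qed

lemma diamond_eq: "diamond V u v k l = (\<Sum>n | v n l \<noteq> 0. diamond_entry k n l (u k n) (v n l))"
  by (simp add: diamond_def diamond_entry_def)

lemma diamond_entry_zhu: "diamond_entry 0 0 0 u v = zhu_mult V u v"
  by (simp add: diamond_entry_eq zhu_mult_eq)

end

section \<open>The action on the associated graded space\<close>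

context lower_bounded_generalized_module
begin

sublocale ms: vector_space "mscale W" by (rule m_vector_space)

lemma mY_add_left: "w \<in> mcarrier W \<Longrightarrow> mY W (v + v') k w = mY W v k w + mY W v' k w"
  and mY_scale_left: "w \<in> mcarrier W \<Longrightarrow> mY W (vscale V c v) k w = mscale W c (mY W v k w)"
  using m_Y_linear1[of w k] unfolding Vector_Spaces.linear_iff by blast+

lemma mY_add_right: "w \<in> mcarrier W \<Longrightarrow> w' \<in> mcarrier W \<Longrightarrow> mY W v k (w + w') = mY W v k w + mY W v k w'"
  using m_Y_linear2[of v k] unfolding linear_on_def by blast

lemma zero_in_carrier [simp]: "0 \<in> mcarrier W"
  by (rule ms.subspace_0[OF m_subspace])

lemma mY_0_right [simp]: "mY W v k 0 = 0"
  using mY_add_right[of 0 0 v k] by simp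

lemma mY_0_left [simp]: "w \<in> mcarrier W \<Longrightarrow> mY W 0 k w = 0"
  using mY_add_left[of w 0 0 k] by simp

lemma m_jacobi_coefficient:
  assumes "w \<in> mcarrier W"
  shows "Sum_any (\<lambda>i::nat. mscale W ((-1) ^ i * (of_int r gchoose i))
        (mY W u (p + r - int i) (mY W v (q + int i) w)))
    - Sum_any (\<lambda>i::nat. mscale W ((-1) powi r * (-1) ^ i * (of_int r gchoose i))
        (mY W v (q + r - int i) (mY W u (p + int i) w)))
    = Sum_any (\<lambda>i::nat. mscale W (of_int p gchoose i)
        (mY W (vY V u (r + int i) v) (p + q - int i) w))"
  using m_jacobi[OF assms, of u v] unfolding jacobi_identity_def by blast

lemma theta_entry_eq:
  assumes w: "w \<in> mcarrier W"
  shows "theta_entry V W k l v w = (\<Sum>r | component (vgrade V) r v \<noteq> 0.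
    mY W (component (vgrade V) r v) (r + int l - int k - 1) w)"
proof -
  have "(fls_X :: complex fls) powi (int l - int k - 1) * fls_X powi r = fls_X powi (r + int l - int k - 1)" for r
  proof -
    have "(fls_X :: complex fls) powi (int l - int k - 1 + r) = fls_X powi (int l - int k - 1) * fls_X powi r"
      by (rule power_int_add) simp
    moreover have "int l - int k - 1 + r = r + int l - int k - 1" by simp
    ultimately show ?thesis by (simp only:)
  qed
  then show ?thesis
    unfolding theta_entry_def
    by (subst Res_vop_twisted[OF m_vector_space finite_components])
      (simp_all only: m_truncation[OF w] Res_laurent_X_power[OF m_vector_space])
qed

text \<open>This mode shifts degrees by \<open>k - l\<close>, in accordance with its place in row
  \<open>k\<close> and column \<open>l\<close>.\<close>

lemma theta_entry_homogeneous:
  assumes w: "w \<in> mcarrier W" and v: "v \<in> vgrade V a"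
  shows "theta_entry V W k l v w = mY W v (a + int l - int k - 1) w"
proof (cases "v = 0")
  case True
  then show ?thesis by (simp add: theta_entry_eq[OF w] w)
next
  case False
  then have "{r. component (vgrade V) r v \<noteq> 0} = {a}" by (auto simp: component_homogeneous[OF v])
  then show ?thesis by (simp add: theta_entry_eq[OF w] component_homogeneous[OF v])
qed

lemma theta_entry_add_left:
  assumes w: "w \<in> mcarrier W"
  shows "theta_entry V W k l (v + v') w = theta_entry V W k l v w + theta_entry V W k l v' w"
proof -
  have sup: "theta_entry V W k l v w = (\<Sum>r\<in>A. mY W (component (vgrade V) r v) (r + int l - int k - 1) w)"
    if "finite A" "{r. component (vgrade V) r v \<noteq> 0} \<subseteq> A" for A v
    unfolding theta_entry_eq[OF w]
    by (rule sum.mono_neutral_left[OF that]) (simp add: w)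
  obtain A where A: "finite A" "{a. component (vgrade V) a v \<noteq> 0} \<subseteq> A"
    "{a. component (vgrade V) a v' \<noteq> 0} \<subseteq> A" "{a. component (vgrade V) a (v + v') \<noteq> 0} \<subseteq> A"
    using finite_UnI[OF finite_UnI[OF finite_components finite_components] finite_components] by blast
  show ?thesis
    by (simp add: sup[OF A(1,2)] sup[OF A(1,3)] sup[OF A(1,4)] component_add mY_add_left w sum.distrib)
qed

lemma theta_entry_scale_left:
  assumes w: "w \<in> mcarrier W"
  shows "theta_entry V W k l (vscale V c v) w = mscale W c (theta_entry V W k l v w)"
proof (cases "c = 0")
  case True
  then show ?thesis by (simp add: theta_entry_homogeneous[OF w zero_in_grade[of 0]] w)
next
  case False
  then show ?thesis
    by (simp add: theta_entry_eq[OF w] component_scale mY_scale_left w ms.scale_sum_right)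
qed

lemma theta_entry_0_left: "w \<in> mcarrier W \<Longrightarrow> theta_entry V W k l 0 w = 0"
  using theta_entry_scale_left[of w k l 0 0] by simp

lemma theta_entry_minus_left: "w \<in> mcarrier W \<Longrightarrow> theta_entry V W k l (- v) w = - theta_entry V W k l v w"
  using theta_entry_scale_left[of w k l "- 1" v] by simp

lemma theta_entry_sum_left:
  "w \<in> mcarrier W \<Longrightarrow> theta_entry V W k l (\<Sum>i\<in>A. g i) w = (\<Sum>i\<in>A. theta_entry V W k l (g i) w)"
  by (induction A rule: infinite_finite_induct) (simp_all add: theta_entry_0_left theta_entry_add_left)

lemma theta_entry_add_right:
  "w \<in> mcarrier W \<Longrightarrow> w' \<in> mcarrier W \<Longrightarrow>
    theta_entry V W k l v (w + w') = theta_entry V W k l v w + theta_entry V W k l v w'"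
  by (simp add: theta_entry_eq ms.subspace_add[OF m_subspace] mY_add_right sum.distrib)

lemma mY_scale_right: "w \<in> mcarrier W \<Longrightarrow> mY W v k (mscale W c w) = mscale W c (mY W v k w)"
  using m_Y_linear2[of v k] unfolding linear_on_def by blast

lemma theta_entry_scale_right:
  "w \<in> mcarrier W \<Longrightarrow> theta_entry V W k l v (mscale W c w) = mscale W c (theta_entry V W k l v w)"
  by (simp add: theta_entry_eq ms.subspace_scale[OF m_subspace] mY_scale_right ms.scale_sum_right)

lemma theta_entry_closed: "w \<in> mcarrier W \<Longrightarrow> theta_entry V W k l v w \<in> mcarrier W"
  by (simp add: theta_entry_eq ms.subspace_sum[OF m_subspace] m_Y_closed)

lemma Omega_carrier: "w \<in> Omega V W n \<Longrightarrow> w \<in> mcarrier W"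
  by (auto simp: Omega_def split: if_splits)

lemma OmegaD: "w \<in> Omega V W n \<Longrightarrow> v \<in> vgrade V r \<Longrightarrow> r - k - 1 < - n \<Longrightarrow> mY W v k w = 0"
  by (auto simp: Omega_def split: if_splits)

lemma OmegaI:
  "w \<in> mcarrier W \<Longrightarrow> 0 \<le> n \<Longrightarrow> (\<And>r v k. v \<in> vgrade V r \<Longrightarrow> r - k - 1 < - n \<Longrightarrow> mY W v k w = 0) \<Longrightarrow>
    w \<in> Omega V W n"
  by (simp add: Omega_def)

lemma Omega_neg: "n < 0 \<Longrightarrow> Omega V W n = {0}"
  by (simp add: Omega_def)

lemma Omega_sum: "(\<And>i. i \<in> A \<Longrightarrow> g i \<in> Omega V W n) \<Longrightarrow> (\<Sum>i\<in>A. g i) \<in> Omega V W n"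
  by (induction A rule: infinite_finite_induct) (simp_all add: Omega_0 Omega_add)

lemma Omega_scale: "w \<in> Omega V W n \<Longrightarrow> mscale W c w \<in> Omega V W n"
  by (auto simp: Omega_def ms.subspace_scale[OF m_subspace] mY_scale_right split: if_splits)

lemma Omega_mono:
  assumes w: "w \<in> Omega V W m" and "m \<le> n"
  shows "w \<in> Omega V W n"
proof (cases "m < 0")
  case True
  then show ?thesis using w Omega_0 by (simp add: Omega_neg)
next
  case False
  show ?thesis
  proof (rule OmegaI[OF Omega_carrier[OF w]])
    show "0 \<le> n" using False assms(2) by simp
    fix r v k assume "v \<in> vgrade V r" "r - k - 1 < - n"
    then show "mY W v k w = 0" using assms(2) by (intro OmegaD[OF w]) auto
  qed
qed

text \<open>
  With \<open>p\<close> so large that \<open>u\<^sub>p\<^sub>+\<^sub>i w = 0\<close> for all \<open>i \<ge> 0\<close>, the Jacobi identity expresses the leading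
  term \<open>u\<^sub>m v\<^sub>j w\<close> by the terms \<open>u\<^sub>m\<^sub>-\<^sub>i v\<^sub>j\<^sub>+\<^sub>i w\<close> with \<open>i > 0\<close>.
\<close>

lemma two_modes_zero:
  assumes w: "w \<in> Omega V W n" and u: "u \<in> vgrade V a" and v: "v \<in> vgrade V b"
  shows "a + b - m - j - 2 < - n \<Longrightarrow> mY W u m (mY W v j w) = 0"
proof -
  note wC = Omega_carrier[OF w]
  obtain K where K: "\<And>k. K \<le> k \<Longrightarrow> mY W v k w = 0" using m_truncation[OF wC] by blast
  have "\<forall>m j. K - int d \<le> j \<longrightarrow> a + b - m - j - 2 < - n \<longrightarrow> mY W u m (mY W v j w) = 0" for d
  proof (induction d)
    case 0
    then show ?case by (simp add: K)
  next
    case (Suc d)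
    show ?case
    proof (intro allI impI)
      fix m j assume j: "K - int (Suc d) \<le> j" and tot: "a + b - m - j - 2 < - n"
      \<comment> \<open>From this index on the modes of \<open>u\<close> annihilate
        \<open>w\<close>, because \<open>w\<close> lies in \<open>Omega V W n\<close>.\<close>
      define p where "p = a + n"
      define r where "r = m - p"
      let ?A = "\<lambda>i::nat. mscale W ((-1) ^ i * (of_int r gchoose i))
        (mY W u (p + r - int i) (mY W v (j + int i) w))"
      have "?A i = 0" if "i \<noteq> 0" for i
      proof -
        have "mY W u (p + r - int i) (mY W v (j + int i) w) = 0"
          using Suc[rule_format, of "j + int i" "p + r - int i"] that j tot by (simp add: r_def)
        then show ?thesis by simp
      qed
      then have "Sum_any ?A = (\<Sum>i<1. ?A i)" by (intro Sum_any_eq_lessThan) auto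
      moreover have "mY W u (p + int i) w = 0" for i
        by (rule OmegaD[OF w u]) (simp add: p_def)
      moreover have "mY W (vY V u (r + int i) v) (p + j - int i) w = 0" for i
        by (rule OmegaD[OF w Y_grade[OF u v]]) (use tot in \<open>simp add: r_def\<close>)
      ultimately show "mY W u m (mY W v j w) = 0"
        using m_jacobi_coefficient[OF wC, of r u p v j] by (simp add: r_def)
    qed
  qed
  from this[of "nat (K - j)"] show "a + b - m - j - 2 < - n \<Longrightarrow> ?thesis" by simp
qed

text \<open>For \<open>d = 0\<close> the entry maps column level \<open>l\<close> to row level
  \<open>k\<close>; for \<open>d = 1\<close> it respects the next lower levels, so that it descends
  to the quotients.\<close>

lemma theta_entry_Omega:
  assumes w: "w \<in> Omega V W (int l - d)"
  shows "theta_entry V W k l v w \<in> Omega V W (int k - d)"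
proof -
  note wC = Omega_carrier[OF w]
  show ?thesis
  proof (rule homogeneous_induct[of "\<lambda>v. theta_entry V W k l v w \<in> Omega V W (int k - d)" v])
    fix b v assume v: "v \<in> vgrade V b"
    show "theta_entry V W k l v w \<in> Omega V W (int k - d)"
    proof (cases "int k - d < 0")
      case True
      have "mY W v (b + int l - int k - 1) w = 0"
        by (rule OmegaD[OF w v]) (use True in auto)
      then show ?thesis by (simp add: theta_entry_homogeneous[OF wC v] Omega_0)
    next
      case False
      show ?thesis unfolding theta_entry_homogeneous[OF wC v]
      proof (rule OmegaI[OF m_Y_closed[OF wC]])
        fix a u m assume u: "u \<in> vgrade V a" and "a - m - 1 < - (int k - d)"
        then show "mY W u m (mY W v (b + int l - int k - 1) w) = 0"
          by (intro two_modes_zero[OF w u v]) auto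
      qed (use False in simp)
    qed
  next
    fix v v' assume "theta_entry V W k l v w \<in> Omega V W (int k - d)"
      "theta_entry V W k l v' w \<in> Omega V W (int k - d)"
    then show "theta_entry V W k l (v + v') w \<in> Omega V W (int k - d)"
      by (simp add: theta_entry_add_left[OF wC] Omega_add)
  qed
qed

text \<open>On \<open>Omega V W l\<close> the modes of \<open>u\<close> from index
  \<open>l + a\<close> on are zero. The Jacobi identity with \<open>p = l + a\<close> thus loses the
  product in which \<open>u\<close> acts first. This explains the factor
  \<open>(1 + x)^l (1 + x)^L(0)\<close> in the matrix product.\<close>

lemma theta_entry_vres:
  assumes w: "w \<in> Omega V W (int l)" and u: "u \<in> vgrade V a" and v: "v \<in> vgrade V b"
  shows "theta_entry V W k l (vres (int l + a) e u v) w =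
    Sum_any (\<lambda>i::nat. mscale W ((-1) ^ i * (of_int e gchoose i))
      (mY W u (int l + a + e - int i) (mY W v (b - e - 2 - int k + int i) w)))"
proof -
  note wC = Omega_carrier[OF w]
  define p where "p = int l + a"
  define q where "q = b - e - 2 - int k"
  obtain K where K: "\<And>k. K \<le> k \<Longrightarrow> vY V u k v = 0" using v_truncation by blast
  let ?N = "nat (K - e)"
  have "theta_entry V W k l (vres p e u v) w =
      (\<Sum>i<?N. mscale W (of_int p gchoose i) (mY W (vY V u (e + int i) v) (p + q - int i) w))"
  proof -
    have "theta_entry V W k l (vY V u (e + int i) v) w = mY W (vY V u (e + int i) v) (p + q - int i) w" for i
      unfolding theta_entry_homogeneous[OF wC Y_grade[OF u v]] by (simp add: p_def q_def algebra_simps)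
    then show ?thesis
      by (simp add: vres_eq_sum[of K u v e ?N p] K theta_entry_sum_left wC theta_entry_scale_left)
  qed
  also have "\<dots> = Sum_any (\<lambda>i. mscale W (of_int p gchoose i) (mY W (vY V u (e + int i) v) (p + q - int i) w))"
    by (rule Sum_any_eq_lessThan[symmetric]) (simp add: K wC)
  also have "\<dots> = Sum_any (\<lambda>i::nat. mscale W ((-1) ^ i * (of_int e gchoose i))
      (mY W u (p + e - int i) (mY W v (q + int i) w)))"
  proof -
    have "mY W u (p + int i) w = 0" for i
      by (rule OmegaD[OF w u]) (simp add: p_def)
    then show ?thesis
      using m_jacobi_coefficient[OF wC, of e u p v q] by simp
  qed
  finally show ?thesis by (simp add: p_def q_def)
qed

text \<open>Exponent \<open>e - m\<close> yields the products of modes \<open>Z j\<close> with the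
  coefficients of \<open>(1 - t)^(e - m)\<close>, and the weights \<open>e gchoose m\<close> of the
  truncated binomial series undo this. By trinomial revision the total coefficient of
  \<open>Z j\<close> is, up to sign, \<open>e gchoose j\<close> times an alternating sum of the
  binomials \<open>j choose m\<close>, hence 0 unless \<open>j = 0\<close>. Stopping at
  \<open>m = n\<close> is harmless, as \<open>Z j = 0\<close> for \<open>n < j\<close>.\<close>

lemma theta_entry_diamond:
  assumes w: "w \<in> Omega V W (int l)"
  shows "theta_entry V W k l (diamond_entry k n l u v) w =
    theta_entry V W k n u (theta_entry V W n l v w)" (is "?L u v = ?R u v")
proof -
  note wC = Omega_carrier[OF w]
  have hom: "?L u v = ?R u v" if u: "u \<in> vgrade V a" and v: "v \<in> vgrade V b" for a b u v
  proof -
    define e where "e = - int k + int n - int l - 1"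
    define Z where "Z j = mY W u (a + int n - int k - 1 - int j) (mY W v (b + int l - int n - 1 + int j) w)"
      for j :: nat
    have Z0: "Z j = 0" if "n < j" for j
    proof -
      have "mY W v (b + int l - int n - 1 + int j) w = 0"
        by (rule OmegaD[OF w v]) (use that in auto)
      then show ?thesis by (simp add: Z_def)
    qed
    have entry: "theta_entry V W k l (vres (int l + a) (e - int m) u v) w =
        (\<Sum>i\<le>n - m. mscale W ((-1) ^ i * (of_int e - of_nat m gchoose i)) (Z (m + i)))" if "m \<le> n" for m
    proof -
      have "theta_entry V W k l (vres (int l + a) (e - int m) u v) w =
          Sum_any (\<lambda>i. mscale W ((-1) ^ i * (of_int e - of_nat m gchoose i)) (Z (m + i)))"
        unfolding theta_entry_vres[OF w u v] Z_def
        by (rule arg_cong[of _ _ Sum_any]) (auto simp: e_def algebra_simps)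
      also have "\<dots> = (\<Sum>i<Suc (n - m). mscale W ((-1) ^ i * (of_int e - of_nat m gchoose i)) (Z (m + i)))"
        by (rule Sum_any_eq_lessThan) (use that Z0 in auto)
      finally show ?thesis by (simp add: lessThan_Suc_atMost)
    qed
    have d: "diamond_entry k n l u v =
        (\<Sum>m=0..n. vscale V (of_int e gchoose m) (vres (int l + a) (e - int m) u v))"
    proof (cases "u = 0")
      case True
      then show ?thesis by (simp add: diamond_entry_eq)
    next
      case False
      then have "{r. component (vgrade V) r u \<noteq> 0} = {a}" by (auto simp: component_homogeneous[OF u])
      then show ?thesis
        by (simp add: diamond_entry_eq component_homogeneous[OF u] e_def algebra_simps)
    qed
    have "?L u v = (\<Sum>m=0..n. \<Sum>i\<le>n - m.
        mscale W ((of_int e gchoose m) * ((-1) ^ i * (of_int e - of_nat m gchoose i))) (Z (m + i)))"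
      unfolding d by (simp add: theta_entry_sum_left theta_entry_scale_left wC entry ms.scale_sum_right)
    also have "\<dots> = (\<Sum>(m, i)\<in>{(m, i). m + i < Suc n}.
        mscale W ((of_int e gchoose m) * ((-1) ^ i * (of_int e - of_nat m gchoose i))) (Z (m + i)))"
      by (subst sum.Sigma) (auto intro!: sum.cong)
    also have "\<dots> = (\<Sum>j<Suc n. \<Sum>m\<le>j.
        mscale W ((of_int e gchoose m) * ((-1) ^ (j - m) * (of_int e - of_nat m gchoose (j - m)))) (Z j))"
      by (subst sum.triangle_reindex) simp
    also have "\<dots> = (\<Sum>j<Suc n. if j = 0 then Z 0 else 0)"
    proof (rule sum.cong[OF refl])
      fix j
      have "(\<Sum>m\<le>j. (of_int e gchoose m) * ((-1) ^ (j - m) * (of_int e - of_nat m gchoose (j - m)))) =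
          (\<Sum>m\<le>j. (of_int e gchoose j) * (- 1) ^ j * ((- 1) ^ m * of_nat (j choose m)) :: complex)"
      proof (rule sum.cong[OF refl])
        fix m assume "m \<in> {..j}"
        then have m: "m \<le> j" by simp
        have "(- 1 :: complex) ^ (j - m) = (- 1) ^ j * (- 1) ^ m"
        proof -
          have "(- 1 :: complex) ^ j = (- 1) ^ (j - m) * (- 1) ^ m" using m by (simp flip: power_add)
          then show ?thesis by (simp add: mult.assoc flip: power_mult_distrib)
        qed
        then show "(of_int e gchoose m) * ((-1) ^ (j - m) * (of_int e - of_nat m gchoose (j - m))) =
            (of_int e gchoose j) * (- 1) ^ j * ((- 1) ^ m * of_nat (j choose m) :: complex)"
          using gbinomial_trinomial_revision[OF m, of "of_int e :: complex"]
          by (simp add: binomial_gbinomial mult_ac)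
      qed
      also have "\<dots> = (of_int e gchoose j) * (- 1) ^ j * (\<Sum>m\<le>j. (- 1) ^ m * of_nat (j choose m))"
        by (rule sum_distrib_left[symmetric])
      also have "\<dots> = (if j = 0 then 1 else 0)"
        by (simp add: choose_alternating_sum)
      finally show "(\<Sum>m\<le>j. mscale W ((of_int e gchoose m) *
          ((-1) ^ (j - m) * (of_int e - of_nat m gchoose (j - m)))) (Z j)) = (if j = 0 then Z 0 else 0)"
        unfolding ms.scale_sum_left[symmetric] by simp
    qed
    also have "\<dots> = Z 0" by simp
    also have "\<dots> = ?R u v"
      by (simp add: Z_def theta_entry_homogeneous[OF wC v]
          theta_entry_homogeneous[OF m_Y_closed[OF wC] u])
    finally show ?thesis .
  qed
  have add_u: "diamond_entry k n l (u + u') v = diamond_entry k n l u v + diamond_entry k n l u' v" for u u' v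
  proof -
    let ?f = "\<lambda>r w. \<Sum>m=0..n. vscale V (of_int (- int k + int n - int l - 1) gchoose m)
      (vres (int l + r) (- int k + int n - int l - int m - 1) w v)"
    have sup: "diamond_entry k n l u v = (\<Sum>r\<in>A. ?f r (component (vgrade V) r u))"
      if "finite A" "{r. component (vgrade V) r u \<noteq> 0} \<subseteq> A" for A u
      unfolding diamond_entry_eq by (rule sum.mono_neutral_left[OF that]) simp
    obtain A where A: "finite A" "{a. component (vgrade V) a u \<noteq> 0} \<subseteq> A"
      "{a. component (vgrade V) a u' \<noteq> 0} \<subseteq> A" "{a. component (vgrade V) a (u + u') \<noteq> 0} \<subseteq> A"
      using finite_UnI[OF finite_UnI[OF finite_components finite_components] finite_components] by blast
    show ?thesis
      by (simp add: sup[OF A(1,2)] sup[OF A(1,3)] sup[OF A(1,4)] component_add vres_add_left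
          vs.scale_right_distrib sum.distrib)
  qed
  have add_v: "diamond_entry k n l u (v + v') = diamond_entry k n l u v + diamond_entry k n l u v'" for u v v'
    by (simp add: diamond_entry_eq vres_add_right vs.scale_right_distrib sum.distrib)
  have homu: "?L u v = ?R u v" if u: "u \<in> vgrade V a" for a u
    by (rule homogeneous_induct[of "\<lambda>v. ?L u v = ?R u v" v])
      (simp_all add: hom[OF u] add_v theta_entry_add_left theta_entry_add_right theta_entry_closed wC)
  show ?thesis
    by (rule homogeneous_induct[of "\<lambda>u. ?L u v = ?R u v" u])
      (simp_all add: homu add_u theta_entry_add_left theta_entry_closed wC)
qed


section \<open>The kernel, entry by entry\<close>

lemma in_Gr_class: "x \<in> Gr_class V W n x"
  unfolding Gr_class_def using Omega_0 by force

lemma Gr_class_0: "Gr_class V W n 0 = Omega V W (int n - 1)"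
  by (simp add: Gr_class_def)

theorem theta_kernel_iff:
  "u \<in> theta_kernel V W \<longleftrightarrow> u \<in> carrier (U_inf V) \<and>
    (\<forall>k l. \<forall>w\<in>Omega V W (int l). theta_entry V W k l (u k l) w \<in> Omega V W (int k - 1))"
proof (intro iffI conjI allI ballI)
  assume u: "u \<in> theta_kernel V W"
  then show "u \<in> carrier (U_inf V)" by (simp add: theta_kernel_def)
  fix k l w assume w: "w \<in> Omega V W (int l)"
  show "theta_entry V W k l (u k l) w \<in> Omega V W (int k - 1)"
  \<comment> \<open>For \<open>w\<close> in the lower level the class is zero, the test family has
    empty support and \<open>theta_Gr\<close> says nothing about this entry; there the claim comes
    from the filtration.\<close>
  proof (cases "w \<in> Omega V W (int l - 1)")
    case True
    then show ?thesis by (rule theta_entry_Omega)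
  next
    case False
    let ?z = "\<lambda>n. if n = l then w else 0"
    let ?g = "\<lambda>n. Gr_class V W n (?z n)"
    have supp: "Gr_support V W ?g = {l}"
      using False by (auto simp: Gr_support_def Gr_class_eq Omega_0)
    have "?g \<in> Gr V W"
      unfolding Gr_def using supp w by (auto simp: Gr_component_def Omega_0)
    then have eq: "theta_Gr V W u ?g k = Gr_class V W k 0"
      using u by (simp add: theta_kernel_def)
    have "Gr_class V W k (\<Sum>n\<in>Gr_support V W ?g. theta_entry V W k n (u k n) (?z n)) \<subseteq> theta_Gr V W u ?g k"
      unfolding theta_Gr_def by (rule UN_upper) (simp add: in_Gr_class)
    then show ?thesis
      unfolding eq supp Gr_class_0 using in_Gr_class by auto
  qed
next
  assume u: "u \<in> carrier (U_inf V) \<and>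
    (\<forall>k l. \<forall>w\<in>Omega V W (int l). theta_entry V W k l (u k l) w \<in> Omega V W (int k - 1))"
  have "theta_Gr V W u g k = Gr_class V W k 0" if g: "g \<in> Gr V W" for g k
  proof -
    have g_cl: "\<exists>x\<in>Omega V W (int l). g l = Gr_class V W l x" for l
      using g unfolding Gr_def Gr_component_def by auto
    have rep: "x \<in> Omega V W (int l)" if "x \<in> g l" for x l
      using g_cl[of l] that Omega_mono[of _ "int l - 1" "int l"]
      by (auto simp: Gr_class_def intro!: Omega_add)
    have "Gr_class V W k (\<Sum>l\<in>Gr_support V W g. theta_entry V W k l (u k l) (w l)) = Gr_class V W k 0"
      if "\<forall>l. w l \<in> g l" for w
      using that u rep by (simp add: Gr_class_eq Omega_sum)
    moreover have "\<exists>w. \<forall>l. w l \<in> g l"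
      using g_cl in_Gr_class by metis
    ultimately show ?thesis unfolding theta_Gr_def by auto
  qed
  then show "u \<in> theta_kernel V W"
    using u by (auto simp: theta_kernel_def)
qed

text \<open>With \<open>k = l = 0\<close> and \<open>e = - 2\<close> the modes of \<open>v\<close>
  that act first have index \<open>b + i\<close>; all of them lower the degree and annihilate
  \<open>Omega V W 0\<close>. For \<open>e = - 1\<close> the term \<open>i = 0\<close> would be the
  zero mode.\<close>

lemma theta_zhu_O:
  assumes v: "v \<in> zhu_O V" and w: "w \<in> Omega V W 0"
  shows "theta_entry V W 0 0 v w = 0"
proof -
  note wC = Omega_carrier[OF w]
  have hom: "theta_entry V W 0 0 (vres a (- 2) u v) w = 0"
    if u: "u \<in> vgrade V a" and v: "v \<in> vgrade V b" for a b u v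
  proof -
    have "mY W v (b - (- 2) - 2 - int 0 + int i) w = 0" for i
      by (rule OmegaD[OF w v]) simp
    then show ?thesis
      using theta_entry_vres[of w 0, OF _ u v, of 0 "- 2"] w by simp
  qed
  have "theta_entry V W 0 0 (vres a (- 2) u v) w = 0" if u: "u \<in> vgrade V a" for a u v
    by (rule homogeneous_induct[of "\<lambda>v. theta_entry V W 0 0 (vres a (- 2) u v) w = 0" v])
      (simp_all add: hom[OF u] vres_add_right theta_entry_add_left[OF wC])
  then have gen: "theta_entry V W 0 0 (Res (laurent_times (vscale V) (fls_X powi (- 2))
      (vop_twisted (vscale V) (vgrade V) (vY V) (1 + fls_X) u v))) w = 0" for u v
    unfolding zhu_O_generator theta_entry_sum_left[OF wC]
    by (intro sum.neutral ballI) (simp add: component_in_grade)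
  show ?thesis
    using v unfolding zhu_O_def
  proof (induction rule: vs.span_induct_alt)
    case base
    show ?case by (rule theta_entry_0_left[OF wC])
  next
    case (step c x y)
    then show ?case using gen by (auto simp: theta_entry_add_left[OF wC] theta_entry_scale_left[OF wC])
  qed
qed

end

section \<open>The Zhu algebra acts faithfully\<close>

context grading_restricted_vertex_algebra
begin

text \<open>Induction on the pole order by way of \<open>vLm1 V v\<close>, which has weight
  \<open>a + 1\<close>: integration by parts expresses pole order \<open>m + 2\<close> for it by
  orders \<open>m + 2\<close> and \<open>m + 3\<close> for \<open>v\<close>, and the coefficient
  \<open>m + 2\<close> of the new term can be divided out.\<close>

lemma vres_in_zhu_O:
  "v \<in> vgrade V a \<Longrightarrow> vres a (- 2 - int m) v u \<in> zhu_O V"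
proof (induction m arbitrary: a v)
  case 0
  show ?case
  proof (cases "v = 0")
    case True
    then show ?thesis by (simp add: zhu_O_def vs.span_zero)
  next
    case False
    then have "{r. component (vgrade V) r v \<noteq> 0} = {a}" by (auto simp: component_homogeneous[OF 0])
    then have "vres a (- 2) v u = Res (laurent_times (vscale V) (fls_X powi (- 2))
        (vop_twisted (vscale V) (vgrade V) (vY V) (1 + fls_X) v u))"
      by (simp only: zhu_O_generator component_homogeneous[OF 0]) simp
    then show ?thesis unfolding zhu_O_def by (intro vs.span_base) auto
  qed
next
  case (Suc m)
  have sub: "vs.subspace (zhu_O V)" by (simp add: zhu_O_def)
  let ?R = "\<lambda>r. vres a r v u"
  have "vres (a + 1) (- 2 - int m) (vLm1 V v) u =
      - vscale V (of_int (a + 1)) (?R (- 2 - int m))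
      + vscale V (of_nat (m + 2)) (?R (- 2 - int (Suc m)) + ?R (- 2 - int m))"
  proof -
    have "vres (a + 1) (- 2 - int m - 1) v u = ?R (- 2 - int (Suc m)) + ?R (- 2 - int m)"
      using vres_Suc[of a "- 2 - int (Suc m)" v u] by simp
    moreover have "(of_int (- 2 - int m) :: complex) = - of_nat (m + 2)" by simp
    ultimately show ?thesis
      using vres_Lm1[of "a + 1" "- 2 - int m" v u] by (simp only: vs.scale_minus_left) simp
  qed
  then have "vscale V (of_nat (m + 2)) (?R (- 2 - int (Suc m))) =
      vres (a + 1) (- 2 - int m) (vLm1 V v) u + vscale V (of_int (a + 1)) (?R (- 2 - int m))
      - vscale V (of_nat (m + 2)) (?R (- 2 - int m))"
    by (simp add: vs.scale_right_distrib)
  also have "\<dots> \<in> zhu_O V"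
    by (intro vs.subspace_diff[OF sub] vs.subspace_add[OF sub] vs.subspace_scale[OF sub]
        Suc.IH Lm1_grade Suc.prems)
  finally have "vscale V (1 / of_nat (m + 2)) (vscale V (of_nat (m + 2)) (?R (- 2 - int (Suc m)))) \<in> zhu_O V"
    by (rule vs.subspace_scale[OF sub])
  moreover have "(of_nat (m + 2) :: complex) \<noteq> 0" by (simp only: of_nat_eq_0_iff)
  ultimately show ?case by simp
qed

text \<open>\<open>zhu_O V\<close> accounts for the test functions with \<open>s = a\<close>; larger
  \<open>s\<close> follow by the Pascal recursion. So functionals on the quotient by
  \<open>zhu_O V\<close> become vectors of degree 0.\<close>

lemma functional_in_dual_grade_0:
  assumes F: "functional f" and O: "\<And>v. v \<in> zhu_O V \<Longrightarrow> f v = 0"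
  shows "f \<in> dual_grade 0"
  unfolding dual_grade_def
proof (intro CollectI conjI F allI ballI impI)
  fix a v u s r assume v: "v \<in> vgrade V a" and s: "a + 0 \<le> s" "s + r \<le> a - 2"
  have "s + r \<le> a - 2 \<longrightarrow> f (vres s r v u) = 0" for r
    using s(1)
  proof (induction s arbitrary: r rule: int_ge_induct)
    case base
    show ?case
    proof
      assume "a + 0 + r \<le> a - 2"
      then have "r = - 2 - int (nat (- 2 - r))" by simp
      then show "f (vres (a + 0) r v u) = 0"
        using O[OF vres_in_zhu_O[OF v, of "nat (- 2 - r)" u]] by simp
    qed
  next
    case (step s)
    then show ?case by (simp add: vres_Suc functional_add[OF F])
  qed
  then show "f (vres s r v u) = 0" using s(2) by blast
qed

lemma separating_functional:
  assumes "v \<notin> zhu_O V"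
  obtains f where "functional f" "\<And>x. x \<in> zhu_O V \<Longrightarrow> f x = 0" "f v = 1"
proof -
  interpret c: vector_space "(*) :: complex \<Rightarrow> complex \<Rightarrow> complex"
    by unfold_locales (simp_all add: algebra_simps)
  interpret p: vector_space_pair "vscale V" "(*) :: complex \<Rightarrow> complex \<Rightarrow> complex" ..
  obtain B where B: "B \<subseteq> zhu_O V" "vs.independent B" "zhu_O V \<subseteq> vs.span B"
    by (rule vs.maximal_independent_subset)
  have "vs.span B \<subseteq> zhu_O V"
    by (rule vs.span_minimal[OF B(1)]) (simp add: zhu_O_def)
  then have "v \<notin> vs.span B" using assms by blast
  then have "vs.independent (insert v B)" "v \<notin> B"
    using B(2) vs.span_base by (auto simp: vs.independent_insert)
  then obtain f where f: "Vector_Spaces.linear (vscale V) (*) f"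
    "\<forall>x\<in>insert v B. f x = (if x = v then 1 else 0)"
    using p.linear_independent_extend[of "insert v B" "\<lambda>x. if x = v then 1 else 0"] by blast
  interpret f: Vector_Spaces.linear "vscale V" "(*)" f by (rule f(1))
  show ?thesis
  proof (rule that)
    show "functional f" by (simp add: functional_def f.add f.scale)
    show "f v = 1" using f(2) by simp
    fix x assume "x \<in> zhu_O V"
    then have "x \<in> vs.span B" using B(3) by blast
    then show "f x = 0"
      by (rule p.linear_eq_0_on_span[OF f(1), rotated]) (use f(2) \<open>v \<notin> B\<close> in auto)
  qed
qed

text \<open>
  Evaluating \<open>o(v) f\<close> at the vacuum gives \<open>f(v)\<close>, because \<open>Y(v, x) \<one>\<close> has constant term \<open>v\<close>
  and no negative powers of \<open>x\<close>.
\<close>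

lemma dual_module_separates:
  assumes "v \<notin> zhu_O V"
  obtains w where "w \<in> Omega V dual_module 0" "theta_entry V dual_module 0 0 v w \<noteq> 0"
proof -
  interpret D: lower_bounded_generalized_module V dual_module by (rule dual_module)
  obtain f where F: "functional f" and O: "\<And>x. x \<in> zhu_O V \<Longrightarrow> f x = 0" and fv: "f v = 1"
    using separating_functional[OF assms] by blast
  have f: "f \<in> dual_grade 0" by (rule functional_in_dual_grade_0[OF F O])
  define w where "w = (\<lambda>n::int. if n = 0 then f else (\<lambda>_. 0))"
  have "finite {n. w n \<noteq> 0}"
    by (rule finite_subset[of _ "{0}"]) (auto simp: w_def zero_fun_def)
  then have w: "w \<in> dC" using f by (auto simp: dC_iff w_def dual_grade_0)
  have "w \<in> Omega V dual_module 0"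
  proof (rule D.OmegaI[OF w order_refl], intro ext)
    fix r v k m u assume v: "v \<in> vgrade V r" and k: "r - k - 1 < - (0::int)"
    have "dual_modes r (m - r + k + 1) v (w (m - r + k + 1)) u k = 0"
    proof (cases "m - r + k + 1 = 0")
      case True
      show ?thesis unfolding True by (rule dual_modes_vanish) (use k in simp)
    next
      case False
      then have "w (m - r + k + 1) = (\<lambda>_. 0)" by (simp only: w_def if_False)
      then show ?thesis by (simp only: dual_modes_zero_functional)
    qed
    then show "dY v k w m u = 0 m u" by (simp add: dY_homogeneous[OF w v])
  qed
  moreover have "theta_entry V dual_module 0 0 x w 0 (vac V) = f x" for x
  proof (rule homogeneous_induct[of "\<lambda>x. theta_entry V dual_module 0 0 x w 0 (vac V) = f x" x])
    fix a x assume x: "x \<in> vgrade V a"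
    have "theta_entry V dual_module 0 0 x w 0 (vac V) = dual_modes a 0 x f (vac V) (a - 1)"
      unfolding D.theta_entry_homogeneous[OF w x] dY_homogeneous[OF w x] by (simp add: w_def)
    \<comment> \<open>The zero mode of \<open>x\<close> sits at the top index \<open>a - 1\<close>,
      where \<open>alt_shift 1\<close> only changes the sign; this cancels the sign in
      \<open>dual_modes\<close>.\<close>
    also have "\<dots> = f x"
      unfolding dual_modes_def by (subst alt_shift_top) (simp_all add: vres_vac_right)
    finally show "theta_entry V dual_module 0 0 x w 0 (vac V) = f x" .
  next
    fix x y assume "theta_entry V dual_module 0 0 x w 0 (vac V) = f x"
      "theta_entry V dual_module 0 0 y w 0 (vac V) = f y"
    then show "theta_entry V dual_module 0 0 (x + y) w 0 (vac V) = f (x + y)"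
      by (simp add: D.theta_entry_add_left[OF w] functional_add[OF F])
  qed
  then have "theta_entry V dual_module 0 0 v w \<noteq> 0" using fv by (metis zero_fun_apply zero_neq_one)
  ultimately show ?thesis by (rule that)
qed

lemma Q_inf_iff:
  "u \<in> Q_inf V \<longleftrightarrow> u \<in> carrier (U_inf V) \<and> (\<forall>W :: ('v, complex poly) vmodule.
    lower_bounded_generalized_module V W \<longrightarrow>
    (\<forall>k l. \<forall>w\<in>Omega V W (int l). theta_entry V W k l (u k l) w \<in> Omega V W (int k - 1)))"
  by (auto simp: Q_inf_def lower_bounded_generalized_module.theta_kernel_iff)

text \<open>In row 0 the quotient is by \<open>Omega V W (- 1) = {0}\<close>, so lying in the lower
  level means vanishing.\<close>

lemma elementary_matrix_00_in_Q_inf: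
  "elementary_matrix v 0 0 \<in> Q_inf V \<longleftrightarrow> (\<forall>W :: ('v, complex poly) vmodule.
    lower_bounded_generalized_module V W \<longrightarrow> (\<forall>w\<in>Omega V W 0. theta_entry V W 0 0 v w = 0))" (is "_ \<longleftrightarrow> ?R")
proof
  assume "elementary_matrix v 0 0 \<in> Q_inf V"
  then have Q: "\<forall>w\<in>Omega V W (int 0). theta_entry V W 0 0 (elementary_matrix v 0 0 0 0) w \<in> Omega V W (int 0 - 1)"
    if "lower_bounded_generalized_module V W" for W :: "('v, complex poly) vmodule"
    using that unfolding Q_inf_iff by blast
  then show ?R
    by (auto simp: elementary_matrix_def Omega_def)
next
  assume R: ?R
  have "elementary_matrix v 0 0 \<in> carrier (U_inf V)"
    by (auto simp: U_inf_def elementary_matrix_def)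
  moreover have "theta_entry V W k l (elementary_matrix v 0 0 k l) w \<in> Omega V W (int k - 1)"
    if W: "lower_bounded_generalized_module V W" and w: "w \<in> Omega V W (int l)"
    for W :: "('v, complex poly) vmodule" and k l w
  proof -
    interpret W: lower_bounded_generalized_module V W by (rule W)
    show ?thesis
      using R W w W.theta_entry_0_left[OF W.Omega_carrier[OF w]]
      by (cases "k = 0 \<and> l = 0") (auto simp: elementary_matrix_def W.Omega_0)
  qed
  ultimately show "elementary_matrix v 0 0 \<in> Q_inf V" unfolding Q_inf_iff by blast
qed

text \<open>\<open>dual_module\<close> lives on another type than the modules in
  \<open>Q_inf\<close>; \<open>Q_inf_subset_theta_kernel\<close> admits it as a test module.\<close>

theorem elementary_matrix_00_in_Q_inf_iff_zhu_O:
  "elementary_matrix v 0 0 \<in> Q_inf V \<longleftrightarrow> v \<in> zhu_O V"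
proof
  assume Q: "elementary_matrix v 0 0 \<in> Q_inf V"
  show "v \<in> zhu_O V"
  proof (rule ccontr)
    assume "v \<notin> zhu_O V"
    then obtain w where w: "w \<in> Omega V dual_module 0" "theta_entry V dual_module 0 0 v w \<noteq> 0"
      by (rule dual_module_separates)
    have "elementary_matrix v 0 0 \<in> theta_kernel V dual_module"
      using Q_inf_subset_theta_kernel[OF dual_module] Q by blast
    then have "theta_entry V dual_module 0 0 (elementary_matrix v 0 0 0 0) w \<in> Omega V dual_module (int 0 - 1)"
      using w(1) unfolding lower_bounded_generalized_module.theta_kernel_iff[OF dual_module]
      by (metis of_nat_0)
    then show False using w(2) by (simp add: elementary_matrix_def Omega_def)
  qed
next
  assume "v \<in> zhu_O V"
  then show "elementary_matrix v 0 0 \<in> Q_inf V"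
    unfolding elementary_matrix_00_in_Q_inf
    using lower_bounded_generalized_module.theta_zhu_O by blast
qed

end

section \<open>Cosets\<close>

text \<open>Collects the linear part of passing to cosets. Compatibility with products is a premise
  of \<open>quotient_mult\<close>, to be supplied for each pair of classes.\<close>

locale linear_quotient =
  fixes A :: "(complex, 'a::ab_group_add) module" and I :: "'a set"
  assumes add_eq: "add A = (+)" and zero_eq: "zero A = 0"
    and carrier_0: "0 \<in> carrier A"
    and carrier_add: "x \<in> carrier A \<Longrightarrow> y \<in> carrier A \<Longrightarrow> x + y \<in> carrier A"
    and I_0: "0 \<in> I" and I_add: "x \<in> I \<Longrightarrow> y \<in> I \<Longrightarrow> x + y \<in> I" and I_minus: "x \<in> I \<Longrightarrow> - x \<in> I"
    and smult_diff: "module.smult A c (x - y) = module.smult A c x - module.smult A c y"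
    and smult_I: "x \<in> I \<Longrightarrow> module.smult A c x \<in> I"
begin

definition cl where "cl x = I +>\<^bsub>A\<^esub> x"

lemma cl_eq_image: "cl x = (\<lambda>i. i + x) ` I"
  by (auto simp: cl_def a_r_coset_def' add_eq)

lemma in_cl: "y \<in> cl x \<longleftrightarrow> y - x \<in> I"
  unfolding cl_eq_image by (force intro: image_eqI[of _ _ "y - x"])

lemma in_cl_self: "x \<in> cl x"
  by (simp add: in_cl I_0)

lemma I_diff: "x \<in> I \<Longrightarrow> y \<in> I \<Longrightarrow> x - y \<in> I"
  using I_add[OF _ I_minus, of x y] by simp

lemma cl_eq_iff: "cl x = cl y \<longleftrightarrow> x - y \<in> I"
proof
  assume "cl x = cl y"
  then show "x - y \<in> I" using in_cl[of x y] in_cl_self[of x] by simp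
next
  assume xy: "x - y \<in> I"
  have "z - x \<in> I \<longleftrightarrow> z - y \<in> I" for z
    using I_add[OF _ xy, of "z - x"] I_diff[OF _ xy, of "z - y"] by auto
  then show "cl x = cl y" by (auto simp: in_cl)
qed

lemma cl_0: "cl 0 = I"
  by (simp add: cl_eq_image)

lemma UN_const_cl:
  "X \<noteq> {} \<Longrightarrow> (\<And>x. x \<in> X \<Longrightarrow> cl (f x) = Y) \<Longrightarrow> (\<Union>x\<in>X. cl (f x)) = Y"
  by auto

lemma quotient_carrier: "carrier (quotient_algebra A I) = cl ` carrier A"
  by (auto simp: quotient_algebra_def FactRing_def A_RCOSETS_def' cl_def)

lemma quotient_zero: "zero (quotient_algebra A I) = cl 0"
  by (simp add: quotient_algebra_def FactRing_def cl_0)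

lemma quotient_one: "one (quotient_algebra A I) = cl (one A)"
  by (simp add: quotient_algebra_def FactRing_def cl_def)

lemma quotient_add: "add (quotient_algebra A I) (cl x) (cl y) = cl (x + y)"
proof -
  have "add (quotient_algebra A I) (cl x) (cl y) = (\<Union>h\<in>cl x. \<Union>k\<in>cl y. {h + k})"
    by (simp add: quotient_algebra_def FactRing_def set_add_def' add_eq)
  also have "\<dots> = cl (x + y)"
  proof (intro equalityI subsetI)
    fix z assume "z \<in> (\<Union>h\<in>cl x. \<Union>k\<in>cl y. {h + k})"
    then obtain h k where hk: "h - x \<in> I" "k - y \<in> I" "z = h + k" by (auto simp: in_cl)
    show "z \<in> cl (x + y)"
      using I_add[OF hk(1,2)] by (simp add: in_cl hk(3) algebra_simps)
  next
    fix z assume z: "z \<in> cl (x + y)"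
    then have "z - y \<in> cl x" by (simp add: in_cl algebra_simps)
    then show "z \<in> (\<Union>h\<in>cl x. \<Union>k\<in>cl y. {h + k})"
      using in_cl_self[of y] by force
  qed
  finally show ?thesis .
qed

lemma quotient_smult: "module.smult (quotient_algebra A I) c (cl x) = cl (module.smult A c x)"
proof -
  have "module.smult (quotient_algebra A I) c (cl x) = (\<Union>y\<in>cl x. cl (module.smult A c y))"
    by (simp add: quotient_algebra_def cl_def)
  also have "\<dots> = cl (module.smult A c x)"
  proof (rule UN_const_cl)
    show "cl x \<noteq> {}" using in_cl_self[of x] by blast
    show "cl (module.smult A c y) = cl (module.smult A c x)" if "y \<in> cl x" for y
      using that by (simp add: cl_eq_iff in_cl smult_I flip: smult_diff)
  qed
  finally show ?thesis .
qed

lemma quotient_mult: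
  assumes "\<And>a b. a \<in> cl x \<Longrightarrow> b \<in> cl y \<Longrightarrow> monoid.mult A a b - z \<in> I"
  shows "monoid.mult (quotient_algebra A I) (cl x) (cl y) = cl z"
proof -
  have "monoid.mult (quotient_algebra A I) (cl x) (cl y) = (\<Union>a\<in>cl x. \<Union>b\<in>cl y. cl (monoid.mult A a b))"
    by (simp add: quotient_algebra_def FactRing_def rcoset_mult_def cl_def)
  also have "\<dots> = (\<Union>a\<in>cl x. \<Union>b\<in>cl y. cl z)"
    by (intro SUP_cong refl) (simp add: cl_eq_iff assms)
  also have "\<dots> = cl z"
    using in_cl_self[of x] in_cl_self[of y] by blast
  finally show ?thesis .
qed

lemma quotient_subgroup:
  assumes S: "S \<subseteq> carrier A" "0 \<in> S" "\<And>x y. x \<in> S \<Longrightarrow> y \<in> S \<Longrightarrow> x + y \<in> S" "\<And>x. x \<in> S \<Longrightarrow> - x \<in> S"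
  shows "subgroup (cl ` S) (add_monoid (quotient_algebra A I))"
proof
  show "cl ` S \<subseteq> carrier (add_monoid (quotient_algebra A I))"
    using S(1) by (auto simp: quotient_carrier)
  show "\<one>\<^bsub>add_monoid (quotient_algebra A I)\<^esub> \<in> cl ` S"
    using S(2) by (simp add: quotient_zero)
  show "x \<otimes>\<^bsub>add_monoid (quotient_algebra A I)\<^esub> y \<in> cl ` S" if "x \<in> cl ` S" "y \<in> cl ` S" for x y
    using that S(3) by (auto simp: quotient_add)
  show "inv\<^bsub>add_monoid (quotient_algebra A I)\<^esub> x \<in> cl ` S" if "x \<in> cl ` S" for x
  proof -
    obtain z where z: "z \<in> S" "x = cl z" using \<open>x \<in> cl ` S\<close> by blast
    have "inv\<^bsub>add_monoid (quotient_algebra A I)\<^esub> x = cl (- z)"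
      unfolding m_inv_def
    proof (rule the_equality)
      show "cl (- z) \<in> carrier (add_monoid (quotient_algebra A I)) \<and>
          x \<otimes>\<^bsub>add_monoid (quotient_algebra A I)\<^esub> cl (- z) = \<one>\<^bsub>add_monoid (quotient_algebra A I)\<^esub> \<and>
          cl (- z) \<otimes>\<^bsub>add_monoid (quotient_algebra A I)\<^esub> x = \<one>\<^bsub>add_monoid (quotient_algebra A I)\<^esub>"
      proof -
        have "- z \<in> carrier A" using S(1,4) z(1) by blast
        then show ?thesis by (simp add: quotient_add quotient_zero quotient_carrier z(2))
      qed
      fix y assume y: "y \<in> carrier (add_monoid (quotient_algebra A I)) \<and>
          x \<otimes>\<^bsub>add_monoid (quotient_algebra A I)\<^esub> y = \<one>\<^bsub>add_monoid (quotient_algebra A I)\<^esub> \<and>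
          y \<otimes>\<^bsub>add_monoid (quotient_algebra A I)\<^esub> x = \<one>\<^bsub>add_monoid (quotient_algebra A I)\<^esub>"
      then obtain t where "y = cl t" by (auto simp: quotient_carrier)
      then show "y = cl (- z)"
        using y by (simp add: z(2) quotient_add quotient_zero cl_eq_iff add.commute)
    qed
    then show ?thesis using S(4) z(1) by simp
  qed
qed

end

section \<open>Algebra axioms checked on representatives\<close>

text \<open>The laws of \<open>m\<close> are required after applying \<open>c\<close> only, since a
  product on representatives need not be associative or unital itself.\<close>

lemma unital_associative_algebraI:
  fixes B :: "(complex, 'b) module" and s :: "complex \<Rightarrow> 'v::ab_group_add \<Rightarrow> 'v"
  assumes s: "vector_space s"
    and carrier: "carrier B = range c"
    and mult: "\<And>x y. monoid.mult B (c x) (c y) = c (m x y)"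
    and add: "\<And>x y. add B (c x) (c y) = c (x + y)"
    and smult: "\<And>a x. module.smult B a (c x) = c (s a x)"
    and zero: "zero B = c 0" and one: "one B = c e"
    and assoc: "\<And>x y z. c (m (m x y) z) = c (m x (m y z))"
    and unit: "\<And>x. c (m e x) = c x" "\<And>x. c (m x e) = c x"
    and distrib: "\<And>x y z. c (m (x + y) z) = c (m x z + m y z)" "\<And>x y z. c (m z (x + y)) = c (m z x + m z y)"
    and scale: "\<And>a x y. c (m (s a x) y) = c (s a (m x y))" "\<And>a x y. c (m x (s a y)) = c (s a (m x y))"
  shows "unital_associative_algebra B"
proof -
  interpret s: vector_space s by fact
  have field: "Ring.cring complex_ring"
    by (rule cringI, rule abelian_groupI)
      (auto simp: complex_ring_def comm_monoid_def comm_monoid_axioms_def monoid_def algebra_simps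
        intro: exI[of _ "- x" for x])
  have B: "abelian_group B"
  proof (rule abelian_groupI)
    fix x assume "x \<in> carrier B"
    then obtain v where "x = c v" by (auto simp: carrier)
    then show "\<exists>y\<in>carrier B. y \<oplus>\<^bsub>B\<^esub> x = \<zero>\<^bsub>B\<^esub>"
      by (intro bexI[of _ "c (- v)"]) (simp_all add: carrier add zero)
  qed (auto simp: carrier add zero algebra_simps)
  have "Ring.ring B"
    by (rule ringI[OF B]) (auto simp: carrier mult add one assoc unit distrib monoid_def)
  moreover have "Module.module complex_ring B"
    by (rule Module.module.intro[OF field B], rule module_axioms.intro)
      (auto simp: complex_ring_def carrier add smult s.scale_left_distrib s.scale_right_distrib)
  moreover have "unital_associative_algebra_axioms B"
    by (rule unital_associative_algebra_axioms.intro) (auto simp: carrier mult smult scale)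
  ultimately show ?thesis by (rule unital_associative_algebra.intro)
qed

section \<open>The subalgebra\<close>

context grading_restricted_vertex_algebra
begin

lemma U_inf_simps:
  "carrier (U_inf V) = {u. \<forall>l. finite {k. u k l \<noteq> 0}}"
  "monoid.mult (U_inf V) = diamond V"
  "zero (U_inf V) = 0"
  "add (U_inf V) = (+)"
  "module.smult (U_inf V) c u k l = vscale V c (u k l)"
  by (simp_all add: U_inf_def fun_eq_iff)

lemma U_inf_add:
  "u \<in> carrier (U_inf V) \<Longrightarrow> u' \<in> carrier (U_inf V) \<Longrightarrow> u + u' \<in> carrier (U_inf V)"
proof -
  assume u: "u \<in> carrier (U_inf V)" "u' \<in> carrier (U_inf V)"
  have "finite {k. u k l + u' k l \<noteq> 0}" for l
  proof (rule finite_subset)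
    show "{k. u k l + u' k l \<noteq> 0} \<subseteq> {k. u k l \<noteq> 0} \<union> {k. u' k l \<noteq> 0}" by auto
    show "finite ({k. u k l \<noteq> 0} \<union> {k. u' k l \<noteq> 0})" using u by (simp add: U_inf_simps)
  qed
  then show "u + u' \<in> carrier (U_inf V)" by (simp add: U_inf_simps)
qed

lemma U_inf_minus: "u \<in> carrier (U_inf V) \<Longrightarrow> - u \<in> carrier (U_inf V)"
  by (simp add: U_inf_simps)

lemma Q_inf_carrier: "u \<in> Q_inf V \<Longrightarrow> u \<in> carrier (U_inf V)"
  by (simp add: Q_inf_iff)

lemma Q_inf_D:
  assumes "u \<in> Q_inf V" "lower_bounded_generalized_module V W" "w \<in> Omega V W (int l)"
  shows "theta_entry V W k l (u k l) w \<in> Omega V W (int k - 1)"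
proof -
  have "u \<in> theta_kernel V W" using Q_inf_subset_theta_kernel[OF assms(2)] assms(1) by (rule subsetD)
  then have *: "\<forall>k l. \<forall>w\<in>Omega V W (int l). theta_entry V W k l (u k l) w \<in> Omega V W (int k - 1)"
    unfolding lower_bounded_generalized_module.theta_kernel_iff[OF assms(2)] by (rule conjunct2)
  show ?thesis by (rule *[rule_format, OF assms(3)])
qed

lemma Q_inf_I:
  assumes "u \<in> carrier (U_inf V)"
    "\<And>(W :: ('v, complex poly) vmodule) k l w. lower_bounded_generalized_module V W \<Longrightarrow>
      w \<in> Omega V W (int l) \<Longrightarrow> theta_entry V W k l (u k l) w \<in> Omega V W (int k - 1)"
  shows "u \<in> Q_inf V"
  unfolding Q_inf_iff by (intro conjI assms(1) allI impI ballI assms(2))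

lemma Q_inf_0: "0 \<in> Q_inf V"
proof (rule Q_inf_I)
  fix W :: "('v, complex poly) vmodule" and k l w
  assume "lower_bounded_generalized_module V W" and w: "w \<in> Omega V W (int l)"
  then interpret W: lower_bounded_generalized_module V W by simp
  show "theta_entry V W k l (0 k l) w \<in> Omega V W (int k - 1)"
    by (simp add: W.theta_entry_0_left[OF W.Omega_carrier[OF w]] W.Omega_0)
qed (simp add: U_inf_simps)

lemma Q_inf_add:
  assumes u: "u \<in> Q_inf V" "u' \<in> Q_inf V"
  shows "u + u' \<in> Q_inf V"
proof (rule Q_inf_I)
  fix W :: "('v, complex poly) vmodule" and k l w
  assume W: "lower_bounded_generalized_module V W" and w: "w \<in> Omega V W (int l)"
  interpret W: lower_bounded_generalized_module V W by (rule W)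
  show "theta_entry V W k l ((u + u') k l) w \<in> Omega V W (int k - 1)"
    using Q_inf_D[OF u(1) W w] Q_inf_D[OF u(2) W w]
    by (simp add: W.theta_entry_add_left[OF W.Omega_carrier[OF w]] W.Omega_add)
qed (simp add: U_inf_add Q_inf_carrier u)

lemma Q_inf_minus:
  assumes u: "u \<in> Q_inf V"
  shows "- u \<in> Q_inf V"
proof (rule Q_inf_I)
  fix W :: "('v, complex poly) vmodule" and k l w
  assume W: "lower_bounded_generalized_module V W" and w: "w \<in> Omega V W (int l)"
  interpret W: lower_bounded_generalized_module V W by (rule W)
  show "theta_entry V W k l ((- u) k l) w \<in> Omega V W (int k - 1)"
    using Q_inf_D[OF u W w]
    by (simp add: W.theta_entry_minus_left[OF W.Omega_carrier[OF w]] W.Omega_minus)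
qed (simp add: U_inf_minus Q_inf_carrier u)

lemma Q_inf_smult:
  assumes u: "u \<in> Q_inf V"
  shows "module.smult (U_inf V) c u \<in> Q_inf V"
proof (rule Q_inf_I)
  have "finite {k. vscale V c (u k l) \<noteq> 0}" for l
  proof (rule finite_subset)
    show "{k. vscale V c (u k l) \<noteq> 0} \<subseteq> {k. u k l \<noteq> 0}" by auto
    show "finite {k. u k l \<noteq> 0}" using Q_inf_carrier[OF u] by (simp add: U_inf_simps)
  qed
  then show "module.smult (U_inf V) c u \<in> carrier (U_inf V)" by (simp add: U_inf_simps)
  fix W :: "('v, complex poly) vmodule" and k l w
  assume W: "lower_bounded_generalized_module V W" and w: "w \<in> Omega V W (int l)"
  interpret W: lower_bounded_generalized_module V W by (rule W)
  show "theta_entry V W k l (module.smult (U_inf V) c u k l) w \<in> Omega V W (int k - 1)"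
    using Q_inf_D[OF u W w]
    by (simp add: U_inf_simps W.theta_entry_scale_left[OF W.Omega_carrier[OF w]] W.Omega_scale)
qed

sublocale UQ: linear_quotient "U_inf V" "Q_inf V"
  by unfold_locales
    (simp_all add: U_inf_simps(3,4) U_inf_add Q_inf_carrier Q_inf_0 Q_inf_add Q_inf_minus Q_inf_smult
      fun_eq_iff U_inf_simps(5) vs.scale_right_diff_distrib)

abbreviation e00 :: "'v \<Rightarrow> nat \<Rightarrow> nat \<Rightarrow> 'v"
  where "e00 v \<equiv> elementary_matrix v 0 0"

lemma e00_add: "e00 (u + v) = e00 u + e00 v"
  and e00_diff: "e00 (u - v) = e00 u - e00 v"
  and e00_minus: "e00 (- v) = - e00 v"
  and e00_0: "e00 0 = 0"
  and e00_scale: "e00 (vscale V c v) = module.smult (U_inf V) c (e00 v)"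
  by (simp_all add: elementary_matrix_def fun_eq_iff U_inf_simps)

lemma e00_carrier: "e00 v \<in> carrier (U_inf V)"
  by (auto simp: U_inf_simps elementary_matrix_def)

lemma class00_eq: "class00 V v = UQ.cl (e00 v)"
  by (simp add: class00_def UQ.cl_def)

lemma class00_eq_iff: "class00 V u = class00 V v \<longleftrightarrow> u - v \<in> zhu_O V"
  by (simp add: class00_eq UQ.cl_eq_iff elementary_matrix_00_in_Q_inf_iff_zhu_O flip: e00_diff)

lemma diamond_carrier:
  assumes a: "a \<in> carrier (U_inf V)" and b: "b \<in> carrier (U_inf V)"
  shows "diamond V a b \<in> carrier (U_inf V)"
proof -
  have 0: "diamond_entry k n l 0 v = 0" for k n l v by (simp add: diamond_entry_eq)
  have "{k. diamond V a b k l \<noteq> 0} \<subseteq> (\<Union>n\<in>{n. b n l \<noteq> 0}. {k. a k n \<noteq> 0})" for l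
  proof
    fix k assume "k \<in> {k. diamond V a b k l \<noteq> 0}"
    then have "(\<Sum>n | b n l \<noteq> 0. diamond_entry k n l (a k n) (b n l)) \<noteq> 0" by (simp add: diamond_eq)
    then obtain n where "n \<in> {n. b n l \<noteq> 0}" "diamond_entry k n l (a k n) (b n l) \<noteq> 0"
      by (meson sum.neutral)
    then show "k \<in> (\<Union>n\<in>{n. b n l \<noteq> 0}. {k. a k n \<noteq> 0})" using 0 by auto
  qed
  moreover have "finite (\<Union>n\<in>{n. b n l \<noteq> 0}. {k. a k n \<noteq> 0})" for l
    using a b by (auto simp: U_inf_simps)
  ultimately have "finite {k. diamond V a b k l \<noteq> 0}" for l by (rule finite_subset)
  then show ?thesis by (simp add: U_inf_simps)
qed

lemma theta_zhu_mult:
  assumes "lower_bounded_generalized_module V W" "w \<in> Omega V W 0"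
  shows "theta_entry V W 0 0 (zhu_mult V u v) w = theta_entry V W 0 0 u (theta_entry V W 0 0 v w)"
  using lower_bounded_generalized_module.theta_entry_diamond[OF assms(1), of w 0 0 0 u v] assms(2)
  by (simp add: diamond_entry_zhu)

text \<open>The representatives \<open>a\<close> and \<open>b\<close> are arbitrary matrices of the
  two cosets, so the products are compared through their actions. Replacing \<open>a\<close> by
  \<open>e00 u\<close> costs an element of \<open>Omega V W (int k - 1)\<close>. Then only the
  component \<open>z 0\<close> of \<open>b\<close> applied to \<open>w\<close> matters, and it
  agrees exactly with that of \<open>e00 v\<close> because \<open>Omega V W (- 1)\<close> is
  zero.\<close>

lemma class00_mult:
  "monoid.mult (A_inf V) (class00 V u) (class00 V v) = class00 V (zhu_mult V u v)"
  unfolding class00_eq A_inf_def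
proof (rule UQ.quotient_mult)
  fix a b assume a: "a \<in> UQ.cl (e00 u)" and b: "b \<in> UQ.cl (e00 v)"
  then have qa: "a - e00 u \<in> Q_inf V" and qb: "b - e00 v \<in> Q_inf V" by (simp_all add: UQ.in_cl)
  have aC: "a \<in> carrier (U_inf V)" and bC: "b \<in> carrier (U_inf V)"
    using U_inf_add[OF Q_inf_carrier[OF qa] e00_carrier[of u]]
      U_inf_add[OF Q_inf_carrier[OF qb] e00_carrier[of v]] by simp_all
  have "diamond V a b - e00 (zhu_mult V u v) \<in> Q_inf V"
  proof (rule Q_inf_I)
    show "diamond V a b - e00 (zhu_mult V u v) \<in> carrier (U_inf V)"
      using U_inf_add[OF diamond_carrier[OF aC bC] U_inf_minus[OF e00_carrier[of "zhu_mult V u v"]]] by simp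
    fix W :: "('v, complex poly) vmodule" and k l w
    assume W: "lower_bounded_generalized_module V W" and w: "w \<in> Omega V W (int l)"
    interpret W: lower_bounded_generalized_module V W by (rule W)
    note wC = W.Omega_carrier[OF w]
    let ?N = "{n. b n l \<noteq> 0}"
    define z where "z n = theta_entry V W n l (b n l) w" for n
    have z: "z n \<in> Omega V W (int n)" for n
      using W.theta_entry_Omega[of w l 0 n "b n l"] w by (simp add: z_def)
    have za: "theta_entry V W k n (a k n) (z n) - theta_entry V W k n (e00 u k n) (z n) \<in> Omega V W (int k - 1)" for n
    proof -
      have "theta_entry V W k n ((a - e00 u) k n) (z n) \<in> Omega V W (int k - 1)"
        by (rule Q_inf_D[OF qa W z])
      moreover have "theta_entry V W k n ((a - e00 u) k n) (z n) =
          theta_entry V W k n (a k n) (z n) - theta_entry V W k n (e00 u k n) (z n)"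
        using W.theta_entry_add_left[OF W.Omega_carrier[OF z[of n]], of k n "a k n" "- e00 u k n"]
        by (simp add: W.theta_entry_minus_left[OF W.Omega_carrier[OF z]])
      ultimately show ?thesis by simp
    qed
    have zb: "z 0 = theta_entry V W 0 l (e00 v 0 l) w"
    proof -
      have "theta_entry V W 0 l ((b - e00 v) 0 l) w \<in> Omega V W (int 0 - 1)"
        by (rule Q_inf_D[OF qb W w])
      moreover have "theta_entry V W 0 l ((b - e00 v) 0 l) w = z 0 - theta_entry V W 0 l (e00 v 0 l) w"
        using W.theta_entry_add_left[OF wC, of 0 l "b 0 l" "- e00 v 0 l"]
        by (simp add: W.theta_entry_minus_left[OF wC] z_def)
      ultimately show ?thesis by (simp add: Omega_def)
    qed
    have fin: "finite ?N" using bC by (simp add: U_inf_simps)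
    have "theta_entry V W k l (diamond V a b k l) w = (\<Sum>n\<in>?N. theta_entry V W k n (a k n) (z n))"
      unfolding diamond_eq W.theta_entry_sum_left[OF wC] W.theta_entry_diamond[OF w] z_def ..
    moreover have "theta_entry V W k l (e00 (zhu_mult V u v) k l) w =
        (\<Sum>n\<in>?N. theta_entry V W k n (e00 u k n) (z n))"
    proof -
      have "(\<Sum>n\<in>?N. theta_entry V W k n (e00 u k n) (z n)) =
          (\<Sum>n\<in>?N. if n = 0 then theta_entry V W k 0 (e00 u k 0) (z 0) else 0)"
        by (rule sum.cong[OF refl])
          (simp add: elementary_matrix_def W.theta_entry_0_left[OF W.Omega_carrier[OF z]])
      \<comment> \<open>The sum runs over the support of column \<open>l\<close> of
        \<open>b\<close>. If 0 is not in it, the term at 0 is itself zero.\<close>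
      also have "\<dots> = theta_entry V W k 0 (e00 u k 0) (z 0)"
      proof (cases "b 0 l = 0")
        case True
        then have "z 0 = 0" by (simp add: z_def W.theta_entry_0_left[OF wC])
        moreover have "theta_entry V W k 0 x 0 = 0" for x
          using W.theta_entry_add_right[of 0 0 k 0 x] by simp
        ultimately show ?thesis using fin True by simp
      next
        case False
        then show ?thesis using fin by simp
      qed
      also have "\<dots> = theta_entry V W k l (e00 (zhu_mult V u v) k l) w"
      proof (cases "l = 0")
        case True
        then have w0: "w \<in> Omega V W 0" using w by simp
        show ?thesis
        proof (cases "k = 0")
          case k: True
          show ?thesis unfolding zb True k
            by (simp add: elementary_matrix_def theta_zhu_mult[OF W w0])
        next
          case False
          then show ?thesis
            by (simp add: elementary_matrix_def W.theta_entry_0_left wC W.Omega_carrier[OF z])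
        qed
      next
        case False
        then have "z 0 = 0" unfolding zb by (simp add: elementary_matrix_def W.theta_entry_0_left[OF wC])
        moreover have "theta_entry V W k 0 x 0 = 0" for x
          using W.theta_entry_add_right[of 0 0 k 0 x] by simp
        ultimately show ?thesis
          using False by (simp add: elementary_matrix_def W.theta_entry_0_left[OF wC])
      qed
      finally show ?thesis ..
    qed
    ultimately have "theta_entry V W k l (diamond V a b k l) w - theta_entry V W k l (e00 (zhu_mult V u v) k l) w
        \<in> Omega V W (int k - 1)"
      by (simp add: W.Omega_sum za flip: sum_subtractf)
    moreover have "theta_entry V W k l ((diamond V a b - e00 (zhu_mult V u v)) k l) w =
        theta_entry V W k l (diamond V a b k l) w - theta_entry V W k l (e00 (zhu_mult V u v) k l) w"
      using W.theta_entry_add_left[OF wC, of k l "diamond V a b k l" "- e00 (zhu_mult V u v) k l"]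
      by (simp add: W.theta_entry_minus_left[OF wC])
    ultimately show "theta_entry V W k l ((diamond V a b - e00 (zhu_mult V u v)) k l) w \<in> Omega V W (int k - 1)"
      by simp
  qed
  then show "a \<otimes>\<^bsub>U_inf V\<^esub> b - e00 (zhu_mult V u v) \<in> Q_inf V" by (simp add: U_inf_simps)
qed

lemma class00_add: "add (A_inf V) (class00 V u) (class00 V v) = class00 V (u + v)"
  unfolding class00_eq A_inf_def UQ.quotient_add e00_add ..

lemma class00_smult: "module.smult (A_inf V) c (class00 V v) = class00 V (vscale V c v)"
  unfolding class00_eq A_inf_def UQ.quotient_smult e00_scale ..

lemma class00_0: "zero (A_inf V) = class00 V 0"
  unfolding class00_eq A_inf_def UQ.quotient_zero e00_0 ..

lemma A00_subalgebra: "nonunital_subalgebra (A00 V) (A_inf V)"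
proof -
  have A00: "A00 V = UQ.cl ` range e00" by (auto simp: A00_def class00_eq)
  have "subgroup (A00 V) (add_monoid (A_inf V))"
    unfolding A00 A_inf_def
  proof (rule UQ.quotient_subgroup)
    show "range e00 \<subseteq> carrier (U_inf V)" using e00_carrier by blast
    show "0 \<in> range e00" using e00_0 by (metis rangeI)
    show "x + y \<in> range e00" if "x \<in> range e00" "y \<in> range e00" for x y
    proof -
      obtain u v where xy: "x = e00 u" "y = e00 v" using \<open>x \<in> range e00\<close> \<open>y \<in> range e00\<close> by blast
      have "x + y = e00 (u + v)" unfolding xy by (rule e00_add[symmetric])
      then show ?thesis by (rule range_eqI)
    qed
    show "- x \<in> range e00" if "x \<in> range e00" for x
    proof -
      obtain u where x: "x = e00 u" using \<open>x \<in> range e00\<close> by blast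
      have "- x = e00 (- u)" unfolding x by (rule e00_minus[symmetric])
      then show ?thesis by (rule range_eqI)
    qed
  qed
  moreover have "submodule_axioms (A00 V) complex_ring (A_inf V)"
    by unfold_locales (auto simp: A00_def class00_smult)
  ultimately show ?thesis
    unfolding nonunital_subalgebra_def submodule_def by (auto simp: A00_def class00_mult)
qed

text \<open>Identities in \<open>A00 V\<close> may be checked as identities of operators on the
  spaces \<open>Omega V W 0\<close>, where by \<open>theta_zhu_mult\<close> the product is
  composition. All algebra laws are obtained in this way.\<close>

lemma class00_eqI:
  assumes "\<And>(W :: ('v, complex poly) vmodule) w. lower_bounded_generalized_module V W \<Longrightarrow>
    w \<in> Omega V W 0 \<Longrightarrow> theta_entry V W 0 0 u w = theta_entry V W 0 0 v w"
  shows "class00 V u = class00 V v"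
proof -
  have "e00 (u - v) \<in> Q_inf V"
    unfolding elementary_matrix_00_in_Q_inf
  proof (intro allI impI ballI)
    fix W :: "('v, complex poly) vmodule" and w
    assume W: "lower_bounded_generalized_module V W" and w: "w \<in> Omega V W 0"
    interpret W: lower_bounded_generalized_module V W by (rule W)
    show "theta_entry V W 0 0 (u - v) w = 0"
      using W.theta_entry_add_left[OF W.Omega_carrier[OF w], of 0 0 u "- v"] assms[OF W w]
      by (simp add: W.theta_entry_minus_left[OF W.Omega_carrier[OF w]])
  qed
  then show ?thesis by (simp add: class00_eq UQ.cl_eq_iff flip: e00_diff)
qed

lemma A00_unital_associative_algebra: "unital_associative_algebra (A00_algebra V)"
proof (rule unital_associative_algebraI[OF v_vector_space, where c = "class00 V" and m = "zhu_mult V"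
      and e = "vac V"])
  have simps: "monoid.mult (A00_algebra V) = monoid.mult (A_inf V)" "add (A00_algebra V) = add (A_inf V)"
    "module.smult (A00_algebra V) = module.smult (A_inf V)" "zero (A00_algebra V) = zero (A_inf V)"
    "carrier (A00_algebra V) = A00 V" "one (A00_algebra V) = class00 V (vac V)"
    by (simp_all add: A00_algebra_def)
  show "carrier (A00_algebra V) = range (class00 V)" by (simp add: simps A00_def)
  show "zero (A00_algebra V) = class00 V 0" by (simp add: simps class00_0)
  show "one (A00_algebra V) = class00 V (vac V)" by (simp add: simps)
  fix x y z c
  show "monoid.mult (A00_algebra V) (class00 V x) (class00 V y) = class00 V (zhu_mult V x y)"
    "add (A00_algebra V) (class00 V x) (class00 V y) = class00 V (x + y)"
    "module.smult (A00_algebra V) c (class00 V x) = class00 V (vscale V c x)"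
    by (simp_all add: simps class00_mult class00_add class00_smult)
  have step: "theta_entry V W 0 0 v w \<in> Omega V W 0"
    if "lower_bounded_generalized_module V W" "w \<in> Omega V W 0"
    for W :: "('v, complex poly) vmodule" and v w
    using lower_bounded_generalized_module.theta_entry_Omega[OF that(1), of w 0 0 0] that(2) by simp
  have linear: "theta_entry V W 0 0 (v + v') w = theta_entry V W 0 0 v w + theta_entry V W 0 0 v' w"
    "theta_entry V W 0 0 v (w + w') = theta_entry V W 0 0 v w + theta_entry V W 0 0 v w'"
    "theta_entry V W 0 0 (vscale V c v) w = mscale W c (theta_entry V W 0 0 v w)"
    "theta_entry V W 0 0 v (mscale W c w) = mscale W c (theta_entry V W 0 0 v w)"
    if "lower_bounded_generalized_module V W" "w \<in> Omega V W 0" "w' \<in> Omega V W 0"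
    for W :: "('v, complex poly) vmodule" and c v v' w w'
  proof -
    interpret W: lower_bounded_generalized_module V W by (rule that(1))
    note wC = W.Omega_carrier[OF that(2)] and wC' = W.Omega_carrier[OF that(3)]
    show "theta_entry V W 0 0 (v + v') w = theta_entry V W 0 0 v w + theta_entry V W 0 0 v' w"
      "theta_entry V W 0 0 v (w + w') = theta_entry V W 0 0 v w + theta_entry V W 0 0 v w'"
      "theta_entry V W 0 0 (vscale V c v) w = mscale W c (theta_entry V W 0 0 v w)"
      "theta_entry V W 0 0 v (mscale W c w) = mscale W c (theta_entry V W 0 0 v w)"
      by (rule W.theta_entry_add_left[OF wC] W.theta_entry_add_right[OF wC wC']
          W.theta_entry_scale_left[OF wC] W.theta_entry_scale_right[OF wC])+
  qed
  have vac: "theta_entry V W 0 0 (vac V) w = w"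
    if "lower_bounded_generalized_module V W" "w \<in> Omega V W 0"
    for W :: "('v, complex poly) vmodule" and w
  proof -
    interpret W: lower_bounded_generalized_module V W by (rule that(1))
    show ?thesis
      using W.theta_entry_homogeneous[OF W.Omega_carrier[OF that(2)] v_vac_grade, of 0 0]
        W.m_vacuum[OF W.Omega_carrier[OF that(2)]] by simp
  qed
  show "class00 V (zhu_mult V (zhu_mult V x y) z) = class00 V (zhu_mult V x (zhu_mult V y z))"
    by (rule class00_eqI) (simp add: theta_zhu_mult step)
  show "class00 V (zhu_mult V (vac V) x) = class00 V x"
    by (rule class00_eqI) (simp add: theta_zhu_mult step vac)
  show "class00 V (zhu_mult V x (vac V)) = class00 V x"
    by (rule class00_eqI) (simp add: theta_zhu_mult step vac)
  show "class00 V (zhu_mult V (x + y) z) = class00 V (zhu_mult V x z + zhu_mult V y z)"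
    by (rule class00_eqI) (simp add: theta_zhu_mult step linear)
  show "class00 V (zhu_mult V z (x + y)) = class00 V (zhu_mult V z x + zhu_mult V z y)"
    by (rule class00_eqI) (simp add: theta_zhu_mult step linear)
  show "class00 V (zhu_mult V (vscale V c x) y) = class00 V (vscale V c (zhu_mult V x y))"
    by (rule class00_eqI) (simp add: theta_zhu_mult step linear)
  show "class00 V (zhu_mult V x (vscale V c y)) = class00 V (vscale V c (zhu_mult V x y))"
    by (rule class00_eqI) (simp add: theta_zhu_mult step linear)
qed

section \<open>Comparison with the Zhu algebra\<close>

definition zhu_pre :: "(complex, 'v) module"
  where "zhu_pre = \<lparr>carrier = UNIV, monoid.mult = zhu_mult V, one = vac V, zero = 0, add = (+),
    module.smult = vscale V\<rparr>"

sublocale ZO: linear_quotient zhu_pre "zhu_O V"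
  by unfold_locales
    (simp_all add: zhu_pre_def zhu_O_def vs.span_zero vs.span_add vs.span_neg vs.span_scale
      vs.scale_right_diff_distrib)

text \<open>Both sides are \<open>V\<close> modulo \<open>zhu_O V\<close> with the product of
  \<open>zhu_mult\<close>. That this product is well defined on cosets of \<open>zhu_O V\<close> is
  read off from \<open>class00_mult\<close>.\<close>

lemma A00_iso_zhu_algebra: "\<exists>h. h \<in> algebra_iso (A00_algebra V) (zhu_algebra V)"
proof -
  have Z: "zhu_algebra V = quotient_algebra zhu_pre (zhu_O V)"
    by (simp add: zhu_algebra_def zhu_pre_def)
  define h where "h X = ZO.cl (SOME v. X = class00 V v)" for X
  have cl_iff: "ZO.cl u = ZO.cl v \<longleftrightarrow> class00 V u = class00 V v" for u v
    by (simp add: class00_eq_iff ZO.cl_eq_iff)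
  have h: "h (class00 V v) = ZO.cl v" for v
    unfolding h_def cl_iff by (rule someI2[of _ v]) simp_all
  have mult: "monoid.mult (zhu_algebra V) (ZO.cl u) (ZO.cl v) = ZO.cl (zhu_mult V u v)" for u v
    unfolding Z
  proof (rule ZO.quotient_mult)
    fix a b assume "a \<in> ZO.cl u" "b \<in> ZO.cl v"
    then have "class00 V a = class00 V u" "class00 V b = class00 V v"
      by (simp_all add: class00_eq_iff ZO.in_cl)
    then have "class00 V (zhu_mult V a b) = class00 V (zhu_mult V u v)"
      by (simp flip: class00_mult)
    then show "a \<otimes>\<^bsub>zhu_pre\<^esub> b - zhu_mult V u v \<in> zhu_O V"
      by (simp add: class00_eq_iff zhu_pre_def)
  qed
  have A: "carrier (A00_algebra V) = range (class00 V)" by (simp add: A00_algebra_def A00_def)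
  have C: "carrier (zhu_algebra V) = range ZO.cl"
    unfolding Z ZO.quotient_carrier by (simp add: zhu_pre_def)
  have "h \<in> ring_hom (A00_algebra V) (zhu_algebra V)"
  proof (rule ring_hom_memI)
    show "h \<one>\<^bsub>A00_algebra V\<^esub> = \<one>\<^bsub>zhu_algebra V\<^esub>"
      unfolding Z ZO.quotient_one by (simp add: A00_algebra_def h zhu_pre_def)
  next
    fix x assume "x \<in> carrier (A00_algebra V)"
    then show "h x \<in> carrier (zhu_algebra V)" by (auto simp: A C h)
  next
    fix x y assume "x \<in> carrier (A00_algebra V)" "y \<in> carrier (A00_algebra V)"
    then obtain u v where "x = class00 V u" "y = class00 V v" by (auto simp: A)
    then show "h (x \<otimes>\<^bsub>A00_algebra V\<^esub> y) = h x \<otimes>\<^bsub>zhu_algebra V\<^esub> h y"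
      "h (x \<oplus>\<^bsub>A00_algebra V\<^esub> y) = h x \<oplus>\<^bsub>zhu_algebra V\<^esub> h y"
      by (simp_all add: A00_algebra_def class00_mult class00_add h mult)
        (simp add: Z ZO.quotient_add)
  qed
  moreover have "bij_betw h (carrier (A00_algebra V)) (carrier (zhu_algebra V))"
    unfolding bij_betw_def A C by (auto simp: inj_on_def h cl_iff image_image)
  moreover have "h (c \<odot>\<^bsub>A00_algebra V\<^esub> x) = c \<odot>\<^bsub>zhu_algebra V\<^esub> h x"
    if "x \<in> carrier (A00_algebra V)" for c x
  proof -
    obtain v where "x = class00 V v" using \<open>x \<in> carrier (A00_algebra V)\<close> by (auto simp: A)
    then show ?thesis
      unfolding Z by (simp add: A00_algebra_def class00_smult h ZO.quotient_smult) (simp add: zhu_pre_def)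
  qed
  ultimately show ?thesis
    unfolding algebra_iso_def ring_iso_def by blast
qed

text \<open>The Jacobi identity with \<open>r = 0\<close>, \<open>p = 1\<close>,
  \<open>q = a - 1\<close> gives the commutator of \<open>\<omega>_1\<close> with the zero mode of
  \<open>v\<close>: it is
  \<open>(L(-1) v)_a + (L(0) v)_(a-1) = - a v_(a-1) + a v_(a-1) = 0\<close>.\<close>

lemma class00_conformal_central:
  assumes "vertex_operator_algebra V \<omega>"
  shows "class00 V \<omega> \<in> algebra_center (A00_algebra V)"
proof -
  interpret \<omega>: vertex_operator_algebra V \<omega> by fact
  have "class00 V (zhu_mult V \<omega> v) = class00 V (zhu_mult V v \<omega>)" for v
  proof (rule class00_eqI)
    fix W :: "('v, complex poly) vmodule" and w
    assume W: "lower_bounded_generalized_module V W" and w: "w \<in> Omega V W 0"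
    interpret W: lower_bounded_generalized_module V W by (rule W)
    note wC = W.Omega_carrier[OF w]
    have "theta_entry V W 0 0 \<omega> (theta_entry V W 0 0 v w) = theta_entry V W 0 0 v (theta_entry V W 0 0 \<omega> w)"
      (is "?P v")
    proof (rule homogeneous_induct[of ?P v])
      fix a v assume v: "v \<in> vgrade V a"
      have "Sum_any (\<lambda>i::nat. mscale W (of_int 1 gchoose i)
          (mY W (vY V \<omega> (0 + int i) v) (1 + (a - 1) - int i) w)) =
        (\<Sum>i<2. mscale W (of_int 1 gchoose i) (mY W (vY V \<omega> (0 + int i) v) (1 + (a - 1) - int i) w))"
      proof (rule Sum_any_eq_lessThan)
        fix i :: nat assume "2 \<le> i"
        then have "(of_int 1 gchoose i :: complex) = 0"
          using binomial_gbinomial[of 1 i, where 'a = complex] by (simp add: binomial_eq_0)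
        then show "mscale W (of_int 1 gchoose i) (mY W (vY V \<omega> (0 + int i) v) (1 + (a - 1) - int i) w) = 0"
          by simp
      qed
      also have "\<dots> = mY W (vLm1 V v) a w + mY W (vL0 V v) (a - 1) w"
        by (simp add: numeral_2_eq_2 \<omega>.omega_L0 \<omega>.omega_Lm1)
      also have "\<dots> = 0"
        by (simp add: W.m_Lm1_derivative[OF wC] v_L0_grade[OF v] W.mY_scale_left[OF wC])
      finally have "Sum_any (\<lambda>i::nat. mscale W ((-1) ^ i * (of_int 0 gchoose i))
          (mY W \<omega> (1 + 0 - int i) (mY W v (a - 1 + int i) w)))
        = Sum_any (\<lambda>i::nat. mscale W ((-1) powi 0 * (-1) ^ i * (of_int 0 gchoose i))
          (mY W v (a - 1 + 0 - int i) (mY W \<omega> (1 + int i) w)))"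
        using W.m_jacobi_coefficient[OF wC, of 0 \<omega> 1 v "a - 1"] by simp
      moreover have "Sum_any (\<lambda>i::nat. mscale W ((-1) ^ i * (of_int 0 gchoose i)) (g i)) = g 0"
        for g :: "nat \<Rightarrow> complex poly"
        by (subst Sum_any_eq_lessThan[of 1]) (auto simp: gbinomial_0_left)
      ultimately have "mY W \<omega> 1 (mY W v (a - 1) w) = mY W v (a - 1) (mY W \<omega> 1 w)"
        by simp
      then show "?P v"
        by (simp add: W.theta_entry_homogeneous[OF wC v] W.theta_entry_homogeneous[OF wC \<omega>.omega_grade]
            W.theta_entry_homogeneous[OF W.m_Y_closed[OF wC] v]
            W.theta_entry_homogeneous[OF W.m_Y_closed[OF wC] \<omega>.omega_grade])
    next
      fix v v' assume "?P v" "?P v'"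
      then show "?P (v + v')"
        by (simp add: W.theta_entry_add_left wC W.theta_entry_add_right W.theta_entry_closed)
    qed
    then show "theta_entry V W 0 0 (zhu_mult V \<omega> v) w = theta_entry V W 0 0 (zhu_mult V v \<omega>) w"
      by (simp add: theta_zhu_mult[OF W w])
  qed
  then show ?thesis
    by (auto simp: algebra_center_def A00_algebra_def A00_def class00_mult)
qed

end

theorem theorem4p1:
  fixes V :: "'v::ab_group_add vertex_algebra"
  assumes "grading_restricted_vertex_algebra V"
  shows "nonunital_subalgebra (A00 V) (A_inf V)
    \<and> unital_associative_algebra (A00_algebra V)
    \<and> (\<exists>h. h \<in> algebra_iso (A00_algebra V) (zhu_algebra V))
    \<and> (\<forall>\<omega>. vertex_operator_algebra V \<omega> \<longrightarrow>
          class00 V \<omega> \<in> algebra_center (A00_algebra V))"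
proof -
  interpret grading_restricted_vertex_algebra V by fact
  show ?thesis
    using A00_subalgebra A00_unital_associative_algebra A00_iso_zhu_algebra class00_conformal_central
    by blast
qed

end
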